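(* Let $D$ be a special torsion-free affine connection on an $n$-manifold $M$ ($n\ge 2$) and let $g$ be its Patterson--Walker metric on $\widetilde M=T^*M$. (a) Any infinitesimal symmetry $v^A$ of the affine connection $D$ induces (by the lift $\tilde v_0$ defined in the context) a Killing field $\tilde v_0$ of $g$. (b) Any parallel bivector $w^{AB}=w^{[AB]}$, $D_Cw^{AB}=0$, which satisfies the integrability condition $w^{B(A}R_{B(C}{}^{D)}{}_{E)}=0$, induces (by the lift $\tilde v_+$) a Killing field $\tilde v_+$ of $g$. (c) Any Killing $1$-form $\alpha_A$, $D_{(A}\alpha_{B)}=0$, induces (by the lift $\tilde v_-$) a Killing field $\tilde v_-$ of $g$. In fact, any Killing field of $g$ can be uniquely decomposed as a direct sum $\tilde v_++\tilde v_0+\tilde v_-$ of lifts of solutions to the respective affine equations in (b), (a), (c).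
   Context: A torsion-free affine connection is special if it preserves a volume form. Curvature: $R_{AB}{}^C{}_Dv^D=2D_{[A}D_{B]}v^C$. In local coordinates $x^A$ in which the preserved volume form is a constant multiple of $dx^1\wedge\dots\wedge dx^n$, with fibre coordinates $p_A$ on $T^*M$ such that $p_Adx^A$ is the tautological $1$-form, the Patterson--Walker metric is $g=2\,dx^A\odot dp_A-2\,\Gamma_A{}^C{}_B\,p_C\,dx^A\odot dx^B$, with $\alpha\odot\beta=\frac12(\alpha\otimes\beta+\beta\otimes\alpha)$ and $\Gamma_A{}^C{}_B$ the Christoffel symbols of $D$. Put $h_A=\frac{\partial}{\partial x^A}+\Gamma_A{}^C{}_Bp_C\frac{\partial}{\partial p_B}$ and $k=2p_A\frac{\partial}{\partial p_A}$. An infinitesimal symmetry of $D$ is a vector field $v$ with $\mathcal L_vD_AX^B=D_A\mathcal L_vX^B$ for all $X$, equivalently $D_AD_Bv^C+v^DR_{DA}{}^C{}_B=0$. Lifts: with $\psi=\frac1nD_Cv^C$ and $\phi_A^B=D_Av^B-\frac1n\delta_A^BD_Cv^C$, $\tilde v_0=v^Ah_A-\phi_B^Ap_A\frac{\partial}{\partial p_B}-\frac12\psi k$, $\quad\tilde v_+=w^{AB}p_Ah_B$, $\quad\tilde v_-=\alpha_A\frac{\partial}{\partial p_A}$. *)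

theory Defs
  imports "HOL-Analysis.Analysis"
begin

text \<open>Smooth (infinitely often differentiable) maps; intended for open sets \<open>S\<close>.\<close>

primrec Ck_on :: "nat \<Rightarrow> ('e::real_normed_vector \<Rightarrow> 'f::real_normed_vector) \<Rightarrow> 'e set \<Rightarrow> bool" where
  "Ck_on 0 f S \<longleftrightarrow> continuous_on S f"
| "Ck_on (Suc k) f S \<longleftrightarrow> (\<forall>x\<in>S. f differentiable (at x)) \<and>
     (\<forall>h. Ck_on k (\<lambda>x. frechet_derivative f (at x) h) S)"

definition smooth_on :: "'e set \<Rightarrow> ('e::real_normed_vector \<Rightarrow> 'f::real_normed_vector) \<Rightarrow> bool" where
  "smooth_on S f \<longleftrightarrow> (\<forall>k. Ck_on k f S)"

text \<open>
  A manifold modelled on \<open>'e\<close> is given by an indexed atlas of coordinate maps on subsets of \<open>'a\<close>;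
  its set of points is the union of the chart domains, and its topology is the one for which the
  charts are homeomorphisms onto open sets. The atlas need not be maximal. Indexing the charts lets
  the cotangent bundle carry an atlas with the same index set.
\<close>

record ('i, 'a, 'e) atlas =
  idx :: "'i set"
  chart_dom :: "'i \<Rightarrow> 'a set"
  coord :: "'i \<Rightarrow> 'a \<Rightarrow> 'e"

definition points :: "('i, 'a, 'e) atlas \<Rightarrow> 'a set" where
  "points M = (\<Union>i\<in>idx M. chart_dom M i)"

definition chart_range :: "('i, 'a, 'e) atlas \<Rightarrow> 'i \<Rightarrow> 'e set" where
  "chart_range M i = coord M i ` chart_dom M i"

definition overlap :: "('i, 'a, 'e) atlas \<Rightarrow> 'i \<Rightarrow> 'i \<Rightarrow> 'e set" where
  "overlap M i j = coord M i ` (chart_dom M i \<inter> chart_dom M j)"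

definition transition :: "('i, 'a, 'e) atlas \<Rightarrow> 'i \<Rightarrow> 'i \<Rightarrow> 'e \<Rightarrow> 'e" where
  "transition M i j u = coord M j (inv_into (chart_dom M i) (coord M i) u)"

definition manifold_topology :: "('i, 'a, 'e::topological_space) atlas \<Rightarrow> 'a topology" where
  "manifold_topology M =
     topology (\<lambda>U. U \<subseteq> points M \<and> (\<forall>i\<in>idx M. open (coord M i ` (U \<inter> chart_dom M i))))"

definition smooth_manifold :: "('i, 'a, 'e::euclidean_space) atlas \<Rightarrow> bool" where
  "smooth_manifold M \<longleftrightarrow>
     (\<forall>i\<in>idx M. inj_on (coord M i) (chart_dom M i)) \<and>
     (\<forall>i\<in>idx M. \<forall>j\<in>idx M. open (overlap M i j) \<and> smooth_on (overlap M i j) (transition M i j)) \<and>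
     Hausdorff_space (manifold_topology M) \<and> second_countable (manifold_topology M)"

lemma openin_manifold_topology:
  assumes "\<forall>i\<in>idx M. inj_on (coord M i) (chart_dom M i)"
  shows "openin (manifold_topology M) U \<longleftrightarrow>
    U \<subseteq> points M \<and> (\<forall>i\<in>idx M. open (coord M i ` (U \<inter> chart_dom M i)))"
proof -
  have "istopology (\<lambda>U. U \<subseteq> points M \<and> (\<forall>i\<in>idx M. open (coord M i ` (U \<inter> chart_dom M i))))"
    unfolding istopology_def
  proof (intro conjI allI impI ballI)
    fix S T i
    assume S: "S \<subseteq> points M \<and> (\<forall>i\<in>idx M. open (coord M i ` (S \<inter> chart_dom M i)))"
      and T: "T \<subseteq> points M \<and> (\<forall>i\<in>idx M. open (coord M i ` (T \<inter> chart_dom M i)))"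
    show "S \<inter> T \<subseteq> points M" using S by blast
    assume i: "i \<in> idx M"
    have "coord M i ` (S \<inter> T \<inter> chart_dom M i)
        = coord M i ` (S \<inter> chart_dom M i) \<inter> coord M i ` (T \<inter> chart_dom M i)"
      using assms i unfolding inj_on_def by blast
    then show "open (coord M i ` (S \<inter> T \<inter> chart_dom M i))"
      using S T i by (simp add: open_Int)
  next
    fix K assume K: "\<forall>U\<in>K. U \<subseteq> points M \<and> (\<forall>i\<in>idx M. open (coord M i ` (U \<inter> chart_dom M i)))"
    show "\<Union>K \<subseteq> points M" using K by blast
    fix i assume i: "i \<in> idx M"
    have "coord M i ` (\<Union>K \<inter> chart_dom M i) = (\<Union>U\<in>K. coord M i ` (U \<inter> chart_dom M i))" by blast
    then show "open (coord M i ` (\<Union>K \<inter> chart_dom M i))" using K i by auto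
  qed
  then show ?thesis unfolding manifold_topology_def by (simp add: topology_inverse')
qed

definition jac :: "('i, 'a, 'e::euclidean_space) atlas \<Rightarrow> 'i \<Rightarrow> 'i \<Rightarrow> 'e \<Rightarrow> 'e \<Rightarrow> 'e" where
  "jac M i j u = frechet_derivative (transition M i j) (at u)"

text \<open>
  Tensor fields are families of components, one component function on each \<open>chart_range\<close>, obeying the
  transformation law on overlaps. Components of vector fields, 1-forms and bivector fields are
  required to vanish off the chart ranges, so that equality of fields is equality of functions.
\<close>

definition supported :: "('i, 'a, 'e) atlas \<Rightarrow> ('i \<Rightarrow> 'e \<Rightarrow> 'f::zero) \<Rightarrow> bool" where
  "supported M X \<longleftrightarrow> (\<forall>i u. i \<notin> idx M \<or> u \<notin> chart_range M i \<longrightarrow> X i u = 0)"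

definition on_charts :: "('i, 'a, 'e) atlas \<Rightarrow> ('i \<Rightarrow> 'e \<Rightarrow> 'f::zero) \<Rightarrow> 'i \<Rightarrow> 'e \<Rightarrow> 'f" where
  "on_charts M X i u = (if i \<in> idx M \<and> u \<in> chart_range M i then X i u else 0)"

definition vector_field :: "('i, 'a, 'e::euclidean_space) atlas \<Rightarrow> ('i \<Rightarrow> 'e \<Rightarrow> 'e) \<Rightarrow> bool" where
  "vector_field M X \<longleftrightarrow>
     supported M X \<and>
     (\<forall>i\<in>idx M. smooth_on (chart_range M i) (X i)) \<and>
     (\<forall>i\<in>idx M. \<forall>j\<in>idx M. \<forall>u\<in>overlap M i j. X j (transition M i j u) = jac M i j u (X i u))"

definition one_form :: "('i, 'a, real^'n) atlas \<Rightarrow> ('i \<Rightarrow> real^'n \<Rightarrow> real^'n) \<Rightarrow> bool" where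
  "one_form M \<alpha> \<longleftrightarrow>
     supported M \<alpha> \<and>
     (\<forall>i\<in>idx M. smooth_on (chart_range M i) (\<alpha> i)) \<and>
     (\<forall>i\<in>idx M. \<forall>j\<in>idx M. \<forall>x\<in>overlap M i j. \<forall>A.
        \<alpha> i x $ A = (\<Sum>B\<in>UNIV. jac M i j x (axis A 1) $ B * \<alpha> j (transition M i j x) $ B))"

definition bivector_field :: "('i, 'a, real^'n) atlas \<Rightarrow> ('i \<Rightarrow> real^'n \<Rightarrow> real^'n^'n) \<Rightarrow> bool" where
  "bivector_field M w \<longleftrightarrow>
     supported M w \<and>
     (\<forall>i\<in>idx M. smooth_on (chart_range M i) (w i)) \<and>
     (\<forall>i\<in>idx M. \<forall>j\<in>idx M. \<forall>x\<in>overlap M i j. \<forall>C D.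
        w j (transition M i j x) $ C $ D =
          (\<Sum>A\<in>UNIV. \<Sum>B\<in>UNIV. jac M i j x (axis A 1) $ C * jac M i j x (axis B 1) $ D * w i x $ A $ B)) \<and>
     (\<forall>i\<in>idx M. \<forall>x\<in>chart_range M i. \<forall>A B. w i x $ A $ B = - (w i x $ B $ A))"

text \<open>\<open>\<omega> i\<close> is the coefficient of \<open>dx\<^sup>1 \<and> \<dots> \<and> dx\<^sup>n\<close>.\<close>

definition volume_form :: "('i, 'a, real^'n) atlas \<Rightarrow> ('i \<Rightarrow> real^'n \<Rightarrow> real) \<Rightarrow> bool" where
  "volume_form M \<omega> \<longleftrightarrow>
     (\<forall>i\<in>idx M. smooth_on (chart_range M i) (\<omega> i)) \<and>
     (\<forall>i\<in>idx M. \<forall>x\<in>chart_range M i. \<omega> i x \<noteq> 0) \<and>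
     (\<forall>i\<in>idx M. \<forall>j\<in>idx M. \<forall>x\<in>overlap M i j.
        \<omega> i x = det (matrix (jac M i j x)) * \<omega> j (transition M i j x))"

definition pd :: "'n::finite \<Rightarrow> (real^'n \<Rightarrow> real) \<Rightarrow> real^'n \<Rightarrow> real" where
  "pd A f x = frechet_derivative f (at x) (axis A 1)"

text \<open>
  An affine connection is given by its Christoffel symbols: \<open>\<Gamma> i x A C B\<close> stands for
  \<open>\<Gamma>\<^sub>A\<^sup>C\<^sub>B\<close> in the chart \<open>i\<close>, so that \<open>D\<^sub>A v\<^sup>C = \<partial>\<^sub>A v\<^sup>C + \<Gamma>\<^sub>A\<^sup>C\<^sub>B v\<^sup>B\<close>.
\<close>

type_synonym 'n christoffel = "real^'n \<Rightarrow> 'n \<Rightarrow> 'n \<Rightarrow> 'n \<Rightarrow> real"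

definition affine_connection :: "('i, 'a, real^'n) atlas \<Rightarrow> ('i \<Rightarrow> 'n christoffel) \<Rightarrow> bool" where
  "affine_connection M \<Gamma> \<longleftrightarrow>
     (\<forall>i\<in>idx M. \<forall>A C B. smooth_on (chart_range M i) (\<lambda>x. \<Gamma> i x A C B)) \<and>
     (\<forall>i\<in>idx M. \<forall>j\<in>idx M. \<forall>x\<in>overlap M i j. \<forall>A B E.
        (\<Sum>C\<in>UNIV. jac M i j x (axis C 1) $ E * \<Gamma> i x A C B) =
          pd A (\<lambda>y. jac M i j y (axis B 1) $ E) x +
          (\<Sum>F\<in>UNIV. \<Sum>G\<in>UNIV. jac M i j x (axis A 1) $ F * jac M i j x (axis B 1) $ G *
              \<Gamma> j (transition M i j x) F E G))"

definition torsion_free :: "('i, 'a, real^'n) atlas \<Rightarrow> ('i \<Rightarrow> 'n christoffel) \<Rightarrow> bool" where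
  "torsion_free M \<Gamma> \<longleftrightarrow> (\<forall>i\<in>idx M. \<forall>x\<in>chart_range M i. \<forall>A B C. \<Gamma> i x A C B = \<Gamma> i x B C A)"

definition special :: "('i, 'a, real^'n) atlas \<Rightarrow> ('i \<Rightarrow> 'n christoffel) \<Rightarrow> bool" where
  "special M \<Gamma> \<longleftrightarrow> (\<exists>\<omega>. volume_form M \<omega> \<and>
     (\<forall>i\<in>idx M. \<forall>x\<in>chart_range M i. \<forall>A. pd A (\<omega> i) x - (\<Sum>C\<in>UNIV. \<Gamma> i x A C C) * \<omega> i x = 0))"

text \<open>Covariant derivatives \<open>D\<^sub>A v\<^sup>C\<close>, \<open>D\<^sub>A \<alpha>\<^sub>B\<close>, \<open>D\<^sub>A T\<^sub>B\<^sup>C\<close> and \<open>D\<^sub>C w\<^sup>A\<^sup>B\<close> in a chart; \<open>T x B C\<close> is \<open>T\<^sub>B\<^sup>C\<close>.\<close>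

definition cov_vec :: "'n::finite christoffel \<Rightarrow> (real^'n \<Rightarrow> real^'n) \<Rightarrow> real^'n \<Rightarrow> 'n \<Rightarrow> 'n \<Rightarrow> real" where
  "cov_vec G v x A C = pd A (\<lambda>y. v y $ C) x + (\<Sum>B\<in>UNIV. G x A C B * v x $ B)"

definition cov_form :: "'n::finite christoffel \<Rightarrow> (real^'n \<Rightarrow> real^'n) \<Rightarrow> real^'n \<Rightarrow> 'n \<Rightarrow> 'n \<Rightarrow> real" where
  "cov_form G \<alpha> x A B = pd A (\<lambda>y. \<alpha> y $ B) x - (\<Sum>C\<in>UNIV. G x A C B * \<alpha> x $ C)"

definition cov_endo :: "'n::finite christoffel \<Rightarrow> (real^'n \<Rightarrow> 'n \<Rightarrow> 'n \<Rightarrow> real) \<Rightarrow>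
    real^'n \<Rightarrow> 'n \<Rightarrow> 'n \<Rightarrow> 'n \<Rightarrow> real" where
  "cov_endo G T x A B C = pd A (\<lambda>y. T y B C) x
     - (\<Sum>E\<in>UNIV. G x A E B * T x E C) + (\<Sum>E\<in>UNIV. G x A C E * T x B E)"

definition cov_biv :: "'n::finite christoffel \<Rightarrow> (real^'n \<Rightarrow> real^'n^'n) \<Rightarrow>
    real^'n \<Rightarrow> 'n \<Rightarrow> 'n \<Rightarrow> 'n \<Rightarrow> real" where
  "cov_biv G w x C A B = pd C (\<lambda>y. w y $ A $ B) x
     + (\<Sum>E\<in>UNIV. G x C A E * w x $ E $ B) + (\<Sum>E\<in>UNIV. G x C B E * w x $ A $ E)"

text \<open>
  \<open>curvature G x A B C E\<close> is \<open>R\<^sub>A\<^sub>B\<^sup>C\<^sub>E\<close>, read off from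
  \<open>R\<^sub>A\<^sub>B\<^sup>C\<^sub>E v\<^sup>E = D\<^sub>A D\<^sub>B v\<^sup>C - D\<^sub>B D\<^sub>A v\<^sup>C\<close> by taking for \<open>v\<close> the coordinate vector field of index \<open>E\<close>
  (the right-hand side is tensorial in \<open>v\<close> since \<open>D\<close> is torsion-free).
\<close>

definition curvature :: "'n::finite christoffel \<Rightarrow> real^'n \<Rightarrow> 'n \<Rightarrow> 'n \<Rightarrow> 'n \<Rightarrow> 'n \<Rightarrow> real" where
  "curvature G x A B C E =
     cov_endo G (cov_vec G (\<lambda>_. axis E 1)) x A B C - cov_endo G (cov_vec G (\<lambda>_. axis E 1)) x B A C"

definition lie_vec :: "(real^'n \<Rightarrow> real^'n) \<Rightarrow> (real^'n \<Rightarrow> real^'n) \<Rightarrow> real^'n \<Rightarrow> real^'n" where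
  "lie_vec v X x = (\<chi> B. (\<Sum>C\<in>UNIV. v x $ C * pd C (\<lambda>y. X y $ B) x)
                       - (\<Sum>C\<in>UNIV. X x $ C * pd C (\<lambda>y. v y $ B) x))"

definition lie_endo :: "(real^'n \<Rightarrow> real^'n) \<Rightarrow> (real^'n \<Rightarrow> 'n \<Rightarrow> 'n \<Rightarrow> real) \<Rightarrow>
    real^'n \<Rightarrow> 'n \<Rightarrow> 'n \<Rightarrow> real" where
  "lie_endo v T x A B = (\<Sum>C\<in>UNIV. v x $ C * pd C (\<lambda>y. T y A B) x)
     + (\<Sum>C\<in>UNIV. pd A (\<lambda>y. v y $ C) x * T x C B) - (\<Sum>C\<in>UNIV. T x A C * pd C (\<lambda>y. v y $ B) x)"

text \<open>The test fields \<open>X\<close> range over vector fields on arbitrary open subsets of chart domains.\<close>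

definition infinitesimal_symmetry ::
    "('i, 'a, real^'n) atlas \<Rightarrow> ('i \<Rightarrow> 'n christoffel) \<Rightarrow> ('i \<Rightarrow> real^'n \<Rightarrow> real^'n) \<Rightarrow> bool" where
  "infinitesimal_symmetry M \<Gamma> v \<longleftrightarrow>
     vector_field M v \<and>
     (\<forall>i\<in>idx M. \<forall>U X. open U \<and> U \<subseteq> chart_range M i \<and> smooth_on U X \<longrightarrow>
        (\<forall>x\<in>U. \<forall>A B. lie_endo (v i) (cov_vec (\<Gamma> i) X) x A B = cov_vec (\<Gamma> i) (lie_vec (v i) X) x A B))"

definition parallel_bivector ::
    "('i, 'a, real^'n) atlas \<Rightarrow> ('i \<Rightarrow> 'n christoffel) \<Rightarrow> ('i \<Rightarrow> real^'n \<Rightarrow> real^'n^'n) \<Rightarrow> bool" where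
  "parallel_bivector M \<Gamma> w \<longleftrightarrow>
     bivector_field M w \<and>
     (\<forall>i\<in>idx M. \<forall>x\<in>chart_range M i. \<forall>C A B. cov_biv (\<Gamma> i) (w i) x C A B = 0)"

definition w_curvature ::
    "'n::finite christoffel \<Rightarrow> (real^'n \<Rightarrow> real^'n^'n) \<Rightarrow> real^'n \<Rightarrow> 'n \<Rightarrow> 'n \<Rightarrow> 'n \<Rightarrow> 'n \<Rightarrow> real" where
  "w_curvature G w x A C D E = (\<Sum>B\<in>UNIV. w x $ B $ A * curvature G x B C D E)"

text \<open>\<open>w\<^sup>B\<^sup>(\<^sup>A R\<^sub>B\<^sub>(\<^sub>C\<^sup>D\<^sup>)\<^sub>E\<^sub>) = 0\<close>, symmetrized over \<open>A, D\<close> and over \<open>C, E\<close>.\<close>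

definition integrability_condition ::
    "('i, 'a, real^'n) atlas \<Rightarrow> ('i \<Rightarrow> 'n christoffel) \<Rightarrow> ('i \<Rightarrow> real^'n \<Rightarrow> real^'n^'n) \<Rightarrow> bool" where
  "integrability_condition M \<Gamma> w \<longleftrightarrow>
     (\<forall>i\<in>idx M. \<forall>x\<in>chart_range M i. \<forall>A C D E.
        (w_curvature (\<Gamma> i) (w i) x A C D E + w_curvature (\<Gamma> i) (w i) x D C A E
         + w_curvature (\<Gamma> i) (w i) x A E D C + w_curvature (\<Gamma> i) (w i) x D E A C) / 4 = 0)"

definition killing_form ::
    "('i, 'a, real^'n) atlas \<Rightarrow> ('i \<Rightarrow> 'n christoffel) \<Rightarrow> ('i \<Rightarrow> real^'n \<Rightarrow> real^'n) \<Rightarrow> bool" where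
  "killing_form M \<Gamma> \<alpha> \<longleftrightarrow>
     one_form M \<alpha> \<and>
     (\<forall>i\<in>idx M. \<forall>x\<in>chart_range M i. \<forall>A B.
        (cov_form (\<Gamma> i) (\<alpha> i) x A B + cov_form (\<Gamma> i) (\<alpha> i) x B A) / 2 = 0)"

text \<open>A covector at the point \<open>m\<close> is the family of its components in the charts around \<open>m\<close>.\<close>

definition covector_at :: "('i, 'a, real^'n) atlas \<Rightarrow> 'a \<Rightarrow> ('i \<Rightarrow> real^'n) \<Rightarrow> bool" where
  "covector_at M m \<xi> \<longleftrightarrow>
     (\<forall>i. i \<notin> idx M \<or> m \<notin> chart_dom M i \<longrightarrow> \<xi> i = 0) \<and>
     (\<forall>i\<in>idx M. \<forall>j\<in>idx M. m \<in> chart_dom M i \<inter> chart_dom M j \<longrightarrow>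
        (\<forall>A. \<xi> i $ A = (\<Sum>B\<in>UNIV. jac M i j (coord M i m) (axis A 1) $ B * \<xi> j $ B)))"

text \<open>In the chart \<open>i\<close> of \<open>T\<^sup>*M\<close> the coordinates are \<open>(x, p)\<close> with tautological 1-form \<open>p\<^sub>A dx\<^sup>A\<close>.\<close>

definition cotangent_bundle ::
    "('i, 'a, real^'n) atlas \<Rightarrow> ('i, 'a \<times> ('i \<Rightarrow> real^'n), (real^'n) \<times> (real^'n)) atlas" where
  "cotangent_bundle M =
     \<lparr> idx = idx M,
       chart_dom = (\<lambda>i. {(m, \<xi>). m \<in> chart_dom M i \<and> covector_at M m \<xi>}),
       coord = (\<lambda>i (m, \<xi>). (coord M i m, \<xi> i)) \<rparr>"

definition tensor02 :: "('i, 'a, 'e::euclidean_space) atlas \<Rightarrow> ('i \<Rightarrow> 'e \<Rightarrow> 'e \<Rightarrow> 'e \<Rightarrow> real) \<Rightarrow> bool" where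
  "tensor02 M g \<longleftrightarrow>
     (\<forall>i\<in>idx M. \<forall>u\<in>chart_range M i. bilinear (g i u)) \<and>
     (\<forall>i\<in>idx M. \<forall>Y Z. smooth_on (chart_range M i) (\<lambda>u. g i u Y Z)) \<and>
     (\<forall>i\<in>idx M. \<forall>j\<in>idx M. \<forall>u\<in>overlap M i j. \<forall>Y Z.
        g i u Y Z = g j (transition M i j u) (jac M i j u Y) (jac M i j u Z))"

text \<open>The Lie derivative of \<open>g\<close> along \<open>X\<close> in a chart, evaluated on constant vectors \<open>Y, Z\<close>.\<close>

definition lie_metric :: "('e::euclidean_space \<Rightarrow> 'e) \<Rightarrow> ('e \<Rightarrow> 'e \<Rightarrow> 'e \<Rightarrow> real) \<Rightarrow> 'e \<Rightarrow> 'e \<Rightarrow> 'e \<Rightarrow> real" where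
  "lie_metric X g u Y Z =
     frechet_derivative (\<lambda>y. g y Y Z) (at u) (X u)
     + g u (frechet_derivative X (at u) Y) Z + g u Y (frechet_derivative X (at u) Z)"

definition killing_field ::
    "('i, 'a, 'e::euclidean_space) atlas \<Rightarrow> ('i \<Rightarrow> 'e \<Rightarrow> 'e \<Rightarrow> 'e \<Rightarrow> real) \<Rightarrow> ('i \<Rightarrow> 'e \<Rightarrow> 'e) \<Rightarrow> bool" where
  "killing_field M g X \<longleftrightarrow>
     vector_field M X \<and>
     (\<forall>i\<in>idx M. \<forall>u\<in>chart_range M i. \<forall>Y Z. lie_metric (X i) (g i) u Y Z = 0)"

definition odot :: "('e \<Rightarrow> real) \<Rightarrow> ('e \<Rightarrow> real) \<Rightarrow> 'e \<Rightarrow> 'e \<Rightarrow> real" where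
  "odot \<alpha> \<beta> Y Z = (\<alpha> Y * \<beta> Z + \<beta> Y * \<alpha> Z) / 2"

definition dx :: "'n \<Rightarrow> (real^'n) \<times> (real^'n) \<Rightarrow> real" where
  "dx A Y = fst Y $ A"

definition dp :: "'n \<Rightarrow> (real^'n) \<times> (real^'n) \<Rightarrow> real" where
  "dp A Y = snd Y $ A"

text \<open>
  The Patterson--Walker metric. It is usually written in coordinates in which the parallel volume form
  is a constant multiple of \<open>dx\<^sup>1 \<and> \<dots> \<and> dx\<^sup>n\<close>, but the expression is the same in all
  coordinates (lemma \<open>pw_metric_tensor\<close> below), so no normalization of the charts is needed: it is
  the tensor field on \<open>T\<^sup>*M\<close> given by this expression in the volume-normalized charts.
\<close>

definition pw_metric :: "('i \<Rightarrow> 'n::finite christoffel) \<Rightarrow>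
    'i \<Rightarrow> (real^'n) \<times> (real^'n) \<Rightarrow> (real^'n) \<times> (real^'n) \<Rightarrow> (real^'n) \<times> (real^'n) \<Rightarrow> real" where
  "pw_metric \<Gamma> i u Y Z =
     2 * (\<Sum>A\<in>UNIV. odot (dx A) (dp A) Y Z)
     - 2 * (\<Sum>A\<in>UNIV. \<Sum>B\<in>UNIV. \<Sum>C\<in>UNIV. \<Gamma> i (fst u) A C B * snd u $ C * odot (dx A) (dx B) Y Z)"

text \<open>The vector fields \<open>\<partial>/\<partial>p\<^sub>A\<close>, \<open>h\<^sub>A\<close> and \<open>k\<close> in a chart of \<open>T\<^sup>*M\<close>.\<close>

definition p_field :: "'n::finite \<Rightarrow> (real^'n) \<times> (real^'n)" where
  "p_field A = (0, axis A 1)"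

definition h_field :: "'n::finite christoffel \<Rightarrow> 'n \<Rightarrow> (real^'n) \<times> (real^'n) \<Rightarrow> (real^'n) \<times> (real^'n)" where
  "h_field G A u = (axis A 1, 0) + (\<Sum>B\<in>UNIV. \<Sum>C\<in>UNIV. (G (fst u) A C B * snd u $ C) *\<^sub>R p_field B)"

definition k_field :: "(real^'n::finite) \<times> (real^'n) \<Rightarrow> (real^'n) \<times> (real^'n)" where
  "k_field u = 2 *\<^sub>R (\<Sum>A\<in>UNIV. snd u $ A *\<^sub>R p_field A)"

definition psi :: "'n::finite christoffel \<Rightarrow> (real^'n \<Rightarrow> real^'n) \<Rightarrow> real^'n \<Rightarrow> real" where
  "psi G v x = 1 / real CARD('n) * (\<Sum>C\<in>UNIV. cov_vec G v x C C)"

text \<open>\<open>phi G v x A B\<close> is \<open>\<phi>\<^sub>A\<^sup>B\<close>.\<close>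

definition phi :: "'n::finite christoffel \<Rightarrow> (real^'n \<Rightarrow> real^'n) \<Rightarrow> real^'n \<Rightarrow> 'n \<Rightarrow> 'n \<Rightarrow> real" where
  "phi G v x A B = cov_vec G v x A B
     - 1 / real CARD('n) * (if A = B then 1 else 0) * (\<Sum>C\<in>UNIV. cov_vec G v x C C)"

definition lift_zero :: "('i, 'a, real^'n) atlas \<Rightarrow> ('i \<Rightarrow> 'n christoffel) \<Rightarrow> ('i \<Rightarrow> real^'n \<Rightarrow> real^'n) \<Rightarrow>
    'i \<Rightarrow> (real^'n) \<times> (real^'n) \<Rightarrow> (real^'n) \<times> (real^'n)" where
  "lift_zero M \<Gamma> v = on_charts (cotangent_bundle M) (\<lambda>i u.
     (\<Sum>A\<in>UNIV. v i (fst u) $ A *\<^sub>R h_field (\<Gamma> i) A u)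
     - (\<Sum>A\<in>UNIV. \<Sum>B\<in>UNIV. (phi (\<Gamma> i) (v i) (fst u) B A * snd u $ A) *\<^sub>R p_field B)
     - (1 / 2 * psi (\<Gamma> i) (v i) (fst u)) *\<^sub>R k_field u)"

definition lift_plus :: "('i, 'a, real^'n) atlas \<Rightarrow> ('i \<Rightarrow> 'n christoffel) \<Rightarrow> ('i \<Rightarrow> real^'n \<Rightarrow> real^'n^'n) \<Rightarrow>
    'i \<Rightarrow> (real^'n) \<times> (real^'n) \<Rightarrow> (real^'n) \<times> (real^'n)" where
  "lift_plus M \<Gamma> w = on_charts (cotangent_bundle M) (\<lambda>i u.
     \<Sum>A\<in>UNIV. \<Sum>B\<in>UNIV. (w i (fst u) $ A $ B * snd u $ A) *\<^sub>R h_field (\<Gamma> i) B u)"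

definition lift_minus :: "('i, 'a, real^'n) atlas \<Rightarrow> ('i \<Rightarrow> real^'n \<Rightarrow> real^'n) \<Rightarrow>
    'i \<Rightarrow> (real^'n) \<times> (real^'n) \<Rightarrow> (real^'n) \<times> (real^'n)" where
  "lift_minus M \<alpha> = on_charts (cotangent_bundle M) (\<lambda>i u.
     \<Sum>A\<in>UNIV. \<alpha> i (fst u) $ A *\<^sub>R p_field A)"

lemma Ck_on_subset: "Ck_on k f S \<Longrightarrow> T \<subseteq> S \<Longrightarrow> Ck_on k f T"
  by (induction k arbitrary: f) (auto intro: continuous_on_subset)

lemma smooth_on_subset: "smooth_on S f \<Longrightarrow> T \<subseteq> S \<Longrightarrow> smooth_on T f"
  unfolding smooth_on_def using Ck_on_subset by blast

lemma Ck_on_continuous: "Ck_on k f S \<Longrightarrow> continuous_on S f"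
  by (cases k) (auto simp: continuous_at_imp_continuous_on differentiable_imp_continuous_within)

lemma Ck_on_SucD: "Ck_on (Suc k) f S \<Longrightarrow> Ck_on k f S"
proof (induction k arbitrary: f)
  case 0 then show ?case using Ck_on_continuous by fastforce
next
  case (Suc k) then show ?case by (metis Ck_on.simps(2))
qed

lemma frechet_derivative_cong_open:
  assumes "open S" "x \<in> S" "\<And>y. y \<in> S \<Longrightarrow> f y = g y"
  shows "frechet_derivative f (at x) = frechet_derivative g (at x)"
proof -
  have "(f has_derivative D) (at x) \<longleftrightarrow> (g has_derivative D) (at x)" for D
    using assms by (metis has_derivative_transform_within_open)
  then show ?thesis by (simp add: frechet_derivative_def)
qed

lemma differentiable_cong_open:
  assumes "open S" "x \<in> S" "\<And>y. y \<in> S \<Longrightarrow> f y = g y"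
  shows "f differentiable (at x) \<longleftrightarrow> g differentiable (at x)"
  unfolding differentiable_def
  using assms by (metis has_derivative_transform_within_open)

lemma Ck_on_cong:
  assumes "open S"
  shows "(\<And>y. y \<in> S \<Longrightarrow> f y = g y) \<Longrightarrow> Ck_on k f S \<longleftrightarrow> Ck_on k g S"
proof (induction k arbitrary: f g)
  case 0 then show ?case by (simp cong: continuous_on_cong)
next
  case (Suc k)
  have "Ck_on k (\<lambda>x. frechet_derivative f (at x) h) S
      \<longleftrightarrow> Ck_on k (\<lambda>x. frechet_derivative g (at x) h) S" for h
    by (rule Suc.IH) (use frechet_derivative_cong_open[OF assms _ Suc.prems] in auto)
  moreover have "\<forall>x\<in>S. f differentiable (at x) \<longleftrightarrow> g differentiable (at x)"
    using differentiable_cong_open[OF assms _ Suc.prems] by auto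
  ultimately show ?case by simp
qed

lemma Ck_on_const: "Ck_on k (\<lambda>_. c) S"
  by (induction k arbitrary: c) auto

lemma Ck_on_add:
  assumes "open S"
  shows "Ck_on k f S \<Longrightarrow> Ck_on k g S \<Longrightarrow> Ck_on k (\<lambda>x. f x + g x) S"
proof (induction k arbitrary: f g)
  case 0 then show ?case by (simp add: continuous_on_add)
next
  case (Suc k)
  have *: "frechet_derivative (\<lambda>x. f x + g x) (at x) =
      (\<lambda>h. frechet_derivative f (at x) h + frechet_derivative g (at x) h)" if "x \<in> S" for x
    using Suc.prems that
    by (intro frechet_derivative_at[symmetric] has_derivative_add)
       (auto simp: frechet_derivative_works[symmetric])
  have "Ck_on k (\<lambda>x. frechet_derivative (\<lambda>x. f x + g x) (at x) h) S
     \<longleftrightarrow> Ck_on k (\<lambda>x. frechet_derivative f (at x) h + frechet_derivative g (at x) h) S" for h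
    by (rule Ck_on_cong[OF assms]) (simp add: *)
  then show ?case using Suc by auto
qed

lemma Ck_on_mult:
  fixes f g :: "'e::real_normed_vector \<Rightarrow> real"
  assumes "open S"
  shows "Ck_on k f S \<Longrightarrow> Ck_on k g S \<Longrightarrow> Ck_on k (\<lambda>x. f x * g x) S"
proof (induction k arbitrary: f g)
  case 0 then show ?case by (simp add: continuous_on_mult)
next
  case (Suc k)
  have *: "frechet_derivative (\<lambda>x. f x * g x) (at x) =
      (\<lambda>h. f x * frechet_derivative g (at x) h + frechet_derivative f (at x) h * g x)"
    if "x \<in> S" for x
    using Suc.prems that
    by (intro frechet_derivative_at[symmetric] has_derivative_mult)
       (auto simp: frechet_derivative_works[symmetric])
  have "Ck_on k (\<lambda>x. frechet_derivative (\<lambda>x. f x * g x) (at x) h) S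
     \<longleftrightarrow> Ck_on k (\<lambda>x. f x * frechet_derivative g (at x) h + frechet_derivative f (at x) h * g x) S" for h
    by (rule Ck_on_cong[OF assms]) (simp add: *)
  moreover have "Ck_on k (\<lambda>x. f x * frechet_derivative g (at x) h + frechet_derivative f (at x) h * g x) S" for h
    using Suc.prems Ck_on_SucD by (intro Ck_on_add[OF assms] Suc.IH) (auto simp del: Ck_on.simps, auto)
  ultimately show ?case using Suc.prems by (auto intro: differentiable_mult)
qed

lemma Ck_on_linear: "bounded_linear f \<Longrightarrow> Ck_on k f S"
proof (cases k)
  case 0 assume "bounded_linear f" then show ?thesis using 0 by (simp add: linear_continuous_on)
next
  case (Suc m) assume f: "bounded_linear f"
  have "frechet_derivative f (at x) = f" for x
    using f by (metis bounded_linear_imp_has_derivative frechet_derivative_at)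
  then show ?thesis using f Suc by (simp add: bounded_linear_imp_differentiable Ck_on_const)
qed

lemma Ck_on_compose_linear:
  assumes "bounded_linear L" "open S"
  shows "Ck_on k f S \<Longrightarrow> Ck_on k (\<lambda>x. f (L x)) (L -` S)"
proof (induction k arbitrary: f)
  case 0
  then show ?case
    using assms continuous_on_compose2[of S f "L -` S" L] by (auto simp: linear_continuous_on)
next
  case (Suc k)
  have *: "((\<lambda>x. f (L x)) has_derivative (\<lambda>h. frechet_derivative f (at (L x)) (L h))) (at x)"
    if "L x \<in> S" for x
  proof -
    have 1: "(L has_derivative L) (at x)" using assms(1) by (rule bounded_linear_imp_has_derivative)
    have 2: "(f has_derivative frechet_derivative f (at (L x))) (at (L x))"
      using Suc.prems that frechet_derivative_works by auto
    show ?thesis using has_derivative_compose[OF 1 2] .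
  qed
  have **: "frechet_derivative (\<lambda>x. f (L x)) (at x) h = frechet_derivative f (at (L x)) (L h)"
    if "L x \<in> S" for x h
    using frechet_derivative_at[OF *[OF that]] by metis
  have op: "open (L -` S)"
    using assms open_vimage linear_continuous_on by blast
  have "Ck_on k (\<lambda>x. frechet_derivative (\<lambda>x. f (L x)) (at x) h) (L -` S)
    \<longleftrightarrow> Ck_on k (\<lambda>x. frechet_derivative f (at (L x)) (L h)) (L -` S)" for h
    by (rule Ck_on_cong[OF op]) (simp add: **)
  moreover have "Ck_on k (\<lambda>x. frechet_derivative f (at (L x)) (L h)) (L -` S)" for h
    using Suc.IH[of "\<lambda>y. frechet_derivative f (at y) (L h)"] Suc.prems by simp
  moreover have "(\<lambda>x. f (L x)) differentiable (at x)" if "x \<in> L -` S" for x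
    using * that unfolding differentiable_def by blast
  ultimately show ?case by simp
qed

lemma overlap_self: "overlap M i i = chart_range M i"
  by (simp add: overlap_def chart_range_def)

lemma transition_coord:
  assumes "smooth_manifold M" "i \<in> idx M" "m \<in> chart_dom M i"
  shows "transition M i j (coord M i m) = coord M j m"
  using assms by (simp add: transition_def smooth_manifold_def)

lemma transition_in_overlap:
  assumes "smooth_manifold M" "i \<in> idx M" "x \<in> overlap M i j"
  shows "transition M i j x \<in> overlap M j i"
  using assms transition_coord[OF assms(1,2)] by (auto simp: overlap_def)

lemma has_derivative_transition:
  assumes "smooth_manifold M" "i \<in> idx M" "j \<in> idx M" "x \<in> overlap M i j"
  shows "(transition M i j has_derivative jac M i j x) (at x)"
proof -
  have "Ck_on (Suc 0) (transition M i j) (overlap M i j)"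
    using assms unfolding smooth_manifold_def smooth_on_def by blast
  then show ?thesis using assms(4) unfolding jac_def by (simp add: frechet_derivative_works)
qed

lemma jac_differentiable:
  assumes "smooth_manifold M" "i \<in> idx M" "j \<in> idx M" "x \<in> overlap M i j"
  shows "(\<lambda>y. jac M i j y h) differentiable (at x)"
proof -
  have "Ck_on (Suc (Suc 0)) (transition M i j) (overlap M i j)"
    using assms unfolding smooth_manifold_def smooth_on_def by blast
  then show ?thesis using assms(4) unfolding jac_def by simp
qed

lemma linear_jac:
  assumes "smooth_manifold M" "i \<in> idx M" "j \<in> idx M" "x \<in> overlap M i j"
  shows "linear (jac M i j x)"
  using has_derivative_transition[OF assms] has_derivative_linear by blast

lemma jac_expand:
  fixes M :: "('i, 'a, real^'n) atlas"
  assumes "smooth_manifold M" "i \<in> idx M" "j \<in> idx M" "x \<in> overlap M i j"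
  shows "jac M i j x h = (\<Sum>A\<in>UNIV. h $ A *\<^sub>R jac M i j x (axis A 1))"
proof -
  have "jac M i j x h = jac M i j x (\<Sum>A\<in>UNIV. h $ A *\<^sub>R axis A 1)"
    using basis_expansion[of h] by (simp add: scalar_mult_eq_scaleR)
  then show ?thesis
    by (simp add: linear_sum[OF linear_jac[OF assms]] linear_cmul[OF linear_jac[OF assms]])
qed

lemma jac_cocycle:
  assumes M: "smooth_manifold M" and ijk: "i \<in> idx M" "j \<in> idx M" "k \<in> idx M"
    and m: "m \<in> chart_dom M i" "m \<in> chart_dom M j" "m \<in> chart_dom M k"
  shows "jac M i k (coord M i m) h = jac M j k (coord M j m) (jac M i j (coord M i m) h)"
proof -
  let ?x = "coord M i m"
  have inj: "inj_on (coord M i) (chart_dom M i)" using M ijk by (simp add: smooth_manifold_def)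
  have ij: "?x \<in> overlap M i j" and ik: "?x \<in> overlap M i k"
    and jk: "coord M j m \<in> overlap M j k" using m by (auto simp: overlap_def)
  have eq: "transition M j k (transition M i j y) = transition M i k y"
    if "y \<in> overlap M i j \<inter> overlap M i k" for y
  proof -
    from that obtain m' where m': "y = coord M i m'" "m' \<in> chart_dom M i"
      "m' \<in> chart_dom M j" "m' \<in> chart_dom M k"
      using inj unfolding overlap_def inj_on_def by blast
    then show ?thesis using transition_coord[OF M] ijk by simp
  qed
  have op: "open (overlap M i j \<inter> overlap M i k)"
    using M ijk by (simp add: smooth_manifold_def open_Int)
  have "(transition M j k has_derivative jac M j k (coord M j m)) (at (transition M i j ?x))"
    using has_derivative_transition[OF M ijk(2,3) jk] transition_coord[OF M ijk(1) m(1)] by simp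
  then have "((\<lambda>y. transition M j k (transition M i j y)) has_derivative
      (\<lambda>h. jac M j k (coord M j m) (jac M i j ?x h))) (at ?x)"
    by (rule has_derivative_compose[OF has_derivative_transition[OF M ijk(1,2) ij]])
  then have "(transition M i k has_derivative (\<lambda>h. jac M j k (coord M j m) (jac M i j ?x h))) (at ?x)"
    by (rule has_derivative_transform_within_open[OF _ op]) (use ij ik eq in auto)
  then show ?thesis
    using has_derivative_unique[OF has_derivative_transition[OF M ijk(1,3) ik]] by metis
qed

lemma jac_self:
  assumes M: "smooth_manifold M" and i: "i \<in> idx M" and x: "x \<in> chart_range M i"
  shows "jac M i i x h = h"
proof -
  have x': "x \<in> overlap M i i" using x by (simp add: overlap_self)
  have "((\<lambda>y. y) has_derivative (\<lambda>h. h)) (at x)" by simp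
  then have "(transition M i i has_derivative (\<lambda>h. h)) (at x)"
  proof (rule has_derivative_transform_within_open)
    show "open (overlap M i i)" using M i by (simp add: smooth_manifold_def)
    show "x \<in> overlap M i i" by fact
    show "y = transition M i i y" if "y \<in> overlap M i i" for y
      using that transition_coord[OF M i] by (auto simp: overlap_def)
  qed
  then show ?thesis
    using has_derivative_unique[OF has_derivative_transition[OF M i i x']] by metis
qed

lemma covector_at_iff:
  fixes M :: "('i, 'a, real^'n) atlas"
  assumes M: "smooth_manifold M"
  shows "covector_at M m \<xi> \<longleftrightarrow>
    (\<forall>i. i \<notin> idx M \<or> m \<notin> chart_dom M i \<longrightarrow> \<xi> i = 0) \<and>
    (\<forall>i\<in>idx M. \<forall>j\<in>idx M. m \<in> chart_dom M i \<inter> chart_dom M j \<longrightarrow>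
        (\<forall>h. \<xi> i \<bullet> h = \<xi> j \<bullet> jac M i j (coord M i m) h))"
proof -
  have "(\<forall>A. \<xi> i $ A = (\<Sum>B\<in>UNIV. jac M i j (coord M i m) (axis A 1) $ B * \<xi> j $ B)) \<longleftrightarrow>
        (\<forall>h. \<xi> i \<bullet> h = \<xi> j \<bullet> jac M i j (coord M i m) h)" (is "?L \<longleftrightarrow> ?R")
    if ij: "i \<in> idx M" "j \<in> idx M" "m \<in> chart_dom M i \<inter> chart_dom M j" for i j
  proof
    have x: "coord M i m \<in> overlap M i j" using ij by (auto simp: overlap_def)
    assume L: ?L
    then have L': "\<xi> i $ A = \<xi> j \<bullet> jac M i j (coord M i m) (axis A 1)" for A
      by (simp add: inner_vec_def mult.commute)
    show ?R
    proof
      fix h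
      have "\<xi> j \<bullet> jac M i j (coord M i m) h
        = (\<Sum>A\<in>UNIV. h $ A * (\<xi> j \<bullet> jac M i j (coord M i m) (axis A 1)))"
        by (subst jac_expand[OF M ij(1,2) x]) (simp add: inner_sum_right)
      then show "\<xi> i \<bullet> h = \<xi> j \<bullet> jac M i j (coord M i m) h"
        by (simp add: L' inner_vec_def[of "\<xi> i" h] mult.commute)
    qed
  next
    assume R: ?R
    show ?L
    proof
      fix A
      have "\<xi> i $ A = \<xi> i \<bullet> axis A 1" by (simp add: inner_axis)
      then show "\<xi> i $ A = (\<Sum>B\<in>UNIV. jac M i j (coord M i m) (axis A 1) $ B * \<xi> j $ B)"
        using R by (simp add: inner_vec_def[of "\<xi> j"] mult.commute)
    qed
  qed
  then show ?thesis unfolding covector_at_def by blast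
qed

lemma covector_exists:
  fixes M :: "('i, 'a, real^'n) atlas"
  assumes M: "smooth_manifold M" and i: "i \<in> idx M" "m \<in> chart_dom M i"
  obtains \<xi> where "covector_at M m \<xi>" "\<xi> i = p"
    "\<And>k. k \<in> idx M \<Longrightarrow> m \<in> chart_dom M k \<Longrightarrow>
       \<xi> k = (\<chi> A. p \<bullet> jac M k i (coord M k m) (axis A 1))"
proof -
  define \<xi> where "\<xi> k = (if k \<in> idx M \<and> m \<in> chart_dom M k
    then (\<chi> A. p \<bullet> jac M k i (coord M k m) (axis A 1)) else 0)" for k
  have inner: "\<xi> k \<bullet> h = p \<bullet> jac M k i (coord M k m) h" if k: "k \<in> idx M" "m \<in> chart_dom M k" for k h
  proof -
    have x: "coord M k m \<in> overlap M k i" using k i by (auto simp: overlap_def)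
    have "p \<bullet> jac M k i (coord M k m) h
        = (\<Sum>A\<in>UNIV. h $ A * (p \<bullet> jac M k i (coord M k m) (axis A 1)))"
      by (subst jac_expand[OF M k(1) i(1) x]) (simp add: inner_sum_right)
    then show ?thesis using k by (simp add: \<xi>_def inner_vec_def[of "vec_lambda _"] mult.commute)
  qed
  have "covector_at M m \<xi>"
    unfolding covector_at_iff[OF M]
  proof (intro conjI ballI impI allI)
    show "\<xi> k = 0" if "k \<notin> idx M \<or> m \<notin> chart_dom M k" for k using that by (auto simp: \<xi>_def)
    fix k l h assume "k \<in> idx M" "l \<in> idx M" "m \<in> chart_dom M k \<inter> chart_dom M l"
    then show "\<xi> k \<bullet> h = \<xi> l \<bullet> jac M k l (coord M k m) h"
      using inner jac_cocycle[OF M, of k l i m h] i by simp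
  qed
  moreover have "\<xi> i = p"
  proof -
    have "coord M i m \<in> chart_range M i" using i by (auto simp: chart_range_def)
    then show ?thesis
      using i by (simp add: \<xi>_def vec_eq_iff jac_self[OF M] inner_axis)
  qed
  ultimately show ?thesis using that by (simp add: \<xi>_def)
qed

lemma idx_cotangent [simp]: "idx (cotangent_bundle M) = idx M"
  by (simp add: cotangent_bundle_def)

lemma overlap_cotangent:
  fixes M :: "('i, 'a, real^'n) atlas"
  assumes M: "smooth_manifold M" and i: "i \<in> idx M"
  shows "overlap (cotangent_bundle M) i j = overlap M i j \<times> UNIV"
proof (intro set_eqI iffI)
  fix u assume "u \<in> overlap M i j \<times> (UNIV :: (real^'n) set)"
  then obtain m p where u: "u = (coord M i m, p)" "m \<in> chart_dom M i" "m \<in> chart_dom M j"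
    by (auto simp: overlap_def)
  obtain \<xi> where "covector_at M m \<xi>" "\<xi> i = p" using covector_exists[OF M i u(2)] by blast
  then show "u \<in> overlap (cotangent_bundle M) i j"
    using u by (force simp: overlap_def cotangent_bundle_def)
qed (auto simp: overlap_def cotangent_bundle_def)

lemma chart_range_cotangent:
  fixes M :: "('i, 'a, real^'n) atlas"
  assumes "smooth_manifold M" "i \<in> idx M"
  shows "chart_range (cotangent_bundle M) i = chart_range M i \<times> UNIV"
  using overlap_cotangent[OF assms, of i] by (simp add: overlap_self)

lemma coord_cotangent_inj:
  fixes M :: "('i, 'a, real^'n) atlas"
  assumes M: "smooth_manifold M" and i: "i \<in> idx M"
  shows "inj_on (coord (cotangent_bundle M) i) (chart_dom (cotangent_bundle M) i)"
proof (rule inj_onI, clarsimp simp: cotangent_bundle_def)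
  fix m \<xi> m' \<xi>'
  assume m: "m \<in> chart_dom M i" "m' \<in> chart_dom M i" "coord M i m = coord M i m'"
    and \<xi>: "covector_at M m \<xi>" "covector_at M m' \<xi>'" "\<xi> i = \<xi>' i"
  have mm: "m = m'" using M i m unfolding smooth_manifold_def inj_on_def by blast
  have "\<xi> k = \<xi>' k" for k
  proof (cases "k \<in> idx M \<and> m \<in> chart_dom M k")
    case True
    then have k: "k \<in> idx M" "m \<in> chart_dom M k \<inter> chart_dom M i" using m by auto
    have "\<zeta> k \<bullet> h = \<zeta> i \<bullet> jac M k i (coord M k m) h" if "covector_at M m \<zeta>" for \<zeta> h
      using that k i unfolding covector_at_iff[OF M] by blast
    then have "\<forall>h. \<xi> k \<bullet> h = \<xi>' k \<bullet> h" using \<xi> mm by metis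
    then show ?thesis by (simp only: vector_eq_rdot)
  next
    case False then show ?thesis using \<xi> mm unfolding covector_at_def by auto
  qed
  then show "m = m' \<and> \<xi> = \<xi>'" using mm by auto
qed

lemma transition_cotangent:
  fixes M :: "('i, 'a, real^'n) atlas"
  assumes M: "smooth_manifold M" and ij: "i \<in> idx M" "j \<in> idx M" and x: "x \<in> overlap M i j"
  shows "transition (cotangent_bundle M) i j (x, p) =
    (transition M i j x, \<chi> A. p \<bullet> jac M j i (transition M i j x) (axis A 1))"
proof -
  obtain m where m: "x = coord M i m" "m \<in> chart_dom M i" "m \<in> chart_dom M j"
    using x by (auto simp: overlap_def)
  obtain \<xi> where \<xi>: "covector_at M m \<xi>" "\<xi> i = p"
     "\<xi> j = (\<chi> A. p \<bullet> jac M j i (coord M j m) (axis A 1))"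
    using covector_exists[OF M ij(1) m(2)] ij m by metis
  have "inv_into (chart_dom (cotangent_bundle M) i) (coord (cotangent_bundle M) i) (x, p) = (m, \<xi>)"
    by (rule inv_into_f_eq[OF coord_cotangent_inj[OF M ij(1)]])
       (use m \<xi> in \<open>auto simp: cotangent_bundle_def\<close>)
  then have "transition (cotangent_bundle M) i j (x, p) = (coord M j m, \<xi> j)"
    by (simp add: transition_def) (simp add: cotangent_bundle_def)
  then show ?thesis using \<xi> m transition_coord[OF M ij(1) m(2)] by simp
qed

lemma transition_cotangent_inner:
  fixes M :: "('i, 'a, real^'n) atlas"
  assumes M: "smooth_manifold M" and ij: "i \<in> idx M" "j \<in> idx M" and x: "x \<in> overlap M i j"
  shows "p \<bullet> h = snd (transition (cotangent_bundle M) i j (x, p)) \<bullet> jac M i j x h"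
proof -
  obtain m where m: "x = coord M i m" "m \<in> chart_dom M i" "m \<in> chart_dom M j"
    using x by (auto simp: overlap_def)
  have t: "transition M i j x = coord M j m" using m transition_coord[OF M ij(1)] by simp
  have y: "coord M j m \<in> overlap M j i" using m by (auto simp: overlap_def)
  have xr: "x \<in> chart_range M i" using m by (auto simp: chart_range_def)
  have "p \<bullet> h = p \<bullet> jac M j i (coord M j m) (jac M i j x h)"
    using jac_cocycle[OF M ij(1,2,1) m(2,3,2)] jac_self[OF M ij(1) xr] m(1) by simp
  also have "\<dots> = (\<Sum>A\<in>UNIV. jac M i j x h $ A * (p \<bullet> jac M j i (coord M j m) (axis A 1)))"
    by (subst jac_expand[OF M ij(2,1) y]) (simp add: inner_sum_right)
  also have "\<dots> = snd (transition (cotangent_bundle M) i j (x, p)) \<bullet> jac M i j x h"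
    unfolding transition_cotangent[OF M ij x] t snd_conv inner_vec_def[of "vec_lambda _"]
    by (simp add: mult.commute)
  finally show ?thesis .
qed

definition christoffel_vec :: "'n::finite christoffel \<Rightarrow> real^'n \<Rightarrow> real^'n \<Rightarrow> real^'n \<Rightarrow> real^'n" where
  "christoffel_vec G x a c = (\<chi> C. \<Sum>A\<in>UNIV. \<Sum>B\<in>UNIV. G x A C B * a $ A * c $ B)"

lemma pw_metric_inner:
  "pw_metric \<Gamma> i u Y Z = fst Y \<bullet> snd Z + snd Y \<bullet> fst Z
    - snd u \<bullet> (christoffel_vec (\<Gamma> i) (fst u) (fst Y) (fst Z) + christoffel_vec (\<Gamma> i) (fst u) (fst Z) (fst Y))"
proof -
  have "2 * odot (dx A) (dp A) Y Z = fst Y $ A * snd Z $ A + snd Y $ A * fst Z $ A" for A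
    by (simp add: odot_def dx_def dp_def)
  then have 1: "2 * (\<Sum>A\<in>UNIV. odot (dx A) (dp A) Y Z) = fst Y \<bullet> snd Z + snd Y \<bullet> fst Z"
    by (simp only: sum_distrib_left inner_vec_def sum.distrib inner_real_def)
  have "snd u \<bullet> (christoffel_vec (\<Gamma> i) (fst u) (fst Y) (fst Z) + christoffel_vec (\<Gamma> i) (fst u) (fst Z) (fst Y))
    = (\<Sum>C\<in>UNIV. \<Sum>A\<in>UNIV. \<Sum>B\<in>UNIV. snd u $ C * (\<Gamma> i (fst u) A C B * fst Y $ A * fst Z $ B
         + \<Gamma> i (fst u) A C B * fst Z $ A * fst Y $ B))"
    by (simp only: inner_vec_def christoffel_vec_def vector_add_component vec_lambda_beta
        inner_real_def sum_distrib_left sum.distrib[symmetric])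
  also have "\<dots> = (\<Sum>C\<in>UNIV. \<Sum>A\<in>UNIV. \<Sum>B\<in>UNIV. 2 * (\<Gamma> i (fst u) A C B * snd u $ C * odot (dx A) (dx B) Y Z))"
    by (intro sum.cong refl) (simp add: odot_def dx_def algebra_simps)
  also have "\<dots> = (\<Sum>A\<in>UNIV. \<Sum>C\<in>UNIV. \<Sum>B\<in>UNIV. 2 * (\<Gamma> i (fst u) A C B * snd u $ C * odot (dx A) (dx B) Y Z))"
    by (rule sum.swap)
  also have "\<dots> = (\<Sum>A\<in>UNIV. \<Sum>B\<in>UNIV. \<Sum>C\<in>UNIV. 2 * (\<Gamma> i (fst u) A C B * snd u $ C * odot (dx A) (dx B) Y Z))"
    by (intro sum.cong refl sum.swap)
  finally show ?thesis using 1 by (simp add: pw_metric_def sum_distrib_left)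
qed

lemma sum_swap4:
  fixes t :: "'n::finite \<Rightarrow> 'n \<Rightarrow> 'n \<Rightarrow> 'n \<Rightarrow> real"
  shows "(\<Sum>A\<in>UNIV. \<Sum>B\<in>UNIV. \<Sum>F\<in>UNIV. \<Sum>G\<in>UNIV. t A B F G) =
    (\<Sum>F\<in>UNIV. \<Sum>G\<in>UNIV. \<Sum>A\<in>UNIV. \<Sum>B\<in>UNIV. t A B F G)"
proof -
  have 3: "(\<Sum>B\<in>UNIV. \<Sum>F\<in>UNIV. \<Sum>G\<in>UNIV. s B F G) = (\<Sum>F\<in>UNIV. \<Sum>G\<in>UNIV. \<Sum>B\<in>UNIV. s B F G)"
    for s :: "'n \<Rightarrow> 'n \<Rightarrow> 'n \<Rightarrow> real"
  proof -
    have "(\<Sum>B\<in>UNIV. \<Sum>F\<in>UNIV. \<Sum>G\<in>UNIV. s B F G) = (\<Sum>F\<in>UNIV. \<Sum>B\<in>UNIV. \<Sum>G\<in>UNIV. s B F G)"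
      by (rule sum.swap)
    also have "\<dots> = (\<Sum>F\<in>UNIV. \<Sum>G\<in>UNIV. \<Sum>B\<in>UNIV. s B F G)"
      by (intro sum.cong refl sum.swap)
    finally show ?thesis .
  qed
  have "(\<Sum>A\<in>UNIV. \<Sum>B\<in>UNIV. \<Sum>F\<in>UNIV. \<Sum>G\<in>UNIV. t A B F G) =
      (\<Sum>A\<in>UNIV. \<Sum>F\<in>UNIV. \<Sum>G\<in>UNIV. \<Sum>B\<in>UNIV. t A B F G)"
    by (intro sum.cong refl 3)
  also have "\<dots> = (\<Sum>F\<in>UNIV. \<Sum>G\<in>UNIV. \<Sum>A\<in>UNIV. \<Sum>B\<in>UNIV. t A B F G)"
    by (rule 3)
  finally show ?thesis .
qed

lemma has_derivative_vec_lambda':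
  fixes f :: "'e::real_normed_vector \<Rightarrow> 'n::finite \<Rightarrow> real"
  assumes "\<And>A. ((\<lambda>v. f v A) has_derivative (\<lambda>Y. f' Y A)) F"
  shows "((\<lambda>v. \<chi> A. f v A) has_derivative (\<lambda>Y. \<chi> A. f' Y A)) F"
proof -
  have "((\<lambda>v. \<Sum>A\<in>UNIV. f v A *\<^sub>R axis A (1::real)) has_derivative (\<lambda>Y. \<Sum>A\<in>UNIV. f' Y A *\<^sub>R axis A 1)) F"
    by (intro has_derivative_sum has_derivative_scaleR_left assms)
  moreover have "(\<Sum>A\<in>UNIV. g A *\<^sub>R axis A (1::real)) = (\<chi> A. g A)" for g :: "'n \<Rightarrow> real"
    using basis_expansion[of "\<chi> A. g A"] by (simp add: scalar_mult_eq_scaleR)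
  ultimately show ?thesis by simp
qed

lemma christoffel_vec_transform:
  fixes M :: "('i, 'a, real^'n) atlas"
  assumes M: "smooth_manifold M" and D: "affine_connection M \<Gamma>"
    and ij: "i \<in> idx M" "j \<in> idx M" and x: "x \<in> overlap M i j"
  obtains H where
    "\<And>c. ((\<lambda>y. jac M i j y c) has_derivative (\<lambda>a. H a c)) (at x)"
    "\<And>a c. jac M i j x (christoffel_vec (\<Gamma> i) x a c) =
      H a c + christoffel_vec (\<Gamma> j) (transition M i j x) (jac M i j x a) (jac M i j x c)"
proof -
  let ?J = "jac M i j"
  define H0 where "H0 B = frechet_derivative (\<lambda>y. ?J y (axis B 1)) (at x)" for B
  define H where "H a c = (\<Sum>B\<in>UNIV. c $ B *\<^sub>R H0 B a)" for a c
  have H0: "((\<lambda>y. ?J y (axis B 1)) has_derivative H0 B) (at x)" for B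
    using jac_differentiable[OF M ij x] by (simp add: H0_def frechet_derivative_works)
  have op: "open (overlap M i j)" using M ij by (simp add: smooth_manifold_def)
  have "((\<lambda>y. \<Sum>B\<in>UNIV. c $ B *\<^sub>R ?J y (axis B 1)) has_derivative (\<lambda>a. H a c)) (at x)" for c
    unfolding H_def by (intro has_derivative_sum has_derivative_scaleR_right H0)
  then have 1: "((\<lambda>y. ?J y c) has_derivative (\<lambda>a. H a c)) (at x)" for c
    by (rule has_derivative_transform_within_open[OF _ op x]) (rule jac_expand[OF M ij, symmetric])
  have pd: "pd A (\<lambda>y. ?J y (axis B 1) $ E) x = H0 B (axis A 1) $ E" for A B E
  proof -
    have "((\<lambda>y. ?J y (axis B 1) $ E) has_derivative (\<lambda>a. H0 B a $ E)) (at x)"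
      by (rule bounded_linear.has_derivative[OF bounded_linear_vec_nth H0])
    from fun_cong[OF frechet_derivative_at[OF this], of "axis A 1"] show ?thesis by (simp add: pd_def)
  qed
  have lin: "H0 B a = (\<Sum>A\<in>UNIV. a $ A *\<^sub>R H0 B (axis A 1))" for a B
  proof -
    have l: "linear (H0 B)" using H0 has_derivative_linear by blast
    have "H0 B a = H0 B (\<Sum>A\<in>UNIV. a $ A *\<^sub>R axis A 1)"
      using basis_expansion[of a] by (simp add: scalar_mult_eq_scaleR)
    then show ?thesis by (simp add: linear_sum[OF l] linear_cmul[OF l])
  qed
  have law: "(\<Sum>C\<in>UNIV. ?J x (axis C 1) $ E * \<Gamma> i x A C B) = H0 B (axis A 1) $ E +
     (\<Sum>F\<in>UNIV. \<Sum>G\<in>UNIV. ?J x (axis A 1) $ F * ?J x (axis B 1) $ G * \<Gamma> j (transition M i j x) F E G)" for A B E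
    using D ij x unfolding affine_connection_def pd[symmetric] by blast
  have "?J x (christoffel_vec (\<Gamma> i) x a c) $ E =
      H a c $ E + christoffel_vec (\<Gamma> j) (transition M i j x) (?J x a) (?J x c) $ E" for a c E
  proof -
    have "?J x (christoffel_vec (\<Gamma> i) x a c) $ E
       = (\<Sum>C\<in>UNIV. \<Sum>A\<in>UNIV. \<Sum>B\<in>UNIV. a $ A * c $ B * (?J x (axis C 1) $ E * \<Gamma> i x A C B))"
      by (subst jac_expand[OF M ij x])
         (simp add: christoffel_vec_def sum_distrib_left sum_distrib_right mult_ac)
    also have "\<dots> = (\<Sum>A\<in>UNIV. \<Sum>C\<in>UNIV. \<Sum>B\<in>UNIV. a $ A * c $ B * (?J x (axis C 1) $ E * \<Gamma> i x A C B))"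
      by (rule sum.swap)
    also have "\<dots> = (\<Sum>A\<in>UNIV. \<Sum>B\<in>UNIV. \<Sum>C\<in>UNIV. a $ A * c $ B * (?J x (axis C 1) $ E * \<Gamma> i x A C B))"
      by (intro sum.cong refl sum.swap)
    also have "\<dots> = (\<Sum>A\<in>UNIV. \<Sum>B\<in>UNIV. a $ A * c $ B * (H0 B (axis A 1) $ E +
     (\<Sum>F\<in>UNIV. \<Sum>G\<in>UNIV. ?J x (axis A 1) $ F * ?J x (axis B 1) $ G * \<Gamma> j (transition M i j x) F E G)))"
      by (simp only: sum_distrib_left[symmetric] law)
    also have "\<dots> = (\<Sum>A\<in>UNIV. \<Sum>B\<in>UNIV. a $ A * c $ B * H0 B (axis A 1) $ E) +
      (\<Sum>A\<in>UNIV. \<Sum>B\<in>UNIV. \<Sum>F\<in>UNIV. \<Sum>G\<in>UNIV. (a $ A * ?J x (axis A 1) $ F) * (c $ B * ?J x (axis B 1) $ G) * \<Gamma> j (transition M i j x) F E G)"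
      by (simp add: distrib_left sum.distrib sum_distrib_left mult_ac)
    also have "(\<Sum>A\<in>UNIV. \<Sum>B\<in>UNIV. a $ A * c $ B * H0 B (axis A 1) $ E) = H a c $ E"
    proof -
      have "H a c $ E = (\<Sum>B\<in>UNIV. \<Sum>A\<in>UNIV. a $ A * c $ B * H0 B (axis A 1) $ E)"
        unfolding H_def by (subst lin) (simp add: sum_distrib_left mult_ac)
      then show ?thesis by (subst sum.swap) simp
    qed
    also have "(\<Sum>A\<in>UNIV. \<Sum>B\<in>UNIV. \<Sum>F\<in>UNIV. \<Sum>G\<in>UNIV. (a $ A * ?J x (axis A 1) $ F) * (c $ B * ?J x (axis B 1) $ G) * \<Gamma> j (transition M i j x) F E G)
      = (\<Sum>F\<in>UNIV. \<Sum>G\<in>UNIV. \<Sum>A\<in>UNIV. \<Sum>B\<in>UNIV. (a $ A * ?J x (axis A 1) $ F) * (c $ B * ?J x (axis B 1) $ G) * \<Gamma> j (transition M i j x) F E G)"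
      (is "(\<Sum>A\<in>UNIV. \<Sum>B\<in>UNIV. \<Sum>F\<in>UNIV. \<Sum>G\<in>UNIV. ?t A B F G) = _")
      by (rule sum_swap4)
    also have "\<dots> = christoffel_vec (\<Gamma> j) (transition M i j x) (?J x a) (?J x c) $ E"
    proof -
      have "(\<Sum>A\<in>UNIV. \<Sum>B\<in>UNIV. ?t A B F G)
         = \<Gamma> j (transition M i j x) F E G * ?J x a $ F * ?J x c $ G" for F G
      proof -
        have "?J x a $ F = (\<Sum>A\<in>UNIV. a $ A * ?J x (axis A 1) $ F)"
          by (subst jac_expand[OF M ij x]) simp
        moreover have "?J x c $ G = (\<Sum>A\<in>UNIV. c $ A * ?J x (axis A 1) $ G)"
          by (subst jac_expand[OF M ij x]) simp
        ultimately show ?thesis by (simp add: sum_product sum_distrib_left sum_distrib_right mult_ac)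
      qed
      then show ?thesis by (simp add: christoffel_vec_def)
    qed
    finally show ?thesis .
  qed
  then show ?thesis using that[of H] 1 by (simp add: vec_eq_iff)
qed

lemma has_derivative_transition_cotangent:
  fixes M :: "('i, 'a, real^'n) atlas"
  assumes M: "smooth_manifold M" and ij: "i \<in> idx M" "j \<in> idx M"
    and u: "u \<in> overlap (cotangent_bundle M) i j"
  shows "(transition (cotangent_bundle M) i j has_derivative jac (cotangent_bundle M) i j u) (at u)"
proof -
  have x: "fst u \<in> overlap M i j" using u overlap_cotangent[OF M ij(1)] by auto
  let ?y = "transition M i j (fst u)"
  have y: "?y \<in> overlap M j i" by (rule transition_in_overlap[OF M ij(1) x])
  have op: "open (overlap (cotangent_bundle M) i j)"
    unfolding overlap_cotangent[OF M ij(1)] using M ij by (simp add: smooth_manifold_def open_Times)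
  have t: "((\<lambda>v. transition M i j (fst v)) has_derivative (\<lambda>Y. jac M i j (fst u) (fst Y))) (at u)"
    by (rule has_derivative_compose[OF has_derivative_fst[OF has_derivative_ident]
        has_derivative_transition[OF M ij x]])
  define D where "D A = frechet_derivative (\<lambda>y. jac M j i y (axis A 1)) (at ?y)" for A
  have D: "((\<lambda>y. jac M j i y (axis A 1)) has_derivative D A) (at ?y)" for A
    using jac_differentiable[OF M ij(2,1) y] by (simp add: D_def frechet_derivative_works)
  have e: "((\<lambda>v. snd v \<bullet> jac M j i (transition M i j (fst v)) (axis A 1)) has_derivative
      (\<lambda>Y. snd u \<bullet> D A (jac M i j (fst u) (fst Y)) + snd Y \<bullet> jac M j i ?y (axis A 1))) (at u)" for A
    by (rule has_derivative_inner[OF has_derivative_snd[OF has_derivative_ident]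
        has_derivative_compose[OF t D]])
  have "((\<lambda>v. (transition M i j (fst v), \<chi> A. snd v \<bullet> jac M j i (transition M i j (fst v)) (axis A 1)))
    has_derivative (\<lambda>Y. (jac M i j (fst u) (fst Y), \<chi> A. snd u \<bullet> D A (jac M i j (fst u) (fst Y)) + snd Y \<bullet> jac M j i ?y (axis A 1)))) (at u)"
    by (intro has_derivative_Pair t has_derivative_vec_lambda' e)
  then have "(transition (cotangent_bundle M) i j
    has_derivative (\<lambda>Y. (jac M i j (fst u) (fst Y), \<chi> A. snd u \<bullet> D A (jac M i j (fst u) (fst Y)) + snd Y \<bullet> jac M j i ?y (axis A 1)))) (at u)"
  proof (rule has_derivative_transform_within_open[OF _ op u])
    fix v assume "v \<in> overlap (cotangent_bundle M) i j"
    then show "(transition M i j (fst v), \<chi> A. snd v \<bullet> jac M j i (transition M i j (fst v)) (axis A 1)) =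
      transition (cotangent_bundle M) i j v"
      using transition_cotangent[OF M ij, of "fst v" "snd v"] overlap_cotangent[OF M ij(1)] by auto
  qed
  note d = this
  show ?thesis
    using d by (simp only: jac_def[of "cotangent_bundle M"] frechet_derivative_at[OF d, symmetric])
qed

lemma pw_metric_transform:
  fixes M :: "('i, 'a, real^'n) atlas"
  assumes M: "smooth_manifold M" and D: "affine_connection M \<Gamma>"
    and ij: "i \<in> idx M" "j \<in> idx M" and u: "u \<in> overlap (cotangent_bundle M) i j"
  shows "pw_metric \<Gamma> i u Y Z = pw_metric \<Gamma> j (transition (cotangent_bundle M) i j u)
      (jac (cotangent_bundle M) i j u Y) (jac (cotangent_bundle M) i j u Z)"
proof -
  let ?T = "transition (cotangent_bundle M) i j" and ?K = "jac (cotangent_bundle M) i j u"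
  let ?x = "fst u" and ?J = "jac M i j (fst u)"
  have x: "?x \<in> overlap M i j" using u overlap_cotangent[OF M ij(1)] by auto
  have op: "open (overlap (cotangent_bundle M) i j)"
    unfolding overlap_cotangent[OF M ij(1)] using M ij by (simp add: smooth_manifold_def open_Times)
  obtain H where H: "\<And>c. ((\<lambda>y. jac M i j y c) has_derivative (\<lambda>a. H a c)) (at ?x)"
    and G: "\<And>a c. ?J (christoffel_vec (\<Gamma> i) ?x a c) =
      H a c + christoffel_vec (\<Gamma> j) (transition M i j ?x) (?J a) (?J c)"
    using christoffel_vec_transform[OF M D ij x] by blast
  have T: "(?T has_derivative ?K) (at u)" by (rule has_derivative_transition_cotangent[OF M ij u])
  have fstT: "fst (?T v) = transition M i j (fst v)"
    and sndT: "snd v \<bullet> h = snd (?T v) \<bullet> jac M i j (fst v) h"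
    if "v \<in> overlap (cotangent_bundle M) i j" for v h
    using that transition_cotangent[OF M ij, of "fst v" "snd v"]
      transition_cotangent_inner[OF M ij, of "fst v" "snd v" h] overlap_cotangent[OF M ij(1)] by auto
  have fstK: "fst (?K Y) = ?J (fst Y)" for Y
  proof -
    have "((\<lambda>v. fst (?T v)) has_derivative (\<lambda>Y. ?J (fst Y))) (at u)"
    proof (rule has_derivative_transform_within_open[OF _ op u])
      show "((\<lambda>v. transition M i j (fst v)) has_derivative (\<lambda>Y. ?J (fst Y))) (at u)"
        by (rule has_derivative_compose[OF has_derivative_fst[OF has_derivative_ident]
          has_derivative_transition[OF M ij x]])
    qed (simp add: fstT)
    from fun_cong[OF has_derivative_unique[OF this has_derivative_fst[OF T]], of Y] show ?thesis by simp
  qed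
  have sndK: "snd Y \<bullet> h = snd (?K Y) \<bullet> ?J h + snd (?T u) \<bullet> H (fst Y) h" for Y h
  proof -
    have "((\<lambda>v. snd (?T v) \<bullet> jac M i j (fst v) h) has_derivative
        (\<lambda>Y. snd (?T u) \<bullet> H (fst Y) h + snd (?K Y) \<bullet> ?J h)) (at u)"
      by (rule has_derivative_inner[OF has_derivative_snd[OF T]
        has_derivative_compose[OF has_derivative_fst[OF has_derivative_ident] H]])
    then have "((\<lambda>v. snd v \<bullet> h) has_derivative
        (\<lambda>Y. snd (?T u) \<bullet> H (fst Y) h + snd (?K Y) \<bullet> ?J h)) (at u)"
      by (rule has_derivative_transform_within_open[OF _ op u]) (simp add: sndT)
    moreover have "((\<lambda>v. snd v \<bullet> h) has_derivative (\<lambda>Y. snd Y \<bullet> h)) (at u)"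
      by (intro has_derivative_inner_left has_derivative_snd has_derivative_ident)
    ultimately have "(\<lambda>Y. snd (?T u) \<bullet> H (fst Y) h + snd (?K Y) \<bullet> ?J h) = (\<lambda>Y. snd Y \<bullet> h)"
      by (rule has_derivative_unique)
    from fun_cong[OF this, of Y] show ?thesis by simp
  qed
  have 1: "snd u \<bullet> christoffel_vec (\<Gamma> i) ?x a c = snd (?T u) \<bullet> H a c
      + snd (?T u) \<bullet> christoffel_vec (\<Gamma> j) (fst (?T u)) (?J a) (?J c)" for a c
    using sndT[OF u, of "christoffel_vec (\<Gamma> i) ?x a c"]
    by (simp only: G fstT[OF u] inner_add_right)
  have 2: "fst Y \<bullet> snd Z = ?J (fst Y) \<bullet> snd (?K Z) + snd (?T u) \<bullet> H (fst Z) (fst Y)"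
    using sndK[of Z "fst Y"] by (simp add: inner_commute)
  show ?thesis
    unfolding pw_metric_inner fstK inner_add_right 1 2 sndK[of Y "fst Z"] by simp
qed

lemma smooth_on_pw_metric:
  fixes M :: "('i, 'a, real^'n) atlas"
  assumes M: "smooth_manifold M" and D: "affine_connection M \<Gamma>" and i: "i \<in> idx M"
  shows "smooth_on (chart_range (cotangent_bundle M) i) (\<lambda>u. pw_metric \<Gamma> i u Y Z)"
proof -
  let ?S = "chart_range (cotangent_bundle M) i"
  have opM: "open (chart_range M i)"
    using M i unfolding smooth_manifold_def by (metis overlap_self)
  have S: "?S = fst -` chart_range M i" unfolding chart_range_cotangent[OF M i] by auto
  have op: "open ?S" unfolding chart_range_cotangent[OF M i] using opM by (simp add: open_Times)
  have "Ck_on k (\<lambda>u. pw_metric \<Gamma> i u Y Z) ?S" for k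
  proof -
    have G: "Ck_on k (\<lambda>u. \<Gamma> i (fst u) A C B) ?S" for A B C
      unfolding S
      by (rule Ck_on_compose_linear[OF bounded_linear_fst opM, where f = "\<lambda>x. \<Gamma> i x A C B"])
         (use D i in \<open>simp add: affine_connection_def smooth_on_def\<close>)
    have p: "Ck_on k (\<lambda>u :: (real^'n) \<times> (real^'n). snd u $ C) ?S" for C
      by (intro Ck_on_linear bounded_linear_compose[OF bounded_linear_vec_nth bounded_linear_snd])
    have sum: "Ck_on k (\<lambda>u. \<Sum>A\<in>(UNIV::'n set). f A u) ?S" if "\<And>A. Ck_on k (f A) ?S"
      for f :: "'n \<Rightarrow> (real^'n) \<times> (real^'n) \<Rightarrow> real"
    proof -
      have "finite F \<Longrightarrow> Ck_on k (\<lambda>u. \<Sum>A\<in>F. f A u) ?S" for F :: "'n set"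
        by (induction F rule: finite_induct) (auto intro: Ck_on_const Ck_on_add[OF op] that)
      then show ?thesis by simp
    qed
    show ?thesis
      unfolding pw_metric_def diff_conv_add_uminus mult_minus_left[symmetric]
      by (intro Ck_on_add[OF op] Ck_on_mult[OF op] Ck_on_const sum G p)
  qed
  then show ?thesis by (simp add: smooth_on_def)
qed

lemma pw_metric_tensor:
  fixes M :: "('i, 'a, real^'n) atlas"
  assumes M: "smooth_manifold M" and D: "affine_connection M \<Gamma>"
  shows "tensor02 (cotangent_bundle M) (pw_metric \<Gamma>)"
proof -
  have l: "christoffel_vec G x (a + b) c = christoffel_vec G x a c + christoffel_vec G x b c"
    "christoffel_vec G x c (a + b) = christoffel_vec G x c a + christoffel_vec G x c b"
    "christoffel_vec G x (r *\<^sub>R a) c = r *\<^sub>R christoffel_vec G x a c"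
    "christoffel_vec G x c (r *\<^sub>R a) = r *\<^sub>R christoffel_vec G x c a"
    for G :: "'n christoffel" and x a b c r
    by (simp_all add: christoffel_vec_def vec_eq_iff distrib_left distrib_right sum.distrib
        sum_distrib_left mult_ac)
  have "bilinear (pw_metric \<Gamma> i u)" for i u
    unfolding bilinear_def pw_metric_inner
    by (intro conjI allI linearI)
       (simp_all add: l inner_add_left inner_add_right right_diff_distrib distrib_left)
  then show ?thesis
    unfolding tensor02_def using smooth_on_pw_metric[OF M D] pw_metric_transform[OF M D] by simp
qed

end

theory Submission
  imports Defs
begin

text \<open>
  In a chart write a vector field on the cotangent bundle as \<open>X = (\<xi>, \<eta>)\<close> in the coordinates
  \<open>(x, p)\<close>. The \<open>pp\<close>-components of the Killing equation make \<open>\<xi>\<close> a Euclidean Killing field in \<open>p\<close>,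
  so \<open>\<xi> = v + p \<cdot> w\<close> with \<open>w\<close> skew. The \<open>xp\<close>-components then give the \<open>p\<close>-derivative of \<open>\<eta>\<close> as an
  affine function of \<open>p\<close>; its integrability is \<open>Dw = 0\<close>, and integrating it shows that \<open>X\<close> is the
  sum of the lifts of \<open>w\<close>, \<open>v\<close> and \<open>\<alpha> = \<eta>(x, 0)\<close>. For a field of this form the \<open>xx\<close>-components
  are a quadratic polynomial in \<open>p\<close> whose coefficients of degree 0, 1 and 2 are the Killing equation
  for \<open>\<alpha>\<close>, the Lie derivative of the connection along \<open>v\<close> and the symmetrized contraction of \<open>w\<close>
  with the curvature. The lift of a symmetry is the complete lift of \<open>v\<close>: its fibre part
  \<open>-p \<cdot> \<partial>v\<close> contains no Christoffel symbols.
\<close>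

section \<open>Calculus of smooth maps\<close>

text \<open>Christoffel symbols act as a bilinear map and covectors are vectors paired by the inner
  product, so index sums are confined to the translation of the affine equations and of the lifts.
  The Lie derivative of the metric is symmetric, hence only its diagonal is computed. The three
  lifts are handled as one field. For parallel \<open>w\<close> a single equivalence characterizes
  when this field satisfies the Killing equation: with two of the three data equal to zero it yields
  (a), (b) and (c), and for an arbitrary Killing field it supplies the equations that remain after
  the chart computation. The obstacle in passing from charts to the manifold is that the
  decomposition of \<open>X\<close> is made chart by chart, while the fibre part of a vector on the
  cotangent bundle does not transform tensorially: second derivatives of the coordinate change
  enter. On the zero section these terms vanish, which gives the laws of \<open>v\<close> and
  \<alpha>; comparing base parts at arbitrary \<open>p\<close> then gives the law of
  \<open>w\<close>.\<close>

text \<open>The mean value theorem in direction \<open>a\<close> turns the second difference into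
  \<open>t\<close> times a difference of first derivatives at two points. Expanding both about
  \<open>x\<close> by differentiability of \<open>f' y a\<close> leaves \<open>t * D b\<close> up to
  an error of order \<open>t\<close> with arbitrarily small constant.\<close>

lemma second_difference_approx:
  fixes f :: "'e::real_normed_vector \<Rightarrow> real"
  assumes S: "open S" "x \<in> S" and f': "\<And>y. y \<in> S \<Longrightarrow> (f has_derivative f' y) (at y)"
    and D: "((\<lambda>y. f' y a) has_derivative D) (at x)" and e: "e > 0"
  shows "\<forall>\<^sub>F t in at_right 0.
    \<bar>f (x + t *\<^sub>R a + t *\<^sub>R b) - f (x + t *\<^sub>R a) - f (x + t *\<^sub>R b) + f x - t\<^sup>2 * D b\<bar> \<le> e * t\<^sup>2"
proof -
  \<comment> \<open>The factor 2 accounts for one expansion error at each of the two points; the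
    summand 1 keeps \<open>K\<close> positive even when \<open>a\<close> and \<open>b\<close>
    vanish.\<close>
  define K where "K = 2 * (norm a + norm b) + 1"
  have K: "K > 0" by (simp add: K_def add_nonneg_pos)
  have "e / K > 0" using e K by simp
  then obtain d where d: "d > 0"
    and dd: "\<And>y. norm (y - x) < d \<Longrightarrow> norm (f' y a - f' x a - D (y - x)) \<le> e / K * norm (y - x)"
    using D unfolding has_derivative_at_alt by meson
  obtain r where r: "r > 0" "ball x r \<subseteq> S" using S open_contains_ball by blast
  define m where "m = min d r / K"
  have m: "m > 0" using d r K by (simp add: m_def)
  have lin: "linear D" using D has_derivative_linear by blast
  have "\<bar>f (x + t *\<^sub>R a + t *\<^sub>R b) - f (x + t *\<^sub>R a) - f (x + t *\<^sub>R b) + f x - t\<^sup>2 * D b\<bar> \<le> e * t\<^sup>2"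
    if t: "0 < t" "t < m" for t
  proof -
    have tK: "t * K < min d r" using t K by (simp add: m_def pos_less_divide_eq)
    have near: "norm (s *\<^sub>R a + c *\<^sub>R b) \<le> t * (norm a + norm b)"
      if "0 \<le> s" "s \<le> t" "0 \<le> c" "c \<le> t" for s c
    proof -
      have "norm (s *\<^sub>R a + c *\<^sub>R b) \<le> s * norm a + c * norm b"
        using norm_triangle_ineq[of "s *\<^sub>R a" "c *\<^sub>R b"] that by simp
      also have "\<dots> \<le> t * norm a + t * norm b"
        using that by (intro add_mono mult_right_mono) auto
      finally show ?thesis by (simp add: distrib_left)
    qed
    have small: "t * (norm a + norm b) < min d r"
    proof -
      have "t * (norm a + norm b) \<le> t * K" using t by (intro mult_left_mono) (auto simp: K_def)
      then show ?thesis using tK by simp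
    qed
    have inS: "x + s *\<^sub>R a + c *\<^sub>R b \<in> S" if "0 \<le> s" "s \<le> t" "0 \<le> c" "c \<le> t" for s c
    proof -
      have "norm (s *\<^sub>R a + c *\<^sub>R b) < r" using near[OF that] small by simp
      then have "x + (s *\<^sub>R a + c *\<^sub>R b) \<in> ball x r"
        by (metis add_diff_cancel_left' dist_commute dist_norm mem_ball)
      then have "x + s *\<^sub>R a + c *\<^sub>R b \<in> ball x r" by (simp only: add.assoc)
      then show ?thesis using r by blast
    qed
    \<comment> \<open>The term \<open>0 *\<^sub>R b\<close> is kept so that both summands are
      instances of one expression in \<open>c\<close>, at \<open>c = t\<close> and
      \<open>c = 0\<close>.\<close>
    define g where "g s = f (x + s *\<^sub>R a + t *\<^sub>R b) - f (x + s *\<^sub>R a + 0 *\<^sub>R b)" for s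
    have gd: "(g has_derivative (\<lambda>h. h * (f' (x + s *\<^sub>R a + t *\<^sub>R b) a - f' (x + s *\<^sub>R a + 0 *\<^sub>R b) a))) (at s)"
      if s: "0 \<le> s" "s \<le> t" for s
    proof -
      have *: "((\<lambda>s. f (x + s *\<^sub>R a + c *\<^sub>R b)) has_derivative (\<lambda>h. h * f' (x + s *\<^sub>R a + c *\<^sub>R b) a)) (at s)"
        if "0 \<le> c" "c \<le> t" for c
      proof -
        have 1: "((\<lambda>s. x + s *\<^sub>R a + c *\<^sub>R b) has_derivative (\<lambda>h. h *\<^sub>R a)) (at s)"
          by (auto intro!: derivative_eq_intros)
        have 2: "(f has_derivative f' (x + s *\<^sub>R a + c *\<^sub>R b)) (at (x + s *\<^sub>R a + c *\<^sub>R b))"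
          by (rule f') (use inS s that in auto)
        have "f' (x + s *\<^sub>R a + c *\<^sub>R b) (h *\<^sub>R a) = h * f' (x + s *\<^sub>R a + c *\<^sub>R b) a" for h
          using linear_cmul[OF has_derivative_linear[OF 2], of h a] by simp
        then show ?thesis using has_derivative_compose[OF 1 2] by simp
      qed
      show ?thesis unfolding g_def right_diff_distrib
        by (intro has_derivative_diff *) (use t in auto)
    qed
    obtain s where s: "0 < s" "s < t"
      and gs: "g t - g 0 = (t - 0) * (f' (x + s *\<^sub>R a + t *\<^sub>R b) a - f' (x + s *\<^sub>R a + 0 *\<^sub>R b) a)"
      using mvt_simple[of 0 t g "\<lambda>s h. h * (f' (x + s *\<^sub>R a + t *\<^sub>R b) a - f' (x + s *\<^sub>R a + 0 *\<^sub>R b) a)"]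
        gd t by (auto simp: has_derivative_at_withinI)
    have est: "\<bar>f' (x + s *\<^sub>R a + c *\<^sub>R b) a - f' x a - D (s *\<^sub>R a + c *\<^sub>R b)\<bar> \<le> e / K * (t * (norm a + norm b))"
      if c: "0 \<le> c" "c \<le> t" for c
    proof -
      have n: "norm (s *\<^sub>R a + c *\<^sub>R b) \<le> t * (norm a + norm b)" using near s c by simp
      have e1: "x + s *\<^sub>R a + c *\<^sub>R b - x = s *\<^sub>R a + c *\<^sub>R b" by simp
      have "\<bar>f' (x + s *\<^sub>R a + c *\<^sub>R b) a - f' x a - D (s *\<^sub>R a + c *\<^sub>R b)\<bar> \<le> e / K * norm (s *\<^sub>R a + c *\<^sub>R b)"
        using dd[of "x + s *\<^sub>R a + c *\<^sub>R b"] n small unfolding e1 by simp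
      also have "\<dots> \<le> e / K * (t * (norm a + norm b))"
        using n e K by (intro mult_left_mono) auto
      finally show ?thesis .
    qed
    have "D (s *\<^sub>R a + t *\<^sub>R b) = D (s *\<^sub>R a + 0 *\<^sub>R b) + t * D b"
      using lin by (simp add: linear_add linear_cmul)
    then have "\<bar>f' (x + s *\<^sub>R a + t *\<^sub>R b) a - f' (x + s *\<^sub>R a + 0 *\<^sub>R b) a - t * D b\<bar>
      \<le> 2 * (e / K * (t * (norm a + norm b)))"
      using est[of t] est[of 0] t by linarith
    also have "\<dots> \<le> e * t"
      using e K t by (simp add: divide_simps K_def algebra_simps add_nonneg_pos)
    finally have "t * \<bar>f' (x + s *\<^sub>R a + t *\<^sub>R b) a - f' (x + s *\<^sub>R a + 0 *\<^sub>R b) a - t * D b\<bar> \<le> t * (e * t)"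
      using t by (intro mult_left_mono) auto
    moreover have "f (x + t *\<^sub>R a + t *\<^sub>R b) - f (x + t *\<^sub>R a) - f (x + t *\<^sub>R b) + f x - t\<^sup>2 * D b
       = t * (f' (x + s *\<^sub>R a + t *\<^sub>R b) a - f' (x + s *\<^sub>R a + 0 *\<^sub>R b) a - t * D b)"
      using gs by (simp add: g_def algebra_simps power2_eq_square)
    ultimately show ?thesis
      using t by (simp add: abs_mult power2_eq_square mult_ac)
  qed
  then show ?thesis using m eventually_at_right_field by auto
qed

text \<open>Young's theorem: only the differentiability of the first derivatives at the point is needed.\<close>

lemma second_derivative_symmetric:
  fixes f :: "'e::real_normed_vector \<Rightarrow> real"
  assumes S: "open S" "x \<in> S" and f': "\<And>y. y \<in> S \<Longrightarrow> (f has_derivative f' y) (at y)"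
    and a: "((\<lambda>y. f' y a) has_derivative Da) (at x)"
    and b: "((\<lambda>y. f' y b) has_derivative Db) (at x)"
  shows "Da b = Db a"
proof -
  have "\<bar>Da b - Db a\<bar> \<le> e" if e: "e > 0" for e
  proof -
    have pos: "\<forall>\<^sub>F t::real in at_right 0. 0 < t" by (simp add: eventually_at_right_less)
    have e2: "e / 2 > 0" using e by simp
    have A: "\<forall>\<^sub>F t in at_right 0.
      \<bar>f (x + t *\<^sub>R a + t *\<^sub>R b) - f (x + t *\<^sub>R a) - f (x + t *\<^sub>R b) + f x - t\<^sup>2 * Da b\<bar> \<le> e / 2 * t\<^sup>2"
      by (rule second_difference_approx[OF S f' a e2])
    have B: "\<forall>\<^sub>F t in at_right 0.
      \<bar>f (x + t *\<^sub>R b + t *\<^sub>R a) - f (x + t *\<^sub>R b) - f (x + t *\<^sub>R a) + f x - t\<^sup>2 * Db a\<bar> \<le> e / 2 * t\<^sup>2"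
      by (rule second_difference_approx[OF S f' b e2])
    have "\<forall>\<^sub>F t::real in at_right 0. \<bar>Da b - Db a\<bar> \<le> e"
      using A B pos
    proof eventually_elim
      case (elim t)
      \<comment> \<open>The second difference is symmetric in \<open>a\<close> and \<open>b\<close>,
        so both mixed derivatives approximate the same number.\<close>
      have eq: "x + t *\<^sub>R b + t *\<^sub>R a = x + t *\<^sub>R a + t *\<^sub>R b" by simp
      have "\<bar>t\<^sup>2 * Da b - t\<^sup>2 * Db a\<bar> \<le> e * t\<^sup>2"
        using elim(1,2) unfolding eq by linarith
      moreover have "\<bar>t\<^sup>2 * Da b - t\<^sup>2 * Db a\<bar> = t\<^sup>2 * \<bar>Da b - Db a\<bar>"
        by (simp only: right_diff_distrib[symmetric] abs_mult) simp
      ultimately have "t\<^sup>2 * \<bar>Da b - Db a\<bar> \<le> t\<^sup>2 * e" by (simp add: mult.commute)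
      then show ?case using elim(3) by simp
    qed
    then show ?thesis by (simp add: eventually_const)
  qed
  then show ?thesis by (metis abs_le_zero_iff dense_ge eq_iff_diff_eq_0)
qed

text \<open>A product rule that asks only for derivatives of \<open>L y c\<close> at fixed
  \<open>c\<close>. In finite dimension the argument expands in a basis, so finitely many
  \<open>c\<close> control the family. It is applied to Jacobians, Christoffel maps, first
  derivatives and contractions with \<open>w\<close>.\<close>

lemma has_derivative_linear_family_apply:
  fixes L :: "'e::real_normed_vector \<Rightarrow> 'f::euclidean_space \<Rightarrow> 'g::real_normed_vector"
  assumes S: "open S" "x \<in> S" and lin: "\<And>y. y \<in> S \<Longrightarrow> linear (L y)"
    and L: "\<And>c. ((\<lambda>y. L y c) has_derivative (\<lambda>a. L' a c)) (at x)"
    and V: "(V has_derivative V') (at x)"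
  shows "((\<lambda>y. L y (V y)) has_derivative (\<lambda>a. L' a (V x) + L x (V' a))) (at x)"
    and "linear (L' a)"
proof -
  have expand: "L y h = (\<Sum>b\<in>Basis. (h \<bullet> b) *\<^sub>R L y b)" if "y \<in> S" for y h
    by (subst euclidean_representation[of h, symmetric])
       (simp add: linear_sum[OF lin[OF that]] linear_cmul[OF lin[OF that]])
  have L'e: "L' a h = (\<Sum>b\<in>Basis. (h \<bullet> b) *\<^sub>R L' a b)" for a h
  proof -
    have "((\<lambda>y. \<Sum>b\<in>Basis. (h \<bullet> b) *\<^sub>R L y b) has_derivative (\<lambda>a. \<Sum>b\<in>Basis. (h \<bullet> b) *\<^sub>R L' a b)) (at x)"
      by (intro has_derivative_sum has_derivative_scaleR_right L)
    then have "((\<lambda>y. L y h) has_derivative (\<lambda>a. \<Sum>b\<in>Basis. (h \<bullet> b) *\<^sub>R L' a b)) (at x)"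
      by (rule has_derivative_transform_within_open[OF _ S]) (rule expand[symmetric])
    from has_derivative_unique[OF L this] show ?thesis by metis
  qed
  show "linear (L' a)" for a
  proof (rule linearI)
    fix b1 b2 :: 'f and r :: real
    show "L' a (b1 + b2) = L' a b1 + L' a b2"
      unfolding L'e[of a "b1 + b2"] L'e[of a b1] L'e[of a b2]
      by (simp add: inner_add_left scaleR_add_left sum.distrib)
    show "L' a (r *\<^sub>R b1) = r *\<^sub>R L' a b1"
      unfolding L'e[of a "r *\<^sub>R b1"] L'e[of a b1] by (simp add: scaleR_sum_right)
  qed
  have "((\<lambda>y. \<Sum>b\<in>Basis. (V y \<bullet> b) *\<^sub>R L y b) has_derivative
     (\<lambda>a. \<Sum>b\<in>Basis. ((V x \<bullet> b) *\<^sub>R L' a b + (V' a \<bullet> b) *\<^sub>R L x b))) (at x)"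
    by (intro has_derivative_sum has_derivative_scaleR L has_derivative_inner_left V)
  then have "((\<lambda>y. L y (V y)) has_derivative
     (\<lambda>a. \<Sum>b\<in>Basis. ((V x \<bullet> b) *\<^sub>R L' a b + (V' a \<bullet> b) *\<^sub>R L x b))) (at x)"
    by (rule has_derivative_transform_within_open[OF _ S]) (rule expand[symmetric])
  then show "((\<lambda>y. L y (V y)) has_derivative (\<lambda>a. L' a (V x) + L x (V' a))) (at x)"
    by (simp add: sum.distrib L'e[symmetric] expand[OF S(2), symmetric])
qed

section \<open>Closure properties of smoothness\<close>

lemma smooth_on_has_derivative:
  assumes "smooth_on S f" "x \<in> S"
  shows "(f has_derivative frechet_derivative f (at x)) (at x)"
proof -
  have "Ck_on (Suc 0) f S" using assms(1) by (simp only: smooth_on_def)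
  then show ?thesis using assms(2) by (simp add: frechet_derivative_works)
qed

lemma smooth_on_frechet_derivative:
  assumes "smooth_on S f"
  shows "smooth_on S (\<lambda>x. frechet_derivative f (at x) h)"
proof -
  have "Ck_on (Suc k) f S" for k using assms by (simp only: smooth_on_def)
  then show ?thesis by (simp add: smooth_on_def)
qed

lemma smooth_on_cong: "open S \<Longrightarrow> (\<And>y. y \<in> S \<Longrightarrow> f y = g y) \<Longrightarrow> smooth_on S f \<longleftrightarrow> smooth_on S g"
  unfolding smooth_on_def using Ck_on_cong by blast

lemma smooth_on_const: "smooth_on S (\<lambda>_. c)"
  by (simp add: smooth_on_def Ck_on_const)

lemma smooth_on_linear: "bounded_linear f \<Longrightarrow> smooth_on S f"
  by (simp add: smooth_on_def Ck_on_linear)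

lemma smooth_on_add:
  "open S \<Longrightarrow> smooth_on S f \<Longrightarrow> smooth_on S g \<Longrightarrow> smooth_on S (\<lambda>x. f x + g x)"
  by (simp add: smooth_on_def Ck_on_add)

lemma smooth_on_mult:
  fixes f g :: "'e::real_normed_vector \<Rightarrow> real"
  shows "open S \<Longrightarrow> smooth_on S f \<Longrightarrow> smooth_on S g \<Longrightarrow> smooth_on S (\<lambda>x. f x * g x)"
  by (simp add: smooth_on_def Ck_on_mult)

lemma Ck_on_linear_comp:
  assumes "open S" and L: "bounded_linear L"
  shows "Ck_on k f S \<Longrightarrow> Ck_on k (\<lambda>x. L (f x)) S"
proof (induction k arbitrary: f)
  case 0 then show ?case by (simp add: bounded_linear.continuous_on[OF L])
next
  case (Suc k)
  have *: "((\<lambda>x. L (f x)) has_derivative (\<lambda>h. L (frechet_derivative f (at x) h))) (at x)" if "x \<in> S" for x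
    using Suc.prems that
    by (intro bounded_linear.has_derivative[OF L]) (auto simp: frechet_derivative_works[symmetric])
  have "Ck_on k (\<lambda>x. frechet_derivative (\<lambda>x. L (f x)) (at x) h) S
     \<longleftrightarrow> Ck_on k (\<lambda>x. L (frechet_derivative f (at x) h)) S" for h
    by (rule Ck_on_cong[OF assms(1)]) (simp add: frechet_derivative_at[OF *, symmetric])
  then show ?case using Suc * by (auto simp: differentiable_def)
qed

lemma smooth_on_linear_comp:
  "open S \<Longrightarrow> bounded_linear L \<Longrightarrow> smooth_on S f \<Longrightarrow> smooth_on S (\<lambda>x. L (f x))"
  by (simp add: smooth_on_def Ck_on_linear_comp)

text \<open>Fixing the fibre coordinate is the affine embedding of \<open>x\<close> as
  \<open>(x, 0) + (0, p)\<close>; the translation \<open>c\<close> is there for this.\<close>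

lemma Ck_on_compose_affine:
  assumes L: "bounded_linear L" and S: "open S"
  shows "Ck_on k f S \<Longrightarrow> Ck_on k (\<lambda>x. f (L x + c)) ((\<lambda>x. L x + c) -` S)"
proof (induction k arbitrary: f)
  case 0
  have "continuous_on UNIV (\<lambda>x. L x + c)"
    by (intro continuous_intros linear_continuous_on L)
  then show ?case
    using 0 continuous_on_compose2[of S f "(\<lambda>x. L x + c) -` S" "\<lambda>x. L x + c"]
    by (auto intro: continuous_on_subset)
next
  case (Suc k)
  have *: "((\<lambda>x. f (L x + c)) has_derivative (\<lambda>h. frechet_derivative f (at (L x + c)) (L h))) (at x)"
    if "L x + c \<in> S" for x
  proof -
    have 1: "((\<lambda>x. L x + c) has_derivative L) (at x)"
      using bounded_linear_imp_has_derivative[OF L] by (rule has_derivative_add_const)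
    have 2: "(f has_derivative frechet_derivative f (at (L x + c))) (at (L x + c))"
      using Suc.prems that frechet_derivative_works by auto
    show ?thesis using has_derivative_compose[OF 1 2] .
  qed
  have op: "open ((\<lambda>x. L x + c) -` S)"
    using S by (intro open_vimage continuous_intros linear_continuous_on L) auto
  have "Ck_on k (\<lambda>x. frechet_derivative (\<lambda>x. f (L x + c)) (at x) h) ((\<lambda>x. L x + c) -` S)
    \<longleftrightarrow> Ck_on k (\<lambda>x. frechet_derivative f (at (L x + c)) (L h)) ((\<lambda>x. L x + c) -` S)" for h
    by (rule Ck_on_cong[OF op]) (auto simp: frechet_derivative_at[OF *, symmetric])
  moreover have "Ck_on k (\<lambda>x. frechet_derivative f (at (L x + c)) (L h)) ((\<lambda>x. L x + c) -` S)" for h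
    using Suc.IH[of "\<lambda>y. frechet_derivative f (at y) (L h)"] Suc.prems by simp
  ultimately show ?case using * by (auto simp: differentiable_def)
qed

lemma smooth_on_compose_affine:
  "bounded_linear L \<Longrightarrow> open S \<Longrightarrow> smooth_on S f \<Longrightarrow>
    smooth_on ((\<lambda>x. L x + c) -` S) (\<lambda>x. f (L x + c))"
  by (simp add: smooth_on_def Ck_on_compose_affine)

lemma smooth_on_sum:
  assumes "open S" "finite F" "\<And>A. A \<in> F \<Longrightarrow> smooth_on S (f A)"
  shows "smooth_on S (\<lambda>x. \<Sum>A\<in>F. f A x)"
  using assms(2,3) by (induction F rule: finite_induct) (auto intro: smooth_on_const smooth_on_add[OF assms(1)])

lemma smooth_on_diff:
  assumes "open S" "smooth_on S f" "smooth_on S g"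
  shows "smooth_on S (\<lambda>x. f x - g x)"
  using smooth_on_add[OF assms(1,2) smooth_on_linear_comp[OF assms(1) _ assms(3), of uminus]]
  by (simp add: bounded_linear_minus bounded_linear_ident)

lemma smooth_on_vec_lambda:
  fixes f :: "'n::finite \<Rightarrow> 'e::real_normed_vector \<Rightarrow> 'f::euclidean_space"
  assumes "open S" "\<And>A. smooth_on S (f A)"
  shows "smooth_on S (\<lambda>x. \<chi> A. f A x)"
proof -
  have "(\<chi> A. g A) = (\<Sum>A\<in>UNIV. axis A (g A))" for g :: "'n \<Rightarrow> 'f"
    by (simp add: vec_eq_iff axis_def if_distrib[of "\<lambda>v. v $ _"] cong: if_cong)
  moreover have "bounded_linear (axis A :: 'f \<Rightarrow> 'f^'n)" for A
    by (simp add: linear_conv_bounded_linear[symmetric] linear_iff axis_def vec_eq_iff)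
  ultimately show ?thesis
    using assms by (simp add: smooth_on_sum smooth_on_linear_comp)
qed

lemma smooth_on_congI:
  "open S \<Longrightarrow> smooth_on S g \<Longrightarrow> (\<And>y. y \<in> S \<Longrightarrow> f y = g y) \<Longrightarrow> smooth_on S f"
  by (rule smooth_on_cong[THEN iffD2])

lemma smooth_on_slice:
  fixes f :: "'e::real_normed_vector \<times> 'f::real_normed_vector \<Rightarrow> 'g::real_normed_vector"
  assumes S: "open S" and f: "smooth_on (S \<times> UNIV) f"
  shows "smooth_on S (\<lambda>x. f (x, p))"
proof -
  have "bounded_linear (\<lambda>x. (x, 0 :: 'f))" by (intro bounded_linear_Pair bounded_linear_ident bounded_linear_zero)
  moreover have "open (S \<times> (UNIV :: 'f set))" using S by (simp add: open_Times)
  ultimately have "smooth_on ((\<lambda>x. (x, 0) + (0, p)) -` (S \<times> UNIV)) (\<lambda>x. f ((x, 0) + (0, p)))"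
    using f by (rule smooth_on_compose_affine)
  moreover have "(\<lambda>x. (x, 0 :: 'f) + (0, p)) -` (S \<times> UNIV) = S" by auto
  ultimately show ?thesis by simp
qed

lemma smooth_on_Pair:
  assumes "open T" "smooth_on T f" "smooth_on T g"
  shows "smooth_on T (\<lambda>x. (f x, g x))"
proof -
  have "smooth_on T (\<lambda>x. (f x, 0) + (0, g x))"
    by (intro smooth_on_add[OF assms(1)] smooth_on_linear_comp[OF assms(1) _ assms(2)]
        smooth_on_linear_comp[OF assms(1) _ assms(3)] bounded_linear_Pair bounded_linear_ident bounded_linear_zero)
  then show ?thesis by simp
qed

lemma smooth_on_fst:
  fixes f :: "'e::real_normed_vector \<Rightarrow> 'f::real_normed_vector"
  assumes "open S" "smooth_on S f"
  shows "smooth_on (S \<times> (UNIV :: 'g::real_normed_vector set)) (\<lambda>u. f (fst u))"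
proof -
  have "smooth_on ((\<lambda>u. fst u + 0) -` S) (\<lambda>u :: 'e \<times> 'g. f (fst u + 0))"
    by (rule smooth_on_compose_affine[OF bounded_linear_fst assms])
  moreover have "(\<lambda>u. fst u + 0) -` S = S \<times> (UNIV :: 'g set)" by auto
  ultimately show ?thesis by simp
qed

text \<open>Young's theorem for the scalar functions \<open>v y \<bullet> b\<close> gives the
  symmetry once \<open>b\<close> varies. The first claim is the product rule for a derivative
  evaluated on a moving vector \<open>V\<close>.\<close>

lemma frechet_derivative_second:
  fixes v :: "'e::euclidean_space \<Rightarrow> 'f::euclidean_space"
  assumes S: "open S" "x \<in> S" and v: "smooth_on S v" and V: "(V has_derivative V') (at x)"
  shows "((\<lambda>y. frechet_derivative v (at y) (V y)) has_derivative
      (\<lambda>a. frechet_derivative (\<lambda>y. frechet_derivative v (at y) (V x)) (at x) a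
         + frechet_derivative v (at x) (V' a))) (at x)"
    and "linear (\<lambda>c. frechet_derivative (\<lambda>y. frechet_derivative v (at y) c) (at x) a)"
    and "frechet_derivative (\<lambda>y. frechet_derivative v (at y) c) (at x) a
       = frechet_derivative (\<lambda>y. frechet_derivative v (at y) a) (at x) c"
proof -
  let ?D2 = "\<lambda>a c. frechet_derivative (\<lambda>y. frechet_derivative v (at y) c) (at x) a"
  have d: "(v has_derivative frechet_derivative v (at y)) (at y)" if "y \<in> S" for y
    by (rule smooth_on_has_derivative[OF v that])
  have d2: "((\<lambda>y. frechet_derivative v (at y) c) has_derivative (\<lambda>a. ?D2 a c)) (at x)" for c
    using smooth_on_has_derivative[OF smooth_on_frechet_derivative[OF v] S(2)] .
  note * = has_derivative_linear_family_apply[where L = "\<lambda>y. frechet_derivative v (at y)" and L' = ?D2,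
      OF S _ d2 V]
  show "((\<lambda>y. frechet_derivative v (at y) (V y)) has_derivative
      (\<lambda>a. ?D2 a (V x) + frechet_derivative v (at x) (V' a))) (at x)"
    using *(1) d has_derivative_linear by blast
  show "linear (?D2 a)" using *(2) d has_derivative_linear by blast
  show "?D2 a c = ?D2 c a"
  proof (rule vector_eq_rdot[THEN iffD1], rule allI)
    fix b
    show "?D2 a c \<bullet> b = ?D2 c a \<bullet> b"
    proof (rule second_derivative_symmetric[where f = "\<lambda>y. v y \<bullet> b"
          and f' = "\<lambda>y h. frechet_derivative v (at y) h \<bullet> b", OF S])
      show "((\<lambda>y. v y \<bullet> b) has_derivative (\<lambda>h. frechet_derivative v (at y) h \<bullet> b)) (at y)" if "y \<in> S" for y
        by (rule has_derivative_inner_left[OF d[OF that]])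
      show "((\<lambda>y. frechet_derivative v (at y) c \<bullet> b) has_derivative (\<lambda>a. ?D2 a c \<bullet> b)) (at x)"
        "((\<lambda>y. frechet_derivative v (at y) a \<bullet> b) has_derivative (\<lambda>c. ?D2 c a \<bullet> b)) (at x)"
        by (rule has_derivative_inner_left[OF d2])+
    qed
  qed
qed

section \<open>The Lie derivative of the Patterson--Walker metric in a chart\<close>

text \<open>Written as \<open>christoffel_vec\<close> of the differentiated symbols, so that
  bilinearity in the two remaining arguments is inherited.\<close>

definition christoffel_deriv :: "'n::finite christoffel \<Rightarrow> real^'n \<Rightarrow> real^'n \<Rightarrow> real^'n \<Rightarrow> real^'n \<Rightarrow> real^'n" where
  "christoffel_deriv G x h =
     christoffel_vec (\<lambda>y A C B. frechet_derivative (\<lambda>z. G z A C B) (at y) h) x"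

definition second_deriv :: "('e::real_normed_vector \<Rightarrow> 'f::real_normed_vector) \<Rightarrow> 'e \<Rightarrow> 'e \<Rightarrow> 'e \<Rightarrow> 'f" where
  "second_deriv v x a c = frechet_derivative (\<lambda>y. frechet_derivative v (at y) c) (at x) a"

text \<open>The Lie derivative of the connection along \<open>v\<close> in coordinates. All terms
  but the last treat the Christoffel symbols as a tensor with one upper and two lower indices;
  \<open>second_deriv\<close> accounts for their inhomogeneous transformation law. For a
  torsion-free connection this is \<open>D\<^sub>A D\<^sub>B v\<^sup>C + v\<^sup>D
  R\<^sub>D\<^sub>A\<^sup>C\<^sub>B\<close>.\<close>

definition lie_connection :: "'n::finite christoffel \<Rightarrow> (real^'n \<Rightarrow> real^'n) \<Rightarrow> real^'n \<Rightarrow> real^'n \<Rightarrow> real^'n \<Rightarrow> real^'n" where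
  "lie_connection G v x a c =
     christoffel_deriv G x (v x) a c - frechet_derivative v (at x) (christoffel_vec G x a c)
     + christoffel_vec G x (frechet_derivative v (at x) a) c
     + christoffel_vec G x a (frechet_derivative v (at x) c) + second_deriv v x a c"

definition curvature_vec :: "'n::finite christoffel \<Rightarrow> real^'n \<Rightarrow> real^'n \<Rightarrow> real^'n \<Rightarrow> real^'n \<Rightarrow> real^'n" where
  "curvature_vec G x a b c =
     christoffel_deriv G x a b c - christoffel_deriv G x b a c
     + christoffel_vec G x a (christoffel_vec G x b c) - christoffel_vec G x b (christoffel_vec G x a c)"

text \<open>For skew \<open>w\<close> this is the covariant derivative of \<open>w\<close> in
  direction \<open>a\<close>, evaluated on the covectors \<open>p\<close> and \<open>q\<close>. The
  minus sign arises because \<open>q\<close> is contracted with the first index of \<open>w\<close>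
  instead of the second.\<close>

definition cov_biv_form :: "'n::finite christoffel \<Rightarrow> (real^'n \<Rightarrow> real^'n^'n) \<Rightarrow> real^'n \<Rightarrow> real^'n \<Rightarrow> real^'n \<Rightarrow> real^'n \<Rightarrow> real" where
  "cov_biv_form G w x a p q =
     (p v* frechet_derivative w (at x) a) \<bullet> q - p \<bullet> christoffel_vec G x a (q v* w x)
     + q \<bullet> christoffel_vec G x a (p v* w x)"

text \<open>The sum of the three lifts in one chart, as \<open>lift_total_chart\<close> confirms;
  treating the sum at once lets one computation serve all three lifts and the converse.\<close>

definition lift_field :: "'n::finite christoffel \<Rightarrow> (real^'n \<Rightarrow> real^'n^'n) \<Rightarrow> (real^'n \<Rightarrow> real^'n) \<Rightarrow>
    (real^'n \<Rightarrow> real^'n) \<Rightarrow> (real^'n) \<times> (real^'n) \<Rightarrow> (real^'n) \<times> (real^'n)" where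
  "lift_field G w v \<alpha> u =
     (v (fst u) + snd u v* w (fst u),
      \<chi> C. \<alpha> (fst u) $ C - snd u \<bullet> frechet_derivative v (at (fst u)) (axis C 1)
         + snd u \<bullet> christoffel_vec G (fst u) (axis C 1) (snd u v* w (fst u)))"

lemma linear_christoffel_vec:
  "linear (christoffel_vec G x a)" "linear (\<lambda>a. christoffel_vec G x a c)"
  by (rule linearI; simp add: christoffel_vec_def vec_eq_iff distrib_left distrib_right
      sum.distrib sum_distrib_left mult_ac)+

lemmas christoffel_vec_simps =
  linear_add[OF linear_christoffel_vec(1)] linear_add[OF linear_christoffel_vec(2)]
  linear_cmul[OF linear_christoffel_vec(1)] linear_cmul[OF linear_christoffel_vec(2)]
  linear_diff[OF linear_christoffel_vec(1)] linear_diff[OF linear_christoffel_vec(2)]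
  linear_0[OF linear_christoffel_vec(1)] linear_0[OF linear_christoffel_vec(2)]
  linear_neg[OF linear_christoffel_vec(1)] linear_neg[OF linear_christoffel_vec(2)]

lemma christoffel_vec_axis:
  "christoffel_vec G x (axis A 1) c $ C = (\<Sum>B\<in>UNIV. G x A C B * c $ B)"
  "christoffel_vec G x c (axis A 1) $ C = (\<Sum>B\<in>UNIV. G x B C A * c $ B)"
proof -
  have 1: "(\<Sum>B\<in>UNIV. G x A' C B * axis A 1 $ A' * c $ B) = (if A' = A then \<Sum>B\<in>UNIV. G x A C B * c $ B else 0)"
    and 2: "(\<Sum>B\<in>UNIV. G x A' C B * c $ A' * axis A 1 $ B) = G x A' C A * c $ A'" for A'
    by (simp_all add: axis_def if_distrib[of "\<lambda>r. _ * r"] cong: if_cong)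
  show "christoffel_vec G x (axis A 1) c $ C = (\<Sum>B\<in>UNIV. G x A C B * c $ B)"
    "christoffel_vec G x c (axis A 1) $ C = (\<Sum>B\<in>UNIV. G x B C A * c $ B)"
    by (simp_all add: christoffel_vec_def 1 2)
qed

lemma linear_vector_matrix_mult:
  "linear (\<lambda>p. p v* (W :: real^'n^'m))" "linear (\<lambda>W. p v* (W :: real^'n^'m))"
  by (rule linearI; simp add: vector_matrix_mult_def vec_eq_iff distrib_left distrib_right
      sum.distrib sum_distrib_left mult_ac)+

lemmas vector_matrix_mult_simps =
  linear_add[OF linear_vector_matrix_mult(1)] linear_add[OF linear_vector_matrix_mult(2)]
  linear_cmul[OF linear_vector_matrix_mult(1)] linear_cmul[OF linear_vector_matrix_mult(2)]
  linear_0[OF linear_vector_matrix_mult(1)] linear_0[OF linear_vector_matrix_mult(2)]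

lemma linear_expand_axis:
  fixes F :: "real^'n \<Rightarrow> 'f::real_vector"
  assumes "linear F"
  shows "F x = (\<Sum>A\<in>UNIV. x $ A *\<^sub>R F (axis A 1))"
proof -
  have "F x = F (\<Sum>A\<in>UNIV. x $ A *\<^sub>R axis A 1)"
    using basis_expansion[of x] by (simp add: scalar_mult_eq_scaleR)
  then show ?thesis by (simp add: linear_sum[OF assms(1)] linear_cmul[OF assms(1)])
qed

lemma linear_vanish_axis:
  fixes F :: "real^'n \<Rightarrow> 'f::real_vector"
  assumes "linear F" "\<And>A. F (axis A 1) = 0"
  shows "F x = 0"
  by (subst linear_expand_axis[OF assms(1)]) (simp add: assms(2))

text \<open>Here \<open>2\<close> is a vector numeral and \<open>*\<close> the componentwise
  product; a sum of two equal vectors can take this shape under simplification.\<close>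

lemma inner_double: "(a :: real^'n) \<bullet> (2 * b) = 2 * (a \<bullet> b)"
  by (simp only: mult_2 inner_add_right)

text \<open>Fibre parts are stored index by index; this recovers them as linear forms that can be
  tested against any vector.\<close>

lemma vec_lambda_linear_inner:
  fixes F :: "real^'n \<Rightarrow> real"
  assumes "linear F"
  shows "(\<chi> A. F (axis A 1)) \<bullet> h = F h"
  by (subst linear_expand_axis[OF assms, of h]) (simp add: inner_vec_def mult.commute)

text \<open>The index \<open>i\<close> is kept since \<open>pw_metric\<close> takes the whole family of Christoffel symbols.\<close>

locale connection_chart =
  fixes S :: "(real^'n) set" and \<Gamma> :: "'i \<Rightarrow> 'n christoffel" and i :: 'i
  assumes open_S: "open S"
    and smooth_\<Gamma>: "\<And>A C B. smooth_on S (\<lambda>x. \<Gamma> i x A C B)"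
    and sym_\<Gamma>: "\<And>x A C B. x \<in> S \<Longrightarrow> \<Gamma> i x A C B = \<Gamma> i x B C A"
begin

abbreviation "chr \<equiv> christoffel_vec (\<Gamma> i)"
abbreviation "dchr \<equiv> christoffel_deriv (\<Gamma> i)"

lemma chr_sym: "x \<in> S \<Longrightarrow> chr x a c = chr x c a"
  unfolding christoffel_vec_def
  by (subst sum.swap) (simp add: sym_\<Gamma>[of x] mult_ac)

lemma has_derivative_chr:
  assumes "x \<in> S"
  shows "((\<lambda>y. chr y a c) has_derivative (\<lambda>h. dchr x h a c)) (at x)"
  unfolding christoffel_deriv_def christoffel_vec_def
  by (intro has_derivative_vec_lambda' has_derivative_sum has_derivative_mult_left
      smooth_on_has_derivative[OF smooth_\<Gamma> assms])

lemma linear_dchr: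
  "linear (dchr x h a)" "linear (\<lambda>a. dchr x h a c)"
  unfolding christoffel_deriv_def by (rule linear_christoffel_vec)+

lemma linear_dchr_direction: "x \<in> S \<Longrightarrow> linear (\<lambda>h. dchr x h a c)"
  using has_derivative_chr has_derivative_linear by blast

lemma dchr_sym:
  assumes "x \<in> S" shows "dchr x h a c = dchr x h c a"
proof -
  have "((\<lambda>y. chr y c a) has_derivative (\<lambda>h. dchr x h a c)) (at x)"
    by (rule has_derivative_transform_within_open[OF has_derivative_chr[OF assms] open_S assms])
       (rule chr_sym)
  from has_derivative_unique[OF this has_derivative_chr[OF assms]] show ?thesis by metis
qed

lemma pw_metric_sym_inner:
  assumes "fst u \<in> S"
  shows "pw_metric \<Gamma> i u Y Z = fst Y \<bullet> snd Z + snd Y \<bullet> fst Z - 2 * (snd u \<bullet> chr (fst u) (fst Y) (fst Z))"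
  unfolding pw_metric_inner by (simp only: chr_sym[OF assms, of "fst Z"] inner_add_right mult_2)

lemma open_Times_UNIV: "open (S \<times> (UNIV :: (real^'n) set))"
  using open_S by (simp add: open_Times)

lemma has_derivative_pw_metric:
  assumes u: "fst u \<in> S"
  shows "((\<lambda>y. pw_metric \<Gamma> i y Y Z) has_derivative
    (\<lambda>h. - 2 * (snd h \<bullet> chr (fst u) (fst Y) (fst Z) + snd u \<bullet> dchr (fst u) (fst h) (fst Y) (fst Z)))) (at u)"
proof -
  have c: "((\<lambda>y. chr (fst y) (fst Y) (fst Z)) has_derivative (\<lambda>h. dchr (fst u) (fst h) (fst Y) (fst Z))) (at u)"
    by (rule has_derivative_compose[OF has_derivative_fst[OF has_derivative_ident] has_derivative_chr[OF u]])
  have "((\<lambda>y. fst Y \<bullet> snd Z + snd Y \<bullet> fst Z - 2 * (snd y \<bullet> chr (fst y) (fst Y) (fst Z)))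
    has_derivative (\<lambda>h. 0 - 2 * (snd u \<bullet> dchr (fst u) (fst h) (fst Y) (fst Z) + snd h \<bullet> chr (fst u) (fst Y) (fst Z)))) (at u)"
    by (intro has_derivative_diff has_derivative_const has_derivative_mult_right has_derivative_inner
        has_derivative_snd has_derivative_ident c)
  then have "((\<lambda>y. pw_metric \<Gamma> i y Y Z)
    has_derivative (\<lambda>h. 0 - 2 * (snd u \<bullet> dchr (fst u) (fst h) (fst Y) (fst Z) + snd h \<bullet> chr (fst u) (fst Y) (fst Z)))) (at u)"
    by (rule has_derivative_transform_within_open[OF _ open_Times_UNIV])
       (use u in \<open>auto simp: mem_Times_iff pw_metric_sym_inner\<close>)
  then show ?thesis by (simp add: algebra_simps)
qed

lemma lie_metric_formula:
  assumes u: "fst u \<in> S" and X: "(X has_derivative X') (at u)"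
  shows "lie_metric X (pw_metric \<Gamma> i) u Y Z =
    - 2 * (snd (X u) \<bullet> chr (fst u) (fst Y) (fst Z) + snd u \<bullet> dchr (fst u) (fst (X u)) (fst Y) (fst Z))
    + (fst (X' Y) \<bullet> snd Z + snd (X' Y) \<bullet> fst Z - 2 * (snd u \<bullet> chr (fst u) (fst (X' Y)) (fst Z)))
    + (fst Y \<bullet> snd (X' Z) + snd Y \<bullet> fst (X' Z) - 2 * (snd u \<bullet> chr (fst u) (fst Y) (fst (X' Z))))"
  unfolding lie_metric_def frechet_derivative_at[OF X, symmetric]
    frechet_derivative_at[OF has_derivative_pw_metric[OF u], symmetric]
    pw_metric_sym_inner[OF u] by simp

text \<open>Polarization: the Lie derivative is a symmetric bilinear form, so its diagonal
  determines it.\<close>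

lemma lie_metric_polarize:
  assumes u: "fst u \<in> S" and X: "(X has_derivative X') (at u)"
  shows "(\<forall>Y Z. lie_metric X (pw_metric \<Gamma> i) u Y Z = 0) \<longleftrightarrow>
    (\<forall>Y. lie_metric X (pw_metric \<Gamma> i) u Y Y = 0)"
proof -
  let ?Q = "lie_metric X (pw_metric \<Gamma> i) u"
  have lin: "linear X'" using X has_derivative_linear by blast
  have "?Q (Y + Z) (Y + Z) = ?Q Y Y + 2 * ?Q Y Z + ?Q Z Z" for Y Z
    unfolding lie_metric_formula[OF u X]
    by (simp add: linear_add[OF lin] christoffel_vec_simps linear_add[OF linear_dchr(1)]
        linear_add[OF linear_dchr(2)] inner_add_left inner_add_right
        chr_sym[OF u, of "fst (X' Z)"] chr_sym[OF u, of "fst Z" "fst (X' Y)"]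
        chr_sym[OF u, of "fst Z" "fst Y"] dchr_sym[OF u, of _ "fst Z" "fst Y"]
        inner_commute[of "fst (X' Z)"] inner_commute[of "snd (X' Z)"] inner_commute[of "fst (X' Y)" "snd Z"]
        inner_commute[of "snd (X' Y)" "fst Z"] inner_double)
  then show ?thesis by force
qed

lemma inner_snd_lift_field:
  assumes "(v has_derivative v') (at (fst u))"
  shows "snd (lift_field (\<Gamma> i) w v \<alpha> u) \<bullet> c =
    \<alpha> (fst u) \<bullet> c - snd u \<bullet> v' c + snd u \<bullet> chr (fst u) c (snd u v* w (fst u))"
proof -
  have v': "linear v'" using assms has_derivative_linear by blast
  have "linear (\<lambda>c. \<alpha> (fst u) \<bullet> c - snd u \<bullet> v' c + snd u \<bullet> chr (fst u) c (snd u v* w (fst u)))"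
    by (rule linearI) (simp_all add: linear_add[OF v'] linear_cmul[OF v'] christoffel_vec_simps inner_add_right algebra_simps)
  from vec_lambda_linear_inner[OF this, of c] show ?thesis
    by (simp add: lift_field_def frechet_derivative_at[OF assms, symmetric] inner_axis)
qed

text \<open>The fibre part of the derivative is described only through inner products with arbitrary
  \<open>c\<close>, which is how the Lie derivative of the metric meets it.\<close>

lemma has_derivative_lift_field:
  assumes x: "fst u \<in> S" and w: "smooth_on S w" and v: "smooth_on S v" and \<alpha>: "smooth_on S \<alpha>"
  defines "Dw \<equiv> frechet_derivative w (at (fst u))" and "Dv \<equiv> frechet_derivative v (at (fst u))"
    and "s \<equiv> snd u v* w (fst u)"
  obtains X' where "(lift_field (\<Gamma> i) w v \<alpha> has_derivative X') (at u)"
    "\<And>Y. fst (X' Y) = Dv (fst Y) + (snd u v* Dw (fst Y) + snd Y v* w (fst u))"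
    "\<And>Y c. snd (X' Y) \<bullet> c = frechet_derivative \<alpha> (at (fst u)) (fst Y) \<bullet> c
        - (snd u \<bullet> second_deriv v (fst u) (fst Y) c + snd Y \<bullet> Dv c)
        + (snd u \<bullet> (dchr (fst u) (fst Y) c s + chr (fst u) c (snd u v* Dw (fst Y) + snd Y v* w (fst u)))
           + snd Y \<bullet> chr (fst u) c s)"
proof -
  have u: "u \<in> S \<times> UNIV" using x by (simp add: mem_Times_iff)
  have F: "(fst has_derivative fst) (at u)" and N: "(snd has_derivative snd) (at u)"
    by (rule has_derivative_fst[OF has_derivative_ident] has_derivative_snd[OF has_derivative_ident])+
  have ds: "((\<lambda>y. snd y v* w (fst y)) has_derivative
      (\<lambda>h. snd u v* Dw (fst h) + snd h v* w (fst u))) (at u)"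
  proof (rule has_derivative_linear_family_apply(1)[OF open_Times_UNIV u _ _ N, where L = "\<lambda>y p. p v* w (fst y)"])
    fix c
    have "bounded_linear (\<lambda>W. c v* (W :: real^'n^'n))"
      using linear_vector_matrix_mult(2) linear_conv_bounded_linear by blast
    then show "((\<lambda>y. c v* w (fst y)) has_derivative (\<lambda>h. c v* Dw (fst h))) (at u)"
      unfolding Dw_def
      by (rule bounded_linear.has_derivative[OF _ has_derivative_compose[OF F smooth_on_has_derivative[OF w x]]])
  qed (rule linear_vector_matrix_mult)
  have dc: "((\<lambda>y. chr (fst y) c (snd y v* w (fst y))) has_derivative
      (\<lambda>h. dchr (fst u) (fst h) c s + chr (fst u) c (snd u v* Dw (fst h) + snd h v* w (fst u)))) (at u)" for c
    unfolding s_def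
    by (rule has_derivative_linear_family_apply(1)[OF open_Times_UNIV u _ _ ds, where L = "\<lambda>y p. chr (fst y) c p"])
       (rule linear_christoffel_vec has_derivative_compose[OF F has_derivative_chr[OF x]])+
  have dv: "((\<lambda>y. frechet_derivative v (at (fst y)) c) has_derivative (\<lambda>h. second_deriv v (fst u) (fst h) c)) (at u)" for c
    unfolding second_deriv_def
    by (rule has_derivative_compose[OF F smooth_on_has_derivative[OF smooth_on_frechet_derivative[OF v] x]])
  have d\<alpha>: "((\<lambda>y. \<alpha> (fst y) $ C) has_derivative (\<lambda>h. frechet_derivative \<alpha> (at (fst u)) (fst h) $ C)) (at u)" for C
    by (rule bounded_linear.has_derivative[OF bounded_linear_vec_nth
        has_derivative_compose[OF F smooth_on_has_derivative[OF \<alpha> x]]])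
  \<comment> \<open>\<open>K h\<close> is the linear form that the fibre part of the derivative in
    direction \<open>h\<close> represents; its linearity is checked afterwards.\<close>
  define K where "K h c = frechet_derivative \<alpha> (at (fst u)) (fst h) \<bullet> c
        - (snd u \<bullet> second_deriv v (fst u) (fst h) c + snd h \<bullet> Dv c)
        + (snd u \<bullet> (dchr (fst u) (fst h) c s + chr (fst u) c (snd u v* Dw (fst h) + snd h v* w (fst u)))
           + snd h \<bullet> chr (fst u) c s)" for h c
  define X' where "X' h = (Dv (fst h) + (snd u v* Dw (fst h) + snd h v* w (fst u)), \<chi> C. K h (axis C 1))" for h
  have K: "((\<lambda>y. \<alpha> (fst y) $ C - snd y \<bullet> frechet_derivative v (at (fst y)) (axis C 1)
         + snd y \<bullet> chr (fst y) (axis C 1) (snd y v* w (fst y))) has_derivative (\<lambda>h. K h (axis C 1))) (at u)" for C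
    unfolding K_def inner_axis inner_real_def mult_1_right Dv_def s_def[symmetric]
    by (rule derivative_eq_intros d\<alpha> has_derivative_inner[OF N dv] has_derivative_inner[OF N dc] refl)+
       (simp add: s_def)
  have "(lift_field (\<Gamma> i) w v \<alpha> has_derivative X') (at u)"
    unfolding lift_field_def X'_def Dv_def
    by (intro has_derivative_Pair has_derivative_vec_lambda' K has_derivative_add ds
        has_derivative_compose[OF F smooth_on_has_derivative[OF v x]])
  moreover have "snd (X' Y) \<bullet> c = K Y c" for Y c
  proof -
    have l1: "linear Dv"
      unfolding Dv_def using has_derivative_linear smooth_on_has_derivative[OF v x] by blast
    have l2: "linear (second_deriv v (fst u) a)" for a
      unfolding second_deriv_def
      by (rule frechet_derivative_second(2)[OF open_S x v has_derivative_ident])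
    have "linear (K Y)"
      by (rule linearI) (simp_all add: K_def linear_add[OF l1] linear_cmul[OF l1] linear_add[OF l2] linear_cmul[OF l2]
         christoffel_vec_simps linear_add[OF linear_dchr(2)] linear_cmul[OF linear_dchr(2)] inner_add_right algebra_simps)
    from vec_lambda_linear_inner[OF this, of c] show ?thesis by (simp add: X'_def)
  qed
  ultimately show ?thesis using that[of X'] by (simp add: X'_def K_def)
qed

text \<open>Parallelism of \<open>w\<close> is used twice: it cancels every term linear in the fibre
  part of \<open>Y\<close>, and it turns the remaining derivative of \<open>w\<close> into the
  iterated Christoffel term that completes the curvature.\<close>

lemma lie_metric_lift_field:
  assumes x: "fst u \<in> S" and w: "smooth_on S w" and v: "smooth_on S v" and \<alpha>: "smooth_on S \<alpha>"
    and anti: "\<And>p q. (p v* w (fst u)) \<bullet> q = - ((q v* w (fst u)) \<bullet> p)"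
    and par: "\<And>a p q. cov_biv_form (\<Gamma> i) w (fst u) a p q = 0"
  shows "lie_metric (lift_field (\<Gamma> i) w v \<alpha>) (pw_metric \<Gamma> i) u Y Y =
    2 * ((frechet_derivative \<alpha> (at (fst u)) (fst Y) \<bullet> fst Y - \<alpha> (fst u) \<bullet> chr (fst u) (fst Y) (fst Y))
      - snd u \<bullet> lie_connection (\<Gamma> i) v (fst u) (fst Y) (fst Y)
      + snd u \<bullet> curvature_vec (\<Gamma> i) (fst u) (fst Y) (snd u v* w (fst u)) (fst Y))"
proof -
  define x' a b p s where "x' = fst u" and "a = fst Y" and "b = snd Y" and "p = snd u" and "s = p v* w x'"
  note defs = x'_def a_def b_def p_def
  have xS: "x' \<in> S" using x by (simp add: x'_def)
  let ?Dw = "frechet_derivative w (at x')" and ?Dv = "frechet_derivative v (at x')"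
  have vd: "(v has_derivative ?Dv) (at x')" by (rule smooth_on_has_derivative[OF v xS])
  obtain X' where X': "(lift_field (\<Gamma> i) w v \<alpha> has_derivative X') (at u)"
    and f: "\<And>Y. fst (X' Y) = ?Dv (fst Y) + (p v* ?Dw (fst Y) + snd Y v* w x')"
    and n: "\<And>Y c. snd (X' Y) \<bullet> c = frechet_derivative \<alpha> (at x') (fst Y) \<bullet> c
        - (p \<bullet> second_deriv v x' (fst Y) c + snd Y \<bullet> ?Dv c)
        + (p \<bullet> (dchr x' (fst Y) c s + chr x' c (p v* ?Dw (fst Y) + snd Y v* w x'))
           + snd Y \<bullet> chr x' c s)"
    unfolding defs s_def using has_derivative_lift_field[OF x w v \<alpha>] by blast
  have X: "snd (lift_field (\<Gamma> i) w v \<alpha> u) \<bullet> c = \<alpha> x' \<bullet> c - p \<bullet> ?Dv c + p \<bullet> chr x' c s"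
    "fst (lift_field (\<Gamma> i) w v \<alpha> u) = v x' + s" for c
    using inner_snd_lift_field[OF vd[unfolded x'_def], of w \<alpha> c] by (simp_all add: defs s_def lift_field_def)
  have par': "(q v* ?Dw a) \<bullet> r = q \<bullet> chr x' a (r v* w x') - r \<bullet> chr x' a (q v* w x')" for q r
    using par[of a q r] by (simp add: cov_biv_form_def x'_def)
  have wb: "(b v* w x') \<bullet> b = 0" using anti[of b b] by (simp add: x'_def)
  \<comment> \<open>The covector obtained by composing \<open>p\<close> with the Christoffel map at
    \<open>a\<close>. Parallelism applied to \<open>p\<close> and \<open>r\<close> rewrites the
    derivative of \<open>w\<close>, and skewness removes the contraction of \<open>w\<close> with
    \<open>r\<close> twice.\<close>
  define r where "r = (\<chi> C. p \<bullet> chr x' a (axis C 1))"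
  have r: "r \<bullet> h = p \<bullet> chr x' a h" for h
  proof -
    have "linear (\<lambda>h. p \<bullet> chr x' a h)"
      by (rule linearI) (simp_all add: christoffel_vec_simps inner_add_right)
    from vec_lambda_linear_inner[OF this] show ?thesis by (simp add: r_def)
  qed
  have Dwp: "p \<bullet> chr x' a (p v* ?Dw a) = - (p \<bullet> chr x' a (chr x' a s))"
  proof -
    have "p \<bullet> chr x' a (p v* ?Dw a) = (p v* ?Dw a) \<bullet> r" by (simp add: r inner_commute)
    also have "\<dots> = r \<bullet> (r v* w x') - r \<bullet> chr x' a s"
      unfolding par' r s_def ..
    also have "r \<bullet> (r v* w x') = 0" using anti[of r r] by (simp add: x'_def inner_commute)
    finally show ?thesis by (simp add: r)
  qed
  have "lie_metric (lift_field (\<Gamma> i) w v \<alpha>) (pw_metric \<Gamma> i) u Y Y / 2 =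
     - (snd (lift_field (\<Gamma> i) w v \<alpha> u) \<bullet> chr x' a a + p \<bullet> dchr x' (v x' + s) a a)
     + (fst (X' Y) \<bullet> b + snd (X' Y) \<bullet> a - 2 * (p \<bullet> chr x' a (fst (X' Y))))"
    unfolding lie_metric_formula[OF x X'] defs[symmetric] X(2)
    by (simp add: chr_sym[OF xS, of "fst (X' Y)"] inner_commute)
  also have "\<dots> = (frechet_derivative \<alpha> (at x') a \<bullet> a - \<alpha> x' \<bullet> chr x' a a)
      - p \<bullet> lie_connection (\<Gamma> i) v x' a a + p \<bullet> curvature_vec (\<Gamma> i) x' a s a
      + ((p v* ?Dw a) \<bullet> b + b \<bullet> chr x' a s - p \<bullet> chr x' a (b v* w x'))"
    unfolding X(1) n f defs[symmetric] lie_connection_def curvature_vec_def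
    by (simp add: christoffel_vec_simps inner_add_right inner_add_left inner_diff_right wb Dwp
        linear_add[OF linear_dchr_direction[OF xS]] chr_sym[OF xS, of "?Dv a" a] chr_sym[OF xS, of s]
        dchr_sym[OF xS, of a s] inner_commute[of b] inner_double)
  \<comment> \<open>The leftover is exactly the part linear in \<open>b\<close>, the fibre part of
    \<open>Y\<close>; the part quadratic in \<open>b\<close> has already vanished by
    skewness.\<close>
  also have "(p v* ?Dw a) \<bullet> b + b \<bullet> chr x' a s - p \<bullet> chr x' a (b v* w x') = 0"
    by (simp add: par' s_def)
  finally show ?thesis by (simp add: defs s_def)
qed

end

section \<open>The affine equations without indices\<close>

text \<open>
  The condition integrates to \<open>(F p - F q) \<bullet> (p - q) = 0\<close>, whence \<open>(F p - F 0) \<bullet> q\<close> is antisymmetric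
  in \<open>p, q\<close> and therefore bilinear; no second derivatives of \<open>F\<close> are needed.
\<close>

lemma skew_derivative_affine:
  fixes F :: "real^'n \<Rightarrow> real^'n"
  assumes F: "\<And>p. (F has_derivative F' p) (at p)" and skew: "\<And>p b. F' p b \<bullet> b = 0"
  defines "W \<equiv> (\<chi> A B. (F (axis A 1) - F 0) $ B)"
  shows "F p = F 0 + p v* W" and "(p v* W) \<bullet> q = - ((q v* W) \<bullet> p)"
proof -
  have mono: "(F p - F q) \<bullet> (p - q) = 0" for p q
  proof -
    define \<phi> where "\<phi> t = F (q + t *\<^sub>R (p - q)) \<bullet> (p - q)" for t :: real
    have "(\<phi> has_derivative (\<lambda>h. 0)) (at t)" for t
    proof -
      have "((\<lambda>t. q + t *\<^sub>R (p - q)) has_derivative (\<lambda>h. h *\<^sub>R (p - q))) (at t)"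
        by (auto intro!: derivative_eq_intros)
      from has_derivative_inner_left[OF has_derivative_compose[OF this F], of "p - q"]
      have "(\<phi> has_derivative (\<lambda>h. F' (q + t *\<^sub>R (p - q)) (h *\<^sub>R (p - q)) \<bullet> (p - q))) (at t)"
        unfolding \<phi>_def .
      moreover have "F' (q + t *\<^sub>R (p - q)) (h *\<^sub>R (p - q)) \<bullet> (p - q) = 0" for h
        using skew[of "q + t *\<^sub>R (p - q)" "p - q"]
          linear_cmul[OF has_derivative_linear[OF F], of "q + t *\<^sub>R (p - q)" h "p - q"] by simp
      ultimately show ?thesis by simp
    qed
    then have "DERIV \<phi> t :> 0" for t
      by (rule has_derivative_imp_has_field_derivative) simp
    then have "\<phi> 1 = \<phi> 0" using DERIV_isconst_all by blast
    then show ?thesis by (simp add: \<phi>_def inner_diff_left)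
  qed
  define \<zeta> where "\<zeta> p = F p - F 0" for p
  have z0: "\<zeta> p \<bullet> p = 0" for p using mono[of p 0] by (simp add: \<zeta>_def)
  have z: "\<zeta> p \<bullet> q = - (\<zeta> q \<bullet> p)" for p q
    using mono[of p q] z0[of p] z0[of q] by (simp add: \<zeta>_def inner_diff_left inner_diff_right)
  have zW: "\<zeta> p = p v* W" for p
  proof -
    have "\<zeta> p $ B = (p v* W) $ B" for B
    proof -
      \<comment> \<open>Skewness moves \<open>p\<close> into the second slot of the inner product,
        where dependence on it is visibly linear; only the values at basis covectors remain.\<close>
      have c: "\<zeta> (axis B 1) $ A = - W $ A $ B" for A
        using z[of "axis B 1" "axis A 1"] by (simp add: inner_axis W_def \<zeta>_def)
      have "\<zeta> p $ B = \<zeta> p \<bullet> axis B 1" by (simp add: inner_axis)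
      also have "\<dots> = - (\<zeta> (axis B 1) \<bullet> p)" by (rule z)
      also have "\<dots> = (p v* W) $ B"
        by (simp add: inner_vec_def c vector_matrix_mult_def sum_negf mult.commute)
      finally show ?thesis .
    qed
    then show ?thesis by (simp add: vec_eq_iff)
  qed
  show "F p = F 0 + p v* W" using zW[of p] by (simp add: \<zeta>_def algebra_simps)
  show "(p v* W) \<bullet> q = - ((q v* W) \<bullet> p)" using z[of p q] by (simp add: zW)
qed

text \<open>Along the ray from 0 the difference of \<open>f\<close> and the proposed polynomial has
  zero derivative. Differentiating the polynomial symmetrizes \<open>B\<close>, so uniqueness of
  derivatives forces \<open>B\<close> to be symmetric; this is the integrability condition of the
  prescribed derivative.\<close>

lemma affine_derivative_quadratic:
  fixes f :: "'e::euclidean_space \<Rightarrow> real"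
  assumes f: "\<And>p. (f has_derivative (\<lambda>q. L q + B p q)) (at p)" and L: "linear L" and B: "bilinear B"
  shows "f p = f 0 + L p + B p p / 2" and "B p q = B q p"
proof -
  have *: "f p = f 0 + L p + B p p / 2" for p
  proof -
    define \<phi> where "\<phi> t = f (t *\<^sub>R p) - t * L p - t\<^sup>2 * (B p p / 2)" for t :: real
    have "(\<phi> has_derivative (\<lambda>h. 0)) (at t)" for t
    proof -
      have 1: "((\<lambda>t. t *\<^sub>R p) has_derivative (\<lambda>h. h *\<^sub>R p)) (at t)"
        by (auto intro!: derivative_eq_intros)
      have "(\<phi> has_derivative (\<lambda>h. (L (h *\<^sub>R p) + B (t *\<^sub>R p) (h *\<^sub>R p)) - h * L p
          - (2 * h * t) * (B p p / 2))) (at t)"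
        unfolding \<phi>_def
        by (intro has_derivative_diff has_derivative_compose[OF 1 f])
           (auto intro!: derivative_eq_intros)
      moreover have "(L (h *\<^sub>R p) + B (t *\<^sub>R p) (h *\<^sub>R p)) - h * L p - (2 * h * t) * (B p p / 2) = 0" for h
        by (simp add: linear_cmul[OF L] bilinear_lmul[OF B] bilinear_rmul[OF B])
      ultimately show ?thesis by simp
    qed
    then have "DERIV \<phi> t :> 0" for t
      by (rule has_derivative_imp_has_field_derivative) simp
    then have "\<phi> 1 = \<phi> 0" using DERIV_isconst_all by blast
    then show ?thesis by (simp add: \<phi>_def)
  qed
  show "f p = f 0 + L p + B p p / 2" by (rule *)
  interpret B: bounded_bilinear B using B bilinear_conv_bounded_bilinear by blast
  have "(L has_derivative L) (at p)"
    using L linear_conv_bounded_linear bounded_linear_imp_has_derivative by blast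
  then have "((\<lambda>p. f 0 + L p + B p p / 2) has_derivative (\<lambda>q. 0 + L q + (B p q + B q p) / 2)) (at p)"
    unfolding divide_inverse
    by (intro has_derivative_add has_derivative_const has_derivative_mult_left B.FDERIV has_derivative_ident)
  moreover have "(\<lambda>p. f 0 + L p + B p p / 2) = f" by (rule ext) (rule *[symmetric])
  ultimately have "(f has_derivative (\<lambda>q. 0 + L q + (B p q + B q p) / 2)) (at p)" by (simp only:)
  from fun_cong[OF has_derivative_unique[OF this f], of q] show "B p q = B q p" by simp
qed

text \<open>Polarization on basis vectors: it translates an equation symmetrized over a pair of
  indices into the vanishing of a quadratic form.\<close>

lemma bilinear_alternating_iff:
  fixes T :: "real^'n \<Rightarrow> real^'n \<Rightarrow> real"
  assumes T: "bilinear T"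
  shows "(\<forall>a. T a a = 0) \<longleftrightarrow> (\<forall>A B. T (axis A 1) (axis B 1) + T (axis B 1) (axis A 1) = 0)"
proof
  assume z: "\<forall>a. T a a = 0"
  show "\<forall>A B. T (axis A 1) (axis B 1) + T (axis B 1) (axis A 1) = 0"
  proof (intro allI)
    fix A B
    have "T (a + c) (a + c) = T a a + T a c + (T c a + T c c)" for a c
      by (simp add: bilinear_ladd[OF T] bilinear_radd[OF T])
    from this[of "axis A 1" "axis B 1"]
    show "T (axis A 1) (axis B 1) + T (axis B 1) (axis A 1) = 0"
      using z by (simp only: add_0 add_0_right)
  qed
next
  assume z: "\<forall>A B. T (axis A 1) (axis B 1) + T (axis B 1) (axis A 1) = 0"
  have l: "linear (T a)" "linear (\<lambda>a. T a c)" for a c using T by (simp_all add: bilinear_def)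
  show "\<forall>a. T a a = 0"
  proof
    fix a
    have "T a c + T c a = 0" for c
    proof (rule linear_vanish_axis[where F = "\<lambda>c. T a c + T c a"])
      show "linear (\<lambda>c. T a c + T c a)" by (intro linear_compose_add l)
      fix B
      show "T a (axis B 1) + T (axis B 1) a = 0"
        by (rule linear_vanish_axis[where F = "\<lambda>a. T a (axis B 1) + T (axis B 1) a"])
           (use z in \<open>auto intro: linear_compose_add l\<close>)
    qed
    from this[of a] show "T a a = 0" by simp
  qed
qed

lemma axis_vector_matrix_mult: "axis A 1 v* (W :: real^'n^'m) = W $ A"
  by (simp add: vec_eq_iff vector_matrix_mult_def axis_def mult_delta_left)

lemma christoffel_vec_axis_axis: "christoffel_vec G x (axis A 1) (axis B 1) $ C = G x A C B"
  unfolding christoffel_vec_axis(1) by (simp add: axis_def mult_delta_right)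

lemma pd_component:
  assumes "(f has_derivative f') (at x)"
  shows "pd A (\<lambda>y. f y $ B) x = f' (axis A 1) $ B"
  unfolding pd_def
  by (simp only: frechet_derivative_at[OF bounded_linear.has_derivative[OF bounded_linear_vec_nth assms], symmetric])

lemma cov_biv_eq_form:
  assumes "(w has_derivative w') (at x)" and anti: "\<And>A B. w x $ A $ B = - w x $ B $ A"
  shows "cov_biv G w x C A B = cov_biv_form G w x (axis C 1) (axis A 1) (axis B 1)"
proof -
  have "pd C (\<lambda>y. w y $ A $ B) x = w' (axis C 1) $ A $ B"
    unfolding pd_def
    by (simp only: frechet_derivative_at[OF bounded_linear.has_derivative[OF
        bounded_linear_compose[OF bounded_linear_vec_nth bounded_linear_vec_nth] assms(1)], symmetric])
  moreover have "(axis A 1 v* w' (axis C 1)) \<bullet> axis B 1 = w' (axis C 1) $ A $ B"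
    by (simp add: inner_axis axis_vector_matrix_mult)
  moreover have "axis A 1 \<bullet> christoffel_vec G x (axis C 1) (axis B 1 v* w x)
     = - (\<Sum>E\<in>UNIV. G x C A E * w x $ E $ B)"
    by (simp add: inner_axis' christoffel_vec_axis axis_vector_matrix_mult anti[of B] sum_negf)
  moreover have "axis B 1 \<bullet> christoffel_vec G x (axis C 1) (axis A 1 v* w x)
     = (\<Sum>E\<in>UNIV. G x C B E * w x $ A $ E)"
    by (simp add: inner_axis' christoffel_vec_axis axis_vector_matrix_mult)
  ultimately show ?thesis
    unfolding cov_biv_def cov_biv_form_def frechet_derivative_at[OF assms(1), symmetric] by simp
qed

lemma skew_matrix_iff:
  "(\<forall>A B. W $ A $ B = - (W $ B $ A)) \<longleftrightarrow> (\<forall>p q. (p v* W) \<bullet> q = - ((q v* W) \<bullet> p))"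
  for W :: "real^'n^'n"
proof
  assume a: "\<forall>A B. W $ A $ B = - (W $ B $ A)"
  have e: "(p v* W) \<bullet> q = (\<Sum>B\<in>UNIV. \<Sum>A\<in>UNIV. W $ A $ B * p $ A * q $ B)" for p q
    by (simp add: inner_vec_def vector_matrix_mult_def sum_distrib_right sum_distrib_left mult_ac)
  show "\<forall>p q. (p v* W) \<bullet> q = - ((q v* W) \<bullet> p)"
  proof (intro allI)
    fix p q
    have "W $ A $ B * p $ A * q $ B = - (W $ B $ A * q $ B * p $ A)" for A B
      using a[rule_format, of A B] by simp
    then have "(p v* W) \<bullet> q = (\<Sum>B\<in>UNIV. \<Sum>A\<in>UNIV. - (W $ B $ A * q $ B * p $ A))"
      unfolding e by (intro sum.cong refl)
    also have "\<dots> = - (\<Sum>A\<in>UNIV. \<Sum>B\<in>UNIV. W $ B $ A * q $ B * p $ A)"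
      by (subst sum.swap) (simp only: sum_negf)
    finally show "(p v* W) \<bullet> q = - ((q v* W) \<bullet> p)" unfolding e[of q p] .
  qed
next
  assume a: "\<forall>p q. (p v* W) \<bullet> q = - ((q v* W) \<bullet> p)"
  have "(axis A 1 v* W) \<bullet> axis B 1 = - ((axis B 1 v* W) \<bullet> axis A 1)" for A B by (rule a[rule_format])
  then have "W $ A $ B = - (W $ B $ A)" for A B
    unfolding axis_vector_matrix_mult inner_axis inner_real_def mult_1_right .
  then show "\<forall>A B. W $ A $ B = - (W $ B $ A)" by blast
qed

context connection_chart
begin

lemma cov_biv_zero_iff:
  fixes w :: "real^'n \<Rightarrow> real^'n^'n"
  assumes w: "smooth_on S w" and x: "x \<in> S" and anti: "\<And>A B. w x $ A $ B = - (w x $ B $ A)"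
  shows "(\<forall>C A B. cov_biv (\<Gamma> i) w x C A B = 0) \<longleftrightarrow> (\<forall>a p q. cov_biv_form (\<Gamma> i) w x a p q = 0)"
proof -
  let ?F = "cov_biv_form (\<Gamma> i) w x"
  have d: "(w has_derivative frechet_derivative w (at x)) (at x)" by (rule smooth_on_has_derivative[OF w x])
  have l: "linear (frechet_derivative w (at x))" using d has_derivative_linear by blast
  have l1: "linear (\<lambda>a. ?F a p q)" and l2: "linear (\<lambda>p. ?F a p q)" and l3: "linear (\<lambda>q. ?F a p q)" for a p q
    by (rule linearI; simp add: cov_biv_form_def linear_add[OF l] linear_cmul[OF l] vector_matrix_mult_simps
       christoffel_vec_simps inner_add_left inner_add_right algebra_simps)+
  have "(\<forall>C A B. ?F (axis C 1) (axis A 1) (axis B 1) = 0) \<longleftrightarrow> (\<forall>a p q. ?F a p q = 0)"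
  proof
    assume z: "\<forall>C A B. ?F (axis C 1) (axis A 1) (axis B 1) = 0"
    have 3: "?F (axis C 1) (axis A 1) q = 0" for C A q
      by (rule linear_vanish_axis[OF l3]) (rule z[rule_format])
    have 2: "?F (axis C 1) p q = 0" for C p q
      by (rule linear_vanish_axis[OF l2]) (rule 3)
    have "?F a p q = 0" for a p q
      by (rule linear_vanish_axis[OF l1]) (rule 2)
    then show "\<forall>a p q. ?F a p q = 0" by blast
  qed blast
  then show ?thesis by (simp only: cov_biv_eq_form[OF d anti])
qed

lemma killing_form_iff:
  assumes \<alpha>: "smooth_on S \<alpha>" and x: "x \<in> S"
  shows "(\<forall>A B. (cov_form (\<Gamma> i) \<alpha> x A B + cov_form (\<Gamma> i) \<alpha> x B A) / 2 = 0) \<longleftrightarrow>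
    (\<forall>a. frechet_derivative \<alpha> (at x) a \<bullet> a - \<alpha> x \<bullet> chr x a a = 0)"
proof -
  define T where "T a c = frechet_derivative \<alpha> (at x) a \<bullet> c - \<alpha> x \<bullet> chr x a c" for a c
  have d: "(\<alpha> has_derivative frechet_derivative \<alpha> (at x)) (at x)" by (rule smooth_on_has_derivative[OF \<alpha> x])
  have l: "linear (frechet_derivative \<alpha> (at x))" using d has_derivative_linear by blast
  have "bilinear T"
    unfolding bilinear_def T_def
    by (intro conjI allI linearI) (simp_all add: linear_add[OF l] linear_cmul[OF l] christoffel_vec_simps
       inner_add_left inner_add_right algebra_simps)
  moreover have "cov_form (\<Gamma> i) \<alpha> x A B = T (axis A 1) (axis B 1)" for A B
  proof -
    have "\<alpha> x \<bullet> chr x (axis A 1) (axis B 1) = (\<Sum>C\<in>UNIV. \<Gamma> i x A C B * \<alpha> x $ C)"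
      by (simp add: inner_vec_def christoffel_vec_axis_axis mult.commute)
    then show ?thesis by (simp add: cov_form_def T_def pd_component[OF d] inner_axis)
  qed
  ultimately show ?thesis using bilinear_alternating_iff[of T] by (simp add: T_def)
qed

lemma curvature_eq_vec:
  assumes x: "x \<in> S"
  shows "curvature (\<Gamma> i) x A B C E = curvature_vec (\<Gamma> i) x (axis A 1) (axis B 1) (axis E 1) $ C"
proof -
  have cv: "cov_vec (\<Gamma> i) (\<lambda>_. axis E 1) = (\<lambda>y B C. \<Gamma> i y B C E)"
    by (simp add: fun_eq_iff cov_vec_def pd_def axis_def if_distrib[of "\<lambda>r. _ * r"] cong: if_cong)
  have "pd A (\<lambda>y. \<Gamma> i y B C E) x = dchr x (axis A 1) (axis B 1) (axis E 1) $ C" for A B C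
    using pd_component[OF has_derivative_chr[OF x, of "axis B 1" "axis E 1"], of A C] by (simp add: christoffel_vec_axis_axis)
  then have "cov_endo (\<Gamma> i) (cov_vec (\<Gamma> i) (\<lambda>_. axis E 1)) x A B C =
     dchr x (axis A 1) (axis B 1) (axis E 1) $ C - (\<Sum>F\<in>UNIV. \<Gamma> i x A F B * \<Gamma> i x F C E)
      + chr x (axis A 1) (chr x (axis B 1) (axis E 1)) $ C" for A B
    by (simp add: cov_endo_def cv christoffel_vec_axis(1)[of _ _ _ "chr x _ _"] christoffel_vec_axis_axis)
  \<comment> \<open>The sum over \<open>F\<close> stems from the lower index of the first covariant
    derivative. It is symmetric in \<open>A\<close> and \<open>B\<close> by torsion-freeness and
    cancels in the commutator.\<close>
  then show ?thesis
    by (simp add: curvature_def curvature_vec_def sym_\<Gamma>[OF x, of A _ B])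
qed

text \<open>The two symmetrizations are undone one after the other: that over the upper pair
  corresponds to equal covectors \<open>p\<close>, that over the lower pair to equal vectors
  \<open>a\<close>.\<close>

lemma integrability_iff:
  assumes x: "x \<in> S" and anti: "\<And>A B. w x $ A $ B = - (w x $ B $ A)"
  shows "(\<forall>A C D E. (w_curvature (\<Gamma> i) w x A C D E + w_curvature (\<Gamma> i) w x D C A E
         + w_curvature (\<Gamma> i) w x A E D C + w_curvature (\<Gamma> i) w x D E A C) / 4 = 0) \<longleftrightarrow>
     (\<forall>p a. p \<bullet> curvature_vec (\<Gamma> i) x a (p v* w x) a = 0)"
proof -
  define Q where "Q p q a c = q \<bullet> curvature_vec (\<Gamma> i) x a (p v* w x) c" for p q a c
  have lin: "linear (\<lambda>a. curvature_vec (\<Gamma> i) x a b c)" "linear (\<lambda>b. curvature_vec (\<Gamma> i) x a b c)"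
    "linear (\<lambda>c. curvature_vec (\<Gamma> i) x a b c)" for a b c
    by (rule linearI; simp add: curvature_vec_def christoffel_vec_simps
        linear_add[OF linear_dchr(1)] linear_cmul[OF linear_dchr(1)]
        linear_add[OF linear_dchr(2)] linear_cmul[OF linear_dchr(2)]
        linear_add[OF linear_dchr_direction[OF x]] linear_cmul[OF linear_dchr_direction[OF x]] algebra_simps)+
  have Qp: "bilinear (\<lambda>p q. Q p q a c)" and Qa: "bilinear (\<lambda>a c. Q p q a c)" for p q a c
    unfolding bilinear_def Q_def
    by (intro conjI allI linearI; simp add: vector_matrix_mult_simps inner_add_left inner_add_right
        linear_add[OF lin(1)] linear_add[OF lin(2)] linear_add[OF lin(3)]
        linear_cmul[OF lin(1)] linear_cmul[OF lin(2)] linear_cmul[OF lin(3)])+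
  have w: "w_curvature (\<Gamma> i) w x A C D E = Q (axis A 1) (axis D 1) (axis C 1) (axis E 1)" for A C D E
  proof -
    \<comment> \<open>Relative to \<open>w_curvature\<close> both the indices of \<open>w\<close>
      and the first index pair of the curvature are interchanged; the two signs cancel.\<close>
    have ax: "(axis A 1 v* w x) $ B = - (w x $ B $ A)" for B
      using anti[of A B] by (simp add: axis_vector_matrix_mult)
    have "Q (axis A 1) (axis D 1) (axis C 1) (axis E 1)
       = (\<Sum>B\<in>UNIV. (axis A 1 v* w x) $ B * curvature (\<Gamma> i) x C B D E)"
      unfolding Q_def by (subst linear_expand_axis[OF lin(2)])
        (simp add: inner_axis' curvature_eq_vec[OF x])
    also have "\<dots> = w_curvature (\<Gamma> i) w x A C D E"
      unfolding w_curvature_def ax by (rule sum.cong) (simp_all add: curvature_def algebra_simps)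
    finally show ?thesis ..
  qed
  have "(\<forall>p a. Q p p a a = 0) \<longleftrightarrow>
     (\<forall>A D a. Q (axis A 1) (axis D 1) a a + Q (axis D 1) (axis A 1) a a = 0)"
    using bilinear_alternating_iff[OF Qp] by blast
  also have "\<dots> \<longleftrightarrow> (\<forall>A D C E. (Q (axis A 1) (axis D 1) (axis C 1) (axis E 1) + Q (axis D 1) (axis A 1) (axis C 1) (axis E 1))
      + (Q (axis A 1) (axis D 1) (axis E 1) (axis C 1) + Q (axis D 1) (axis A 1) (axis E 1) (axis C 1)) = 0)"
  proof -
    have "bilinear (\<lambda>a c. Q p q a c + Q q p a c)" for p q
      using Qa[of p q] Qa[of q p] by (simp add: bilinear_def linear_compose_add)
    from bilinear_alternating_iff[OF this] show ?thesis by blast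
  qed
  finally show ?thesis unfolding w by (auto simp: Q_def add.assoc)
qed

lemma linear_lie_connection:
  assumes v: "smooth_on S v" and x: "x \<in> S"
  shows "linear (\<lambda>a. lie_connection (\<Gamma> i) v x a c)" "linear (\<lambda>c. lie_connection (\<Gamma> i) v x a c)"
    and "lie_connection (\<Gamma> i) v x a c = lie_connection (\<Gamma> i) v x c a"
proof -
  have d: "(v has_derivative frechet_derivative v (at x)) (at x)" by (rule smooth_on_has_derivative[OF v x])
  have l: "linear (frechet_derivative v (at x))" using d has_derivative_linear by blast
  have l2: "linear (second_deriv v x a)" for a
    unfolding second_deriv_def by (rule frechet_derivative_second(2)[OF open_S x v d])
  have sd: "second_deriv v x a c = second_deriv v x c a" for a c
    unfolding second_deriv_def by (rule frechet_derivative_second(3)[OF open_S x v d])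
  show s: "lie_connection (\<Gamma> i) v x a c = lie_connection (\<Gamma> i) v x c a" for a c
    by (simp add: lie_connection_def dchr_sym[OF x, of _ c] chr_sym[OF x, of c] sd[of a c]
      chr_sym[OF x, of "frechet_derivative v (at x) c"])
  show "linear (\<lambda>c. lie_connection (\<Gamma> i) v x a c)" for a
    unfolding lie_connection_def
    by (rule linearI) (simp_all add: linear_add[OF l] linear_cmul[OF l] linear_add[OF l2] linear_cmul[OF l2]
       christoffel_vec_simps linear_add[OF linear_dchr(1)] linear_cmul[OF linear_dchr(1)] algebra_simps)
  then show "linear (\<lambda>a. lie_connection (\<Gamma> i) v x a c)" by (subst s)
qed

text \<open>The commutator of the Lie derivative with \<open>D\<close> is tensorial in
  \<open>X\<close>: first derivatives of \<open>X\<close> cancel, and second derivatives cancel by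
  their symmetry.\<close>

lemma lie_endo_cov_vec:
  assumes v: "smooth_on S v" and U: "open U" "U \<subseteq> S" and X: "smooth_on U X" and x: "x \<in> U"
  shows "lie_endo v (cov_vec (\<Gamma> i) X) x A B - cov_vec (\<Gamma> i) (lie_vec v X) x A B
    = lie_connection (\<Gamma> i) v x (axis A 1) (X x) $ B"
proof -
  let ?DX = "\<lambda>y. frechet_derivative X (at y)" and ?Dv = "\<lambda>y. frechet_derivative v (at y)"
  have xS: "x \<in> S" using x U by blast
  have dX: "(X has_derivative ?DX y) (at y)" if "y \<in> U" for y by (rule smooth_on_has_derivative[OF X that])
  have dv: "(v has_derivative ?Dv y) (at y)" if "y \<in> S" for y by (rule smooth_on_has_derivative[OF v that])
  have lX: "linear (?DX x)" and lv: "linear (?Dv x)"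
    using dX[OF x] dv[OF xS] has_derivative_linear by blast+
  have sum_pd: "(\<Sum>C\<in>UNIV. h $ C * pd C (\<lambda>y. f y $ B) x) = f' h $ B"
    if "(f has_derivative f') (at x)" for f f' x B h
  proof -
    have "f' h $ B = (\<Sum>C\<in>UNIV. h $ C *\<^sub>R f' (axis C 1)) $ B"
      using linear_expand_axis[OF has_derivative_linear[OF that]] by metis
    then show ?thesis by (simp add: pd_component[OF that])
  qed
  have cov: "cov_vec (\<Gamma> i) f y A B = (f' (axis A 1) + chr y (axis A 1) (f y)) $ B"
    if "(f has_derivative f') (at y)" for f f' y A B
    by (simp add: cov_vec_def pd_component[OF that] christoffel_vec_axis)
  have lie: "lie_vec v X y = ?DX y (v y) - ?Dv y (X y)" if "y \<in> U" for y
    unfolding lie_vec_def vec_eq_iff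
    using sum_pd[OF dX[OF that]] sum_pd[OF dv, of y] that U by auto
  have dlie: "(lie_vec v X has_derivative (\<lambda>a. (second_deriv X x a (v x) + ?DX x (?Dv x a))
      - (second_deriv v x a (X x) + ?Dv x (?DX x a)))) (at x)"
  proof (rule has_derivative_transform_within_open[OF _ U(1) x lie[symmetric]])
    show "((\<lambda>y. ?DX y (v y) - ?Dv y (X y)) has_derivative (\<lambda>a. (second_deriv X x a (v x) + ?DX x (?Dv x a))
      - (second_deriv v x a (X x) + ?Dv x (?DX x a)))) (at x)"
      unfolding second_deriv_def
      by (intro has_derivative_diff frechet_derivative_second(1)[OF U(1) x X dv[OF xS]]
          frechet_derivative_second(1)[OF open_S xS v dX[OF x]])
  qed
  have dcov: "((\<lambda>y. ?DX y a + chr y a (X y)) has_derivative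
     (\<lambda>h. second_deriv X x h a + (dchr x h a (X x) + chr x a (?DX x h)))) (at x)" for a
    unfolding second_deriv_def
    by (intro has_derivative_add smooth_on_has_derivative[OF smooth_on_frechet_derivative[OF X] x]
       has_derivative_linear_family_apply(1)[OF open_S xS, where L = "\<lambda>y. chr y a"] linear_christoffel_vec
       has_derivative_chr[OF xS] dX[OF x])
  have pdcov: "pd C (\<lambda>y. cov_vec (\<Gamma> i) X y A B) x = pd C (\<lambda>y. (?DX y (axis A 1) + chr y (axis A 1) (X y)) $ B) x" for C A B
    unfolding pd_def
    by (rule fun_cong[OF frechet_derivative_cong_open[OF U(1) x]]) (rule cov[OF dX])
  have 1: "(\<Sum>C\<in>UNIV. v x $ C * pd C (\<lambda>y. cov_vec (\<Gamma> i) X y A B) x)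
     = (second_deriv X x (v x) (axis A 1) + (dchr x (v x) (axis A 1) (X x) + chr x (axis A 1) (?DX x (v x)))) $ B"
    unfolding pdcov by (rule sum_pd[OF dcov])
  have 2: "(\<Sum>C\<in>UNIV. pd A (\<lambda>y. v y $ C) x * cov_vec (\<Gamma> i) X x C B)
     = (?DX x (?Dv x (axis A 1)) + chr x (?Dv x (axis A 1)) (X x)) $ B"
  proof -
    have "linear (\<lambda>a. ?DX x a + chr x a (X x))" by (intro linear_compose_add lX linear_christoffel_vec)
    from linear_expand_axis[OF this, of "?Dv x (axis A 1)"] show ?thesis
      by (simp add: pd_component[OF dv[OF xS]] cov[OF dX[OF x]])
  qed
  have 3: "(\<Sum>C\<in>UNIV. cov_vec (\<Gamma> i) X x A C * pd C (\<lambda>y. v y $ B) x)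
     = ?Dv x (?DX x (axis A 1) + chr x (axis A 1) (X x)) $ B"
    using sum_pd[OF dv[OF xS], of "?DX x (axis A 1) + chr x (axis A 1) (X x)" B]
    by (simp only: cov[OF dX[OF x]])
  have sd: "second_deriv X x a c = second_deriv X x c a" for a c
    unfolding second_deriv_def by (rule frechet_derivative_second(3)[OF U(1) x X dv[OF xS]])
  show ?thesis
    unfolding lie_endo_def 1 2 3 cov[OF dlie] lie[OF x] lie_connection_def
    by (simp add: linear_add[OF lv] linear_diff[OF lX] christoffel_vec_simps sd[of "v x"])
qed

text \<open>Constant test fields already reach every value of the tensor
  \<open>lie_connection\<close>. Conversely this tensor is symmetric in its two vector arguments, so
  it is recovered from its diagonal and annihilates every test field.\<close>

lemma symmetry_iff:
  assumes v: "smooth_on S v"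
  shows "(\<forall>U X. open U \<and> U \<subseteq> S \<and> smooth_on U X \<longrightarrow>
        (\<forall>x\<in>U. \<forall>A B. lie_endo v (cov_vec (\<Gamma> i) X) x A B = cov_vec (\<Gamma> i) (lie_vec v X) x A B)) \<longleftrightarrow>
     (\<forall>x\<in>S. \<forall>a. lie_connection (\<Gamma> i) v x a a = 0)" (is "?L \<longleftrightarrow> ?R")
proof
  assume L: ?L
  have "lie_connection (\<Gamma> i) v x (axis A 1) c = 0" if x: "x \<in> S" for x A c
  proof -
    have "lie_endo v (cov_vec (\<Gamma> i) (\<lambda>_. c)) x A B = cov_vec (\<Gamma> i) (lie_vec v (\<lambda>_. c)) x A B" for B
      using L open_S x smooth_on_const by blast
    then show ?thesis
      using lie_endo_cov_vec[OF v open_S order_refl smooth_on_const x, of c A] by (simp add: vec_eq_iff)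
  qed
  then have "lie_connection (\<Gamma> i) v x a c = 0" if "x \<in> S" for x a c
    using linear_vanish_axis[OF linear_lie_connection(1)[OF v that]] that by blast
  then show ?R by blast
next
  assume R: ?R
  have z: "lie_connection (\<Gamma> i) v x a c = 0" if x: "x \<in> S" for x a c
  proof -
    note l = linear_lie_connection[OF v x]
    have "lie_connection (\<Gamma> i) v x (a + c) (a + c) = 0" using R x by blast
    then have "lie_connection (\<Gamma> i) v x a c + lie_connection (\<Gamma> i) v x a c = 0"
      using R x l(3)[of c a] by (simp add: linear_add[OF l(1)] linear_add[OF l(2)])
    then show ?thesis by (simp add: vec_eq_iff)
  qed
  show ?L
  proof (intro allI impI ballI)
    fix U x A B and X :: "real^'n \<Rightarrow> real^'n"
    assume U: "open U \<and> U \<subseteq> S \<and> smooth_on U X" and x: "x \<in> U"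
    then have "lie_connection (\<Gamma> i) v x (axis A 1) (X x) = 0" using z by blast
    then show "lie_endo v (cov_vec (\<Gamma> i) X) x A B = cov_vec (\<Gamma> i) (lie_vec v X) x A B"
      using lie_endo_cov_vec[OF v, of U X x A B] U x by simp
  qed
qed

text \<open>The diagonal of the Lie derivative is a polynomial in the free variable
  \<open>p\<close>, so its vanishing on whole fibres splits into one affine equation per
  degree.\<close>

lemma lie_metric_lift_field_iff:
  assumes w: "smooth_on S w" and v: "smooth_on S v" and \<alpha>: "smooth_on S \<alpha>"
    and anti: "\<And>x A B. x \<in> S \<Longrightarrow> w x $ A $ B = - (w x $ B $ A)"
    and par: "\<And>x C A B. x \<in> S \<Longrightarrow> cov_biv (\<Gamma> i) w x C A B = 0"
  shows "(\<forall>u\<in>S \<times> UNIV. \<forall>Y Z. lie_metric (lift_field (\<Gamma> i) w v \<alpha>) (pw_metric \<Gamma> i) u Y Z = 0) \<longleftrightarrow>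
    (\<forall>x\<in>S. \<forall>a. frechet_derivative \<alpha> (at x) a \<bullet> a - \<alpha> x \<bullet> chr x a a = 0) \<and>
    (\<forall>x\<in>S. \<forall>a. lie_connection (\<Gamma> i) v x a a = 0) \<and>
    (\<forall>x\<in>S. \<forall>p a. p \<bullet> curvature_vec (\<Gamma> i) x a (p v* w x) a = 0)"
    (is "?L \<longleftrightarrow> ?R")
proof -
  let ?E0 = "\<lambda>x a. frechet_derivative \<alpha> (at x) a \<bullet> a - \<alpha> x \<bullet> chr x a a"
    and ?E1 = "\<lambda>x a. lie_connection (\<Gamma> i) v x a a"
    and ?E2 = "\<lambda>x p a. p \<bullet> curvature_vec (\<Gamma> i) x a (p v* w x) a"
  have "(\<forall>Y Z. lie_metric (lift_field (\<Gamma> i) w v \<alpha>) (pw_metric \<Gamma> i) (x, p) Y Z = 0) \<longleftrightarrow>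
    (\<forall>a. ?E0 x a - p \<bullet> ?E1 x a + ?E2 x p a = 0)" if x: "x \<in> S" for x p
  proof -
    have x': "fst (x, p) \<in> S" using x by simp
    have an: "(p v* w x) \<bullet> q = - ((q v* w x) \<bullet> p)" for p q using skew_matrix_iff[of "w x"] anti[OF x] by blast
    have pa: "cov_biv_form (\<Gamma> i) w x a p q = 0" for a p q
      using cov_biv_zero_iff[where w = w, OF w x anti[OF x]] par[OF x] by blast
    have "lift_field (\<Gamma> i) w v \<alpha> differentiable (at (x, p))"
      by (rule has_derivative_lift_field[OF x' w v \<alpha>]) (rule differentiableI)
    then have "(lift_field (\<Gamma> i) w v \<alpha> has_derivative frechet_derivative (lift_field (\<Gamma> i) w v \<alpha>) (at (x, p))) (at (x, p))"
      by (simp only: frechet_derivative_works)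
    note pol = lie_metric_polarize[OF x' this]
    have e: "lie_metric (lift_field (\<Gamma> i) w v \<alpha>) (pw_metric \<Gamma> i) (x, p) Y Y =
       2 * (?E0 x (fst Y) - p \<bullet> ?E1 x (fst Y) + ?E2 x p (fst Y))" for Y
      by (rule lie_metric_lift_field[OF x' w v \<alpha>, unfolded fst_conv snd_conv, OF an pa])
    show ?thesis
      unfolding pol e mult_eq_0_iff by (simp add: split_paired_All)
  qed
  then have "?L \<longleftrightarrow> (\<forall>x\<in>S. \<forall>p a. ?E0 x a - p \<bullet> ?E1 x a + ?E2 x p a = 0)" by auto
  also have "\<dots> \<longleftrightarrow> ?R"
  proof
    assume z: "\<forall>x\<in>S. \<forall>p a. ?E0 x a - p \<bullet> ?E1 x a + ?E2 x p a = 0"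
    have "?E0 x a = 0 \<and> ?E1 x a = 0 \<and> ?E2 x p a = 0" if x: "x \<in> S" for x p a
    proof -
      have zq: "?E0 x a - q \<bullet> ?E1 x a + ?E2 x q a = 0" for q using z x by blast
      \<comment> \<open>Setting \<open>p = 0\<close> isolates degree 0. Degrees 1 and 2 are
        separated below by comparing \<open>q\<close> with \<open>- q\<close>, since the curvature
        term is even.\<close>
      have e0: "?E0 x a = 0" using zq[of 0] by simp
      have n: "- q v* w x = - (q v* w x)" for q
        by (rule linear_neg[OF linear_vector_matrix_mult(1)])
      have cn: "curvature_vec (\<Gamma> i) x a (- b) a = - curvature_vec (\<Gamma> i) x a b a" for b
        by (simp add: curvature_vec_def christoffel_vec_simps linear_neg[OF linear_dchr_direction[OF x]]
            linear_neg[OF linear_dchr(2)])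
      have "?E2 x (- q) a = ?E2 x q a" for q by (simp add: n cn)
      then have "q \<bullet> ?E1 x a = 0 \<and> ?E2 x q a = 0" for q
        using zq[of q] zq[of "- q"] e0 by simp
      then show ?thesis using e0 inner_eq_zero_iff by blast
    qed
    then show ?R by blast
  qed simp
  finally show ?thesis .
qed

section \<open>Killing fields in a chart\<close>

text \<open>The data are read off from the slices where \<open>p\<close> is 0 or a basis covector,
  so they are smooth before anything is known about the dependence of \<open>X\<close> on
  \<open>p\<close>. They are prescribed on \<open>S\<close> only, which leaves room for the global
  fields to vanish off the chart ranges.\<close>

lemma killing_on_chart:
  fixes X :: "(real^'n) \<times> (real^'n) \<Rightarrow> (real^'n) \<times> (real^'n)"
  assumes X: "smooth_on (S \<times> UNIV) X"
    and K: "\<And>u Y Z. fst u \<in> S \<Longrightarrow> lie_metric X (pw_metric \<Gamma> i) u Y Z = 0"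
    and v: "\<And>x. x \<in> S \<Longrightarrow> v x = fst (X (x, 0))"
    and \<alpha>: "\<And>x. x \<in> S \<Longrightarrow> \<alpha> x = snd (X (x, 0))"
    and w: "\<And>x. x \<in> S \<Longrightarrow> w x = (\<chi> A B. (fst (X (x, axis A 1)) - fst (X (x, 0))) $ B)"
  shows "smooth_on S v" "smooth_on S \<alpha>" "smooth_on S w"
    and "\<And>x A B. x \<in> S \<Longrightarrow> w x $ A $ B = - (w x $ B $ A)"
    and "\<And>x C A B. x \<in> S \<Longrightarrow> cov_biv (\<Gamma> i) w x C A B = 0"
    and "\<And>u. fst u \<in> S \<Longrightarrow> X u = lift_field (\<Gamma> i) w v \<alpha> u"
proof -
  have sl: "smooth_on S (\<lambda>x. X (x, p))" for p by (rule smooth_on_slice[OF open_S X])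
  have sf: "smooth_on S (\<lambda>x. fst (X (x, p)))" for p
    by (rule smooth_on_linear_comp[OF open_S bounded_linear_fst sl])
  show sv: "smooth_on S v" by (rule smooth_on_congI[OF open_S sf[of 0] v])
  have "smooth_on S (\<lambda>x. snd (X (x, 0)))"
    by (rule smooth_on_linear_comp[OF open_S bounded_linear_snd sl])
  then show s\<alpha>: "smooth_on S \<alpha>" by (rule smooth_on_congI[OF open_S _ \<alpha>])
  have "smooth_on S (\<lambda>x. \<chi> A B. (fst (X (x, axis A 1)) - fst (X (x, 0))) $ B)"
    by (intro smooth_on_vec_lambda[OF open_S] smooth_on_linear_comp[OF open_S bounded_linear_vec_nth]
        smooth_on_diff[OF open_S] sf)
  then show sw: "smooth_on S w" by (rule smooth_on_congI[OF open_S _ w])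
  define X' where "X' u = frechet_derivative X (at u)" for u
  have dX: "(X has_derivative X' u) (at u)" if "fst u \<in> S" for u
    unfolding X'_def by (rule smooth_on_has_derivative[OF X]) (use that in \<open>simp add: mem_Times_iff\<close>)
  have dp: "((\<lambda>p. X (x, p)) has_derivative (\<lambda>b. X' (x, p) (0, b))) (at p)" if x: "x \<in> S" for x p
    by (rule has_derivative_compose[OF has_derivative_Pair[OF has_derivative_const has_derivative_ident] dX])
       (use x in simp)
  have dx: "((\<lambda>y. X (y, p)) has_derivative (\<lambda>a. X' (x, p) (a, 0))) (at x)" if x: "x \<in> S" for x p
    by (rule has_derivative_compose[OF has_derivative_Pair[OF has_derivative_ident has_derivative_const] dX])
       (use x in simp)
  have F: "fst (X (x, p)) = v x + p v* w x" and anti: "(p v* w x) \<bullet> q = - ((q v* w x) \<bullet> p)"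
    if x: "x \<in> S" for x p q
  proof -
    have d: "((\<lambda>p. fst (X (x, p))) has_derivative (\<lambda>b. fst (X' (x, p) (0, b)))) (at p)" for p
      by (rule has_derivative_fst[OF dp[OF x]])
    \<comment> \<open>Both arguments are vertical, where the metric vanishes; only the pairing of
      the base part of the derivative with \<open>b\<close> survives.\<close>
    have skew: "fst (X' (x, p) (0, b)) \<bullet> b = 0" for p b
    proof -
      have x': "fst (x, p) \<in> S" using x by simp
      show ?thesis
        using lie_metric_formula[OF x' dX[OF x'], of "(0, b)" "(0, b)"] K[OF x', of "(0, b)" "(0, b)"]
        by (simp add: christoffel_vec_simps linear_0[OF linear_dchr(1)] inner_commute)
    qed
    note affine = skew_derivative_affine[where F = "\<lambda>p. fst (X (x, p))"
        and F' = "\<lambda>p b. fst (X' (x, p) (0, b))", OF d skew]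
    show "fst (X (x, p)) = v x + p v* w x"
      unfolding v[OF x] w[OF x] by (rule affine(1))
    show "(p v* w x) \<bullet> q = - ((q v* w x) \<bullet> p)"
      unfolding w[OF x] by (rule affine(2))
  qed
  show antiw: "w x $ A $ B = - (w x $ B $ A)" if "x \<in> S" for x A B
    by (rule skew_matrix_iff[THEN iffD2, rule_format, OF anti[OF that]])
  have cov_and_snd: "cov_biv_form (\<Gamma> i) w x a p q = 0"
    "snd (X (x, p)) \<bullet> a = \<alpha> x \<bullet> a - p \<bullet> frechet_derivative v (at x) a + p \<bullet> chr x a (p v* w x)"
    if x: "x \<in> S" for x p q a
  proof -
    let ?Dv = "frechet_derivative v (at x)" and ?Dw = "frechet_derivative w (at x)"
    have dv: "(v has_derivative ?Dv) (at x)" by (rule smooth_on_has_derivative[OF sv x])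
    have dw: "(w has_derivative ?Dw) (at x)" by (rule smooth_on_has_derivative[OF sw x])
    have blw: "bounded_linear (\<lambda>W. p v* (W :: real^'n^'n))" for p
      using linear_vector_matrix_mult(2) linear_conv_bounded_linear by blast
    have dpw: "((\<lambda>y. p v* w y) has_derivative (\<lambda>h. p v* ?Dw h)) (at x)" for p
      by (rule bounded_linear.has_derivative[OF blw dw])
    have fx: "fst (X' (x, p) (a, 0)) = ?Dv a + p v* ?Dw a" for p
    proof -
      have "((\<lambda>y. fst (X (y, p))) has_derivative (\<lambda>a. ?Dv a + p v* ?Dw a)) (at x)"
        by (rule has_derivative_transform_within_open[OF has_derivative_add[OF dv dpw] open_S x])
           (simp add: F)
      from has_derivative_unique[OF has_derivative_fst[OF dx[OF x]] this] show ?thesis by metis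
    qed
    have fp: "fst (X' (x, p) (0, d)) = d v* w x" for p d
    proof -
      have "bounded_linear (\<lambda>p. p v* w x)"
        using linear_vector_matrix_mult(1) linear_conv_bounded_linear by blast
      then have "((\<lambda>p. v x + p v* w x) has_derivative (\<lambda>d. 0 + d v* w x)) (at p)"
        by (intro has_derivative_add has_derivative_const bounded_linear_imp_has_derivative)
      then have "((\<lambda>p. fst (X (x, p))) has_derivative (\<lambda>d. d v* w x)) (at p)"
        by (simp add: F[OF x])
      from has_derivative_unique[OF has_derivative_fst[OF dp[OF x]] this] show ?thesis by metis
    qed
    \<comment> \<open>With the horizontal direction \<open>a\<close> fixed, the mixed Killing
      equation is solved for the fibre derivative of the fibre part paired with \<open>a\<close>:
      \<open>L\<close> is its part independent of \<open>p\<close>, and \<open>B\<close> the part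
      linear in \<open>p\<close>.\<close>
    define L where "L d = - (?Dv a \<bullet> d)" for d
    define B where "B p d = - ((p v* ?Dw a) \<bullet> d) + 2 * (p \<bullet> chr x a (d v* w x))" for p d
    have sp: "snd (X' (x, p) (0, d)) \<bullet> a = L d + B p d" for p d
    proof -
      have x': "fst (x, p) \<in> S" using x by simp
      show ?thesis
        using lie_metric_formula[OF x' dX[OF x'], of "(a, 0)" "(0, d)"] K[OF x', of "(a, 0)" "(0, d)"]
        by (simp add: christoffel_vec_simps linear_0[OF linear_dchr(1)] fx fp L_def B_def
            inner_add_left inner_commute[of a])
    qed
    have f: "((\<lambda>p. snd (X (x, p)) \<bullet> a) has_derivative (\<lambda>d. L d + B p d)) (at p)" for p
      unfolding sp[symmetric] by (rule has_derivative_inner_left[OF has_derivative_snd[OF dp[OF x]]])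
    have L: "linear L" unfolding L_def by (rule linearI) (simp_all add: inner_add_right)
    have B: "bilinear B"
      unfolding bilinear_def B_def
      by (intro conjI allI linearI) (simp_all add: vector_matrix_mult_simps christoffel_vec_simps
          inner_add_left inner_add_right algebra_simps)
    note quad = affine_derivative_quadratic[OF f L B]
    have antiD: "(p v* ?Dw a) \<bullet> q = - ((q v* ?Dw a) \<bullet> p)" for p q
    proof -
      have "((\<lambda>y. - ((q v* w y) \<bullet> p)) has_derivative (\<lambda>a. - ((q v* ?Dw a) \<bullet> p))) (at x)"
        by (intro has_derivative_minus has_derivative_inner_left dpw)
      then have "((\<lambda>y. (p v* w y) \<bullet> q) has_derivative (\<lambda>a. - ((q v* ?Dw a) \<bullet> p))) (at x)"
        by (rule has_derivative_transform_within_open[OF _ open_S x]) (rule anti[symmetric])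
      from has_derivative_unique[OF has_derivative_inner_left[OF dpw] this] show ?thesis by metis
    qed
    \<comment> \<open>Since the derivative of \<open>w\<close> is skew as well,
      \<open>B p q - B q p\<close> is \<open>-2\<close> times this form.\<close>
    show "cov_biv_form (\<Gamma> i) w x a p q = 0"
      using quad(2)[of p q] antiD[of q p] by (simp add: B_def cov_biv_form_def)
    \<comment> \<open>On the diagonal the derivative of \<open>w\<close> drops out by skewness, and
      the factor 2 in \<open>B\<close> cancels the division by 2 from integration.\<close>
    show "snd (X (x, p)) \<bullet> a = \<alpha> x \<bullet> a - p \<bullet> ?Dv a + p \<bullet> chr x a (p v* w x)"
      using quad(1)[of p] antiD[of p p] by (simp add: B_def L_def \<alpha>[OF x] inner_commute)
  qed
  show "cov_biv (\<Gamma> i) w x C A B = 0" if x: "x \<in> S" for x C A B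
    by (rule cov_biv_zero_iff[THEN iffD2, rule_format, OF sw x antiw[OF x] cov_and_snd(1)[OF x]])
  show "X u = lift_field (\<Gamma> i) w v \<alpha> u" if u: "fst u \<in> S" for u
  proof (rule prod_eqI)
    show "fst (X u) = fst (lift_field (\<Gamma> i) w v \<alpha> u)"
      using F[OF u, of "snd u"] by (simp add: lift_field_def)
    have "snd (X u) \<bullet> a = snd (lift_field (\<Gamma> i) w v \<alpha> u) \<bullet> a" for a
      using cov_and_snd(2)[OF u, of "snd u" a] inner_snd_lift_field[OF smooth_on_has_derivative[OF sv u], of w \<alpha> a]
      by simp
    then show "snd (X u) = snd (lift_field (\<Gamma> i) w v \<alpha> u)" by (metis vector_eq_rdot)
  qed
qed

lemma smooth_on_lift_field:
  assumes w: "smooth_on S w" and v: "smooth_on S v" and \<alpha>: "smooth_on S \<alpha>"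
  shows "smooth_on (S \<times> UNIV) (lift_field (\<Gamma> i) w v \<alpha>)"
proof -
  note op = open_Times_UNIV
  have p: "smooth_on (S \<times> UNIV) (\<lambda>u :: (real^'n) \<times> (real^'n). snd u $ C)" for C
    by (intro smooth_on_linear bounded_linear_compose[OF bounded_linear_vec_nth bounded_linear_snd])
  have nth: "smooth_on T (\<lambda>u. f u $ C)" if "open T" "smooth_on T f"
    for T and f :: "(real^'n) \<times> (real^'n) \<Rightarrow> ('z::real_normed_vector)^'n" and C
    by (rule smooth_on_linear_comp[OF that(1) bounded_linear_vec_nth that(2)])
  have s: "smooth_on (S \<times> UNIV) (\<lambda>u. (snd u v* w (fst u)) $ B)" for B
    unfolding vector_matrix_mult_def vec_lambda_beta
    by (intro smooth_on_sum[OF op] smooth_on_mult[OF op] p nth[OF op] smooth_on_fst[OF open_S w] finite)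
  have inner: "smooth_on (S \<times> UNIV) (\<lambda>u. snd u \<bullet> f u)"
    if "\<And>C. smooth_on (S \<times> UNIV) (\<lambda>u. f u $ C)" for f :: "(real^'n) \<times> (real^'n) \<Rightarrow> real^'n"
    unfolding inner_vec_def inner_real_def
    by (intro smooth_on_sum[OF op] smooth_on_mult[OF op] p that finite)
  have "smooth_on (S \<times> UNIV) (\<lambda>u. chr (fst u) (axis C 1) (snd u v* w (fst u)) $ E)" for C E
    unfolding christoffel_vec_axis(1)
    by (intro smooth_on_sum[OF op] smooth_on_mult[OF op] s smooth_on_fst[OF open_S smooth_\<Gamma>] finite)
  note c = inner[OF this]
  have d: "smooth_on (S \<times> UNIV) (\<lambda>u. snd u \<bullet> frechet_derivative v (at (fst u)) (axis C 1))" for C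
    by (intro inner nth[OF op] smooth_on_fst[OF open_S smooth_on_frechet_derivative[OF v]])
  have sv: "smooth_on (S \<times> UNIV) (\<lambda>u. snd u v* w (fst u))"
    using smooth_on_vec_lambda[OF op, where f = "\<lambda>B u. (snd u v* w (fst u)) $ B", OF s] by simp
  show ?thesis
    unfolding lift_field_def
    by (intro smooth_on_Pair[OF op] smooth_on_add[OF op] smooth_on_diff[OF op] smooth_on_vec_lambda[OF op]
        smooth_on_fst[OF open_S v] sv c d nth[OF op] smooth_on_fst[OF open_S \<alpha>])
qed

end

section \<open>Transformation of the lifts\<close>

lemma h_field_sum:
  "(\<Sum>A\<in>UNIV. c $ A *\<^sub>R h_field G A u) =
    (c, \<chi> E. snd u \<bullet> christoffel_vec G (fst u) c (axis E 1))"
proof -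
  have h: "h_field G A u = (axis A 1, \<chi> E. snd u \<bullet> christoffel_vec G (fst u) (axis A 1) (axis E 1))" for A
  proof -
    have "(\<Sum>B\<in>UNIV. \<Sum>C\<in>UNIV. (G (fst u) A C B * snd u $ C) *\<^sub>R p_field B)
      = (0, \<chi> E. \<Sum>C\<in>UNIV. G (fst u) A C E * snd u $ C)"
      by (simp add: p_field_def prod_eq_iff fst_sum snd_sum vec_eq_iff sum_component axis_def
          scaleR_sum_left[symmetric] mult_delta_right)
    then show ?thesis by (simp add: h_field_def inner_vec_def christoffel_vec_axis_axis mult.commute)
  qed
  have "linear (\<lambda>c. snd u \<bullet> christoffel_vec G (fst u) c (axis E 1))" for E
    by (rule linearI) (simp_all add: christoffel_vec_simps inner_add_right)
  from linear_expand_axis[OF this, of c]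
  have "snd u \<bullet> christoffel_vec G (fst u) c (axis E 1)
    = (\<Sum>A\<in>UNIV. c $ A * (snd u \<bullet> christoffel_vec G (fst u) (axis A 1) (axis E 1)))" for E by simp
  then show ?thesis
    unfolding h by (simp add: prod_eq_iff fst_sum snd_sum vec_eq_iff axis_def mult_delta_right)
qed

text \<open>The zero covector reveals \<open>v\<close> and \<alpha>, since every other term carries
  a factor \<open>p\<close>; basis covectors then reveal the rows of \<open>w\<close>.\<close>

lemma lift_field_inject:
  assumes "\<And>p. lift_field G w v \<alpha> (x, p) = lift_field G w' v' \<alpha>' (x, p)"
  shows "w x = w' x" "v x = v' x" "\<alpha> x = \<alpha>' x"
proof -
  show v: "v x = v' x" and "\<alpha> x = \<alpha>' x"
    using assms[of 0] by (simp_all add: lift_field_def vector_matrix_mult_simps vec_eq_iff)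
  have "w x $ A = w' x $ A" for A
    using assms[of "axis A 1"] v by (simp add: lift_field_def axis_vector_matrix_mult)
  then show "w x = w' x" by (simp add: vec_eq_iff)
qed

section \<open>The lifts in the charts of the cotangent bundle\<close>

locale affine_manifold =
  fixes M :: "('i, 'a, real^'n) atlas" and \<Gamma> :: "'i \<Rightarrow> 'n christoffel"
  assumes M: "smooth_manifold M" and connection: "affine_connection M \<Gamma>" and torsion: "torsion_free M \<Gamma>"
begin

abbreviation "TM \<equiv> cotangent_bundle M"

lemma chart: "i \<in> idx M \<Longrightarrow> connection_chart (chart_range M i) \<Gamma> i"
proof
  assume i: "i \<in> idx M"
  show "open (chart_range M i)"
    using M i unfolding smooth_manifold_def by (metis overlap_self)
  show "smooth_on (chart_range M i) (\<lambda>x. \<Gamma> i x A C B)" for A C B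
    using connection i by (simp add: affine_connection_def)
  show "\<Gamma> i x A C B = \<Gamma> i x B C A" if "x \<in> chart_range M i" for x A C B
    using torsion i that by (simp add: torsion_free_def)
qed

lemma in_chart_range_cotangent:
  "i \<in> idx M \<Longrightarrow> u \<in> chart_range TM i \<longleftrightarrow> fst u \<in> chart_range M i"
  by (simp add: chart_range_cotangent[OF M] mem_Times_iff)

lemma lift_plus_chart:
  assumes "i \<in> idx M" "fst u \<in> chart_range M i"
  shows "lift_plus M \<Gamma> w i u = (snd u v* w i (fst u),
    \<chi> E. snd u \<bullet> christoffel_vec (\<Gamma> i) (fst u) (snd u v* w i (fst u)) (axis E 1))"
proof -
  have "lift_plus M \<Gamma> w i u =
     (\<Sum>B\<in>UNIV. \<Sum>A\<in>UNIV. (w i (fst u) $ A $ B * snd u $ A) *\<^sub>R h_field (\<Gamma> i) B u)"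
    using assms by (simp add: lift_plus_def on_charts_def in_chart_range_cotangent) (rule sum.swap)
  also have "\<dots> = (\<Sum>B\<in>UNIV. (snd u v* w i (fst u)) $ B *\<^sub>R h_field (\<Gamma> i) B u)"
    by (simp add: vector_matrix_mult_def scaleR_sum_left mult.commute)
  finally show ?thesis by (simp only: h_field_sum)
qed

lemma lift_minus_chart:
  assumes "i \<in> idx M" "fst u \<in> chart_range M i"
  shows "lift_minus M \<alpha> i u = (0, \<alpha> i (fst u))"
  using assms by (simp add: lift_minus_def on_charts_def in_chart_range_cotangent p_field_def prod_eq_iff
      fst_sum snd_sum vec_eq_iff axis_def mult_delta_right)

text \<open>The trace subtracted in \<open>phi\<close> is restored by the multiple of
  \<open>k_field\<close>, whose factors 1/2 and 2 cancel. The Christoffel terms of the resulting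
  full covariant derivative then cancel those of the horizontal lift by torsion-freeness.\<close>

lemma lift_zero_chart:
  assumes i: "i \<in> idx M" "fst u \<in> chart_range M i" and v: "(v i has_derivative v') (at (fst u))"
  shows "lift_zero M \<Gamma> v i u = (v i (fst u), \<chi> E. - (snd u \<bullet> v' (axis E 1)))"
proof -
  interpret c: connection_chart "chart_range M i" \<Gamma> i by (rule chart[OF i(1)])
  have cov: "cov_vec (\<Gamma> i) (v i) (fst u) B A = (v' (axis B 1) + c.chr (fst u) (axis B 1) (v i (fst u))) $ A" for A B
    by (simp add: cov_vec_def pd_component[OF v] christoffel_vec_axis)
  have "(\<Sum>A\<in>UNIV. \<Sum>B\<in>UNIV. (phi (\<Gamma> i) (v i) (fst u) B A * snd u $ A) *\<^sub>R p_field B)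
       + (1 / 2 * psi (\<Gamma> i) (v i) (fst u)) *\<^sub>R k_field u
     = (0, \<chi> E. (\<Sum>A\<in>UNIV. phi (\<Gamma> i) (v i) (fst u) E A * snd u $ A) + psi (\<Gamma> i) (v i) (fst u) * snd u $ E)"
    by (simp add: k_field_def p_field_def prod_eq_iff fst_sum snd_sum vec_eq_iff axis_def mult_delta_right)
  moreover have "(\<Sum>A\<in>UNIV. phi (\<Gamma> i) (v i) (fst u) E A * snd u $ A) + psi (\<Gamma> i) (v i) (fst u) * snd u $ E
     = (\<Sum>A\<in>UNIV. cov_vec (\<Gamma> i) (v i) (fst u) E A * snd u $ A)" for E
  proof -
    have "phi (\<Gamma> i) (v i) (fst u) E A * snd u $ A = cov_vec (\<Gamma> i) (v i) (fst u) E A * snd u $ A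
       - (if E = A then psi (\<Gamma> i) (v i) (fst u) * snd u $ A else 0)" for A
      by (simp add: phi_def psi_def algebra_simps)
    then show ?thesis by (simp add: sum_subtractf)
  qed
  moreover have "(\<Sum>A\<in>UNIV. cov_vec (\<Gamma> i) (v i) (fst u) E A * snd u $ A)
     = snd u \<bullet> v' (axis E 1) + snd u \<bullet> c.chr (fst u) (v i (fst u)) (axis E 1)" for E
    by (simp add: cov inner_vec_def[of "snd u"] c.chr_sym[OF i(2), of _ "axis E 1"] sum.distrib[symmetric]
        algebra_simps)
  ultimately have "(\<Sum>A\<in>UNIV. \<Sum>B\<in>UNIV. (phi (\<Gamma> i) (v i) (fst u) B A * snd u $ A) *\<^sub>R p_field B)
       + (1 / 2 * psi (\<Gamma> i) (v i) (fst u)) *\<^sub>R k_field u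
     = (0, \<chi> E. snd u \<bullet> v' (axis E 1) + snd u \<bullet> c.chr (fst u) (v i (fst u)) (axis E 1))"
    by simp
  moreover have "lift_zero M \<Gamma> v i u = (\<Sum>A\<in>UNIV. v i (fst u) $ A *\<^sub>R h_field (\<Gamma> i) A u)
     - ((\<Sum>A\<in>UNIV. \<Sum>B\<in>UNIV. (phi (\<Gamma> i) (v i) (fst u) B A * snd u $ A) *\<^sub>R p_field B)
       + (1 / 2 * psi (\<Gamma> i) (v i) (fst u)) *\<^sub>R k_field u)"
    using i by (simp add: lift_zero_def on_charts_def in_chart_range_cotangent)
  ultimately show ?thesis
    by (simp add: h_field_sum prod_eq_iff vec_eq_iff)
qed

lemma lift_total_chart:
  assumes i: "i \<in> idx M" "fst u \<in> chart_range M i" and v: "smooth_on (chart_range M i) (v i)"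
  shows "lift_plus M \<Gamma> w i u + lift_zero M \<Gamma> v i u + lift_minus M \<alpha> i u
    = lift_field (\<Gamma> i) (w i) (v i) (\<alpha> i) u"
proof -
  interpret c: connection_chart "chart_range M i" \<Gamma> i by (rule chart[OF i(1)])
  show ?thesis
    unfolding lift_plus_chart[OF i] lift_minus_chart[OF i]
      lift_zero_chart[where v = v, OF i smooth_on_has_derivative[OF v i(2)]] lift_field_def
    by (simp add: prod_eq_iff vec_eq_iff c.chr_sym[OF i(2), of "axis _ 1"])
qed

text \<open>
  \<open>H\<close> is the second derivative of the transition map; its symmetry is read off from the
  transformation law of two torsion-free connections.
\<close>

lemma jac_cotangent_bundle:
  assumes ij: "i \<in> idx M" "j \<in> idx M" and u: "u \<in> overlap TM i j"
  defines "T \<equiv> transition TM i j" and "K \<equiv> jac TM i j u" and "J \<equiv> jac M i j"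
  obtains H where "\<And>c. ((\<lambda>y. J y c) has_derivative (\<lambda>a. H a c)) (at (fst u))"
    "\<And>a c. J (fst u) (christoffel_vec (\<Gamma> i) (fst u) a c) =
      H a c + christoffel_vec (\<Gamma> j) (fst (T u)) (J (fst u) a) (J (fst u) c)"
    "\<And>a c. H a c = H c a"
    "\<And>Y. fst (K Y) = J (fst u) (fst Y)"
    "\<And>Y h. snd Y \<bullet> h = snd (K Y) \<bullet> J (fst u) h + snd (T u) \<bullet> H (fst Y) h"
proof -
  let ?x = "fst u"
  have ov: "v \<in> overlap TM i j \<longleftrightarrow> fst v \<in> overlap M i j" for v
    by (simp add: overlap_cotangent[OF M ij(1)] mem_Times_iff)
  have x: "?x \<in> overlap M i j" using u ov by simp
  have xi: "?x \<in> chart_range M i" using x by (auto simp: overlap_def chart_range_def)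
  have yj: "transition M i j ?x \<in> chart_range M j"
    using transition_in_overlap[OF M ij(1) x] by (auto simp: overlap_def chart_range_def)
  have op: "open (overlap TM i j)"
    unfolding overlap_cotangent[OF M ij(1)] using M ij by (simp add: smooth_manifold_def open_Times)
  obtain H where H: "\<And>c. ((\<lambda>y. J y c) has_derivative (\<lambda>a. H a c)) (at ?x)"
    and G: "\<And>a c. J ?x (christoffel_vec (\<Gamma> i) ?x a c) =
      H a c + christoffel_vec (\<Gamma> j) (transition M i j ?x) (J ?x a) (J ?x c)"
    unfolding J_def using christoffel_vec_transform[OF M connection ij x] by blast
  have T: "(T has_derivative K) (at u)"
    unfolding T_def K_def by (rule has_derivative_transition_cotangent[OF M ij u])
  have fstT: "fst (T v) = transition M i j (fst v)"
    and sndT: "snd v \<bullet> h = snd (T v) \<bullet> J (fst v) h" if "v \<in> overlap TM i j" for v h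
    using that transition_cotangent[OF M ij, of "fst v" "snd v"]
      transition_cotangent_inner[OF M ij, of "fst v" "snd v" h] ov by (auto simp: T_def J_def)
  have Hs: "H a c = H c a" for a c
  proof -
    have "H a c = J ?x (christoffel_vec (\<Gamma> i) ?x a c)
        - christoffel_vec (\<Gamma> j) (transition M i j ?x) (J ?x a) (J ?x c)" for a c
      using G[of a c] by simp
    then show ?thesis
      using connection_chart.chr_sym[OF chart[OF ij(1)] xi, of a c]
        connection_chart.chr_sym[OF chart[OF ij(2)] yj, of "J ?x a" "J ?x c"] by simp
  qed
  have fstK: "fst (K Y) = J ?x (fst Y)" for Y
  proof -
    have "((\<lambda>v. fst (T v)) has_derivative (\<lambda>Y. J ?x (fst Y))) (at u)"
    proof (rule has_derivative_transform_within_open[OF _ op u])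
      show "((\<lambda>v. transition M i j (fst v)) has_derivative (\<lambda>Y. J ?x (fst Y))) (at u)"
        unfolding J_def
        by (rule has_derivative_compose[OF has_derivative_fst[OF has_derivative_ident]
          has_derivative_transition[OF M ij x]])
    qed (simp add: fstT)
    from fun_cong[OF has_derivative_unique[OF this has_derivative_fst[OF T]], of Y] show ?thesis by simp
  qed
  \<comment> \<open>Differentiating the invariance of the pairing with a fixed \<open>h\<close>
    gives the fibre part without differentiating an inverse Jacobian.\<close>
  have sndK: "snd Y \<bullet> h = snd (K Y) \<bullet> J ?x h + snd (T u) \<bullet> H (fst Y) h" for Y h
  proof -
    have "((\<lambda>v. snd (T v) \<bullet> J (fst v) h) has_derivative
        (\<lambda>Y. snd (T u) \<bullet> H (fst Y) h + snd (K Y) \<bullet> J ?x h)) (at u)"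
      by (rule has_derivative_inner[OF has_derivative_snd[OF T]
        has_derivative_compose[OF has_derivative_fst[OF has_derivative_ident] H]])
    then have "((\<lambda>v. snd v \<bullet> h) has_derivative
        (\<lambda>Y. snd (T u) \<bullet> H (fst Y) h + snd (K Y) \<bullet> J ?x h)) (at u)"
      by (rule has_derivative_transform_within_open[OF _ op u]) (simp add: sndT)
    moreover have "((\<lambda>v. snd v \<bullet> h) has_derivative (\<lambda>Y. snd Y \<bullet> h)) (at u)"
      by (intro has_derivative_inner_left has_derivative_snd has_derivative_ident)
    ultimately have "(\<lambda>Y. snd (T u) \<bullet> H (fst Y) h + snd (K Y) \<bullet> J ?x h) = (\<lambda>Y. snd Y \<bullet> h)"
      by (rule has_derivative_unique)
    from fun_cong[OF this, of Y] show ?thesis by simp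
  qed
  show ?thesis
    by (rule that[OF H _ Hs fstK sndK]) (simp add: G fstT[OF u])
qed

section \<open>Transformation laws tested against covectors\<close>

lemma jac_surj:
  assumes ij: "i \<in> idx M" "j \<in> idx M" and x: "x \<in> overlap M i j"
  shows "jac M i j x (jac M j i (transition M i j x) k) = k"
proof -
  obtain m where m: "x = coord M i m" "m \<in> chart_dom M i" "m \<in> chart_dom M j"
    using x by (auto simp: overlap_def)
  have y: "transition M i j x = coord M j m" using m transition_coord[OF M ij(1)] by simp
  have "coord M j m \<in> chart_range M j" using m by (auto simp: chart_range_def)
  then show ?thesis
    using jac_cocycle[OF M ij(2,1,2) m(3,2,3), of k] jac_self[OF M ij(2)] m(1) y by simp
qed

lemma inner_jac_eqI:
  assumes ij: "i \<in> idx M" "j \<in> idx M" and x: "x \<in> overlap M i j"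
    and eq: "\<And>h. a \<bullet> jac M i j x h = b \<bullet> jac M i j x h"
  shows "a = b"
proof -
  have "a \<bullet> k = b \<bullet> k" for k using eq jac_surj[OF ij x, of k] by metis
  then show ?thesis by (metis vector_eq_rdot)
qed

lemma one_form_law_iff:
  assumes ij: "i \<in> idx M" "j \<in> idx M" and x: "x \<in> overlap M i j"
  shows "(\<forall>A. a $ A = (\<Sum>B\<in>UNIV. jac M i j x (axis A 1) $ B * b $ B)) \<longleftrightarrow> (\<forall>h. a \<bullet> h = b \<bullet> jac M i j x h)"
proof
  assume "\<forall>h. a \<bullet> h = b \<bullet> jac M i j x h"
  then have "a \<bullet> axis A 1 = b \<bullet> jac M i j x (axis A 1)" for A by blast
  then show "\<forall>A. a $ A = (\<Sum>B\<in>UNIV. jac M i j x (axis A 1) $ B * b $ B)"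
    by (simp add: inner_axis) (simp add: inner_vec_def mult.commute)
next
  assume *: "\<forall>A. a $ A = (\<Sum>B\<in>UNIV. jac M i j x (axis A 1) $ B * b $ B)"
  have l: "linear (\<lambda>h. a \<bullet> h - b \<bullet> jac M i j x h)"
    using linear_jac[OF M ij x]
    by (intro linearI) (simp_all add: linear_add linear_cmul inner_add_right algebra_simps)
  have "a \<bullet> axis A 1 - b \<bullet> jac M i j x (axis A 1) = 0" for A
    using *[rule_format, of A] by (simp add: inner_axis) (simp add: inner_vec_def mult.commute)
  from linear_vanish_axis[OF l this] show "\<forall>h. a \<bullet> h = b \<bullet> jac M i j x h" by simp
qed

text \<open>Here \<open>p\<close> and \<open>p'\<close> are the components of one covector in two
  charts. A bivector is thus a map from covectors to vectors, which is the form in which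
  \<open>w\<close> enters the lift and in which its law can be read off from a lift.\<close>

lemma bivector_law_iff:
  assumes ij: "i \<in> idx M" "j \<in> idx M" and x: "x \<in> overlap M i j"
  shows "(\<forall>C D. W' $ C $ D = (\<Sum>A\<in>UNIV. \<Sum>B\<in>UNIV. jac M i j x (axis A 1) $ C * jac M i j x (axis B 1) $ D * W $ A $ B))
    \<longleftrightarrow> (\<forall>p p'. (\<forall>h. p \<bullet> h = p' \<bullet> jac M i j x h) \<longrightarrow> p' v* W' = jac M i j x (p v* W))"
proof -
  let ?J = "jac M i j x"
  have J: "(?J (p v* W)) $ D = (\<Sum>A\<in>UNIV. p $ A * (\<Sum>B\<in>UNIV. ?J (axis B 1) $ D * W $ A $ B))" for p D
  proof -
    have "(?J (p v* W)) $ D = (\<Sum>B\<in>UNIV. (\<Sum>A\<in>UNIV. W $ A $ B * p $ A) * ?J (axis B 1) $ D)"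
      by (subst jac_expand[OF M ij x]) (simp add: vector_matrix_mult_def mult_ac)
    also have "\<dots> = (\<Sum>A\<in>UNIV. \<Sum>B\<in>UNIV. p $ A * (?J (axis B 1) $ D * W $ A $ B))"
      by (subst sum.swap) (simp add: sum_distrib_left sum_distrib_right mult_ac)
    finally show ?thesis by (simp add: sum_distrib_left)
  qed
  have p: "p $ A = (\<Sum>C\<in>UNIV. ?J (axis A 1) $ C * p' $ C)" if "\<forall>h. p \<bullet> h = p' \<bullet> ?J h" for p p' A
    using that one_form_law_iff[OF ij x] by blast
  show ?thesis
  proof
    assume *: "\<forall>C D. W' $ C $ D = (\<Sum>A\<in>UNIV. \<Sum>B\<in>UNIV. ?J (axis A 1) $ C * ?J (axis B 1) $ D * W $ A $ B)"
    show "\<forall>p p'. (\<forall>h. p \<bullet> h = p' \<bullet> ?J h) \<longrightarrow> p' v* W' = ?J (p v* W)"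
    proof (intro allI impI)
      fix p p' assume pp: "\<forall>h. p \<bullet> h = p' \<bullet> ?J h"
      have "(p' v* W') $ D = ?J (p v* W) $ D" for D
      proof -
        have "(p' v* W') $ D = (\<Sum>C\<in>UNIV. \<Sum>A\<in>UNIV. ?J (axis A 1) $ C * p' $ C * (\<Sum>B\<in>UNIV. ?J (axis B 1) $ D * W $ A $ B))"
          by (simp add: vector_matrix_mult_def * sum_distrib_left sum_distrib_right mult_ac)
        also have "\<dots> = (\<Sum>A\<in>UNIV. p $ A * (\<Sum>B\<in>UNIV. ?J (axis B 1) $ D * W $ A $ B))"
          by (subst sum.swap) (simp add: p[OF pp] sum_distrib_right)
        finally show ?thesis by (simp add: J)
      qed
      then show "p' v* W' = ?J (p v* W)" by (simp add: vec_eq_iff)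
    qed
  next
    assume *: "\<forall>p p'. (\<forall>h. p \<bullet> h = p' \<bullet> ?J h) \<longrightarrow> p' v* W' = ?J (p v* W)"
    show "\<forall>C D. W' $ C $ D = (\<Sum>A\<in>UNIV. \<Sum>B\<in>UNIV. ?J (axis A 1) $ C * ?J (axis B 1) $ D * W $ A $ B)"
    proof (intro allI)
      fix C D
      \<comment> \<open>The components in chart \<open>i\<close> of the coordinate 1-form of index
        \<open>C\<close> in chart \<open>j\<close>; contraction with it picks out row
        \<open>C\<close> of \<open>W'\<close>.\<close>
      define p where "p = (\<chi> A. ?J (axis A 1) $ C)"
      have "\<forall>A. p $ A = (\<Sum>B\<in>UNIV. ?J (axis A 1) $ B * axis C 1 $ B)"
        by (simp add: p_def axis_def mult_delta_right)
      then have "axis C 1 v* W' = ?J (p v* W)" using * one_form_law_iff[OF ij x] by blast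
      then have "W' $ C $ D = ?J (p v* W) $ D" by (simp add: axis_vector_matrix_mult)
      then show "W' $ C $ D = (\<Sum>A\<in>UNIV. \<Sum>B\<in>UNIV. ?J (axis A 1) $ C * ?J (axis B 1) $ D * W $ A $ B)"
        by (simp add: J p_def sum_distrib_left mult_ac)
    qed
  qed
qed

text \<open>The derivative of \<open>v\<close> and the Christoffel term each produce a second
  derivative \<open>H\<close> of the coordinate change. Together these form the inhomogeneous term
  in the derivative of the cotangent coordinate change.\<close>

lemma lift_field_transform:
  assumes ij: "i \<in> idx M" "j \<in> idx M" and u: "u \<in> overlap TM i j"
    and w: "bivector_field M w" and v: "vector_field M v" and \<alpha>: "one_form M \<alpha>"
  shows "lift_field (\<Gamma> j) (w j) (v j) (\<alpha> j) (transition TM i j u)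
    = jac TM i j u (lift_field (\<Gamma> i) (w i) (v i) (\<alpha> i) u)"
proof -
  let ?T = "transition TM i j u" and ?K = "jac TM i j u" and ?x = "fst u" and ?J = "jac M i j (fst u)"
  let ?li = "lift_field (\<Gamma> i) (w i) (v i) (\<alpha> i) u" and ?lj = "lift_field (\<Gamma> j) (w j) (v j) (\<alpha> j) ?T"
  obtain H where H: "\<And>c. ((\<lambda>y. jac M i j y c) has_derivative (\<lambda>a. H a c)) (at ?x)"
    and G: "\<And>a c. ?J (christoffel_vec (\<Gamma> i) ?x a c) =
      H a c + christoffel_vec (\<Gamma> j) (fst ?T) (?J a) (?J c)"
    and Hs: "\<And>a c. H a c = H c a"
    and fK: "\<And>Y. fst (?K Y) = ?J (fst Y)"
    and sK: "\<And>Y h. snd Y \<bullet> h = snd (?K Y) \<bullet> ?J h + snd ?T \<bullet> H (fst Y) h"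
    using jac_cotangent_bundle[OF ij u] by blast
  have x: "?x \<in> overlap M i j" using u by (simp add: overlap_cotangent[OF M ij(1)] mem_Times_iff)
  have fT: "fst ?T = transition M i j ?x" and p: "snd u \<bullet> h = snd ?T \<bullet> ?J h" for h
    using transition_cotangent[OF M ij x, of "snd u"] transition_cotangent_inner[OF M ij x, of "snd u" h] by auto
  have xi: "?x \<in> chart_range M i" using x by (auto simp: overlap_def chart_range_def)
  have yj: "fst ?T \<in> chart_range M j"
    using transition_in_overlap[OF M ij(1) x] by (auto simp: fT overlap_def chart_range_def)
  have opx: "open (overlap M i j)" using M ij by (simp add: smooth_manifold_def)
  have dvi: "(v i has_derivative frechet_derivative (v i) (at ?x)) (at ?x)"
    using v ij xi by (intro smooth_on_has_derivative) (auto simp: vector_field_def)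
  have dvj: "(v j has_derivative frechet_derivative (v j) (at (fst ?T))) (at (fst ?T))"
    using v ij yj by (intro smooth_on_has_derivative) (auto simp: vector_field_def)
  have vlaw: "v j (transition M i j y) = jac M i j y (v i y)" if "y \<in> overlap M i j" for y
    using v ij that by (simp add: vector_field_def)
  have wlaw: "snd ?T v* w j (fst ?T) = ?J (snd u v* w i ?x)"
  proof -
    have "\<forall>C D. w j (fst ?T) $ C $ D =
        (\<Sum>A\<in>UNIV. \<Sum>B\<in>UNIV. ?J (axis A 1) $ C * ?J (axis B 1) $ D * w i ?x $ A $ B)"
      using w ij x by (simp add: bivector_field_def fT)
    then show ?thesis using bivector_law_iff[OF ij x] p by blast
  qed
  have \<alpha>law: "\<alpha> i ?x \<bullet> h = \<alpha> j (fst ?T) \<bullet> ?J h" for h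
  proof -
    have "\<forall>A. \<alpha> i ?x $ A = (\<Sum>B\<in>UNIV. ?J (axis A 1) $ B * \<alpha> j (fst ?T) $ B)"
      using \<alpha> ij x by (simp add: one_form_def fT)
    then show ?thesis using one_form_law_iff[OF ij x] by blast
  qed
  \<comment> \<open>Differentiating the law of \<open>v\<close> also differentiates the Jacobian,
    whence the term \<open>H\<close>.\<close>
  have Dv: "frechet_derivative (v j) (at (fst ?T)) (?J h) = H h (v i ?x) + ?J (frechet_derivative (v i) (at ?x) h)" for h
  proof -
    have d1: "((\<lambda>y. v j (transition M i j y)) has_derivative (\<lambda>h. frechet_derivative (v j) (at (fst ?T)) (?J h))) (at ?x)"
      unfolding fT by (rule has_derivative_compose[OF has_derivative_transition[OF M ij x] dvj[unfolded fT]])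
    have d2: "((\<lambda>y. v j (transition M i j y)) has_derivative
       (\<lambda>h. H h (v i ?x) + ?J (frechet_derivative (v i) (at ?x) h))) (at ?x)"
      by (rule has_derivative_transform_within_open[OF
            has_derivative_linear_family_apply(1)[OF opx x linear_jac[OF M ij] H dvi] opx x])
         (simp_all add: vlaw)
    show ?thesis by (rule fun_cong[OF has_derivative_unique[OF d1 d2]])
  qed
  have J: "linear ?J" by (rule linear_jac[OF M ij x])
  have f: "fst ?lj = ?J (fst ?li)"
    using vlaw[OF x, folded fT] by (simp add: lift_field_def wlaw linear_add[OF J])
  show ?thesis
  proof (rule prod_eqI)
    show "fst ?lj = fst (?K ?li)" by (simp add: f fK)
    show "snd ?lj = snd (?K ?li)"
    proof (rule inner_jac_eqI[OF ij x])
      fix h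
      have "snd ?lj \<bullet> ?J h = \<alpha> i ?x \<bullet> h - snd ?T \<bullet> (H h (v i ?x) + ?J (frechet_derivative (v i) (at ?x) h))
         + snd ?T \<bullet> (?J (christoffel_vec (\<Gamma> i) ?x h (snd u v* w i ?x)) - H h (snd u v* w i ?x))"
        unfolding connection_chart.inner_snd_lift_field[OF chart[OF ij(2)] dvj]
        by (simp add: Dv \<alpha>law wlaw G)
      also have "\<dots> = snd ?li \<bullet> h - snd ?T \<bullet> (H h (v i ?x) + H h (snd u v* w i ?x))"
        unfolding connection_chart.inner_snd_lift_field[OF chart[OF ij(1)] dvi] p
        by (simp add: inner_add_right inner_diff_right)
      \<comment> \<open>By symmetry of \<open>H\<close> the two contributions collect into
        \<open>H\<close> applied to the whole base part, as \<open>sK\<close> requires.\<close>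
      also have "H h (v i ?x) + H h (snd u v* w i ?x) = H (fst ?li) h"
        using has_derivative_linear_family_apply(2)[OF opx x linear_jac[OF M ij] H dvi, of h]
        by (simp add: Hs[of _ h] linear_add lift_field_def)
      finally show "snd ?lj \<bullet> ?J h = snd (?K ?li) \<bullet> ?J h" using sK[of ?li h] by simp
    qed
  qed
qed

section \<open>The lift of a triple of affine data on the whole bundle\<close>

definition total_lift :: "('i \<Rightarrow> real^'n \<Rightarrow> real^'n^'n) \<Rightarrow> ('i \<Rightarrow> real^'n \<Rightarrow> real^'n) \<Rightarrow> ('i \<Rightarrow> real^'n \<Rightarrow> real^'n) \<Rightarrow>
    'i \<Rightarrow> (real^'n) \<times> (real^'n) \<Rightarrow> (real^'n) \<times> (real^'n)" where
  "total_lift w v \<alpha> i u = lift_plus M \<Gamma> w i u + lift_zero M \<Gamma> v i u + lift_minus M \<alpha> i u"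

lemma total_lift_off:
  assumes "i \<notin> idx M \<or> u \<notin> chart_range TM i"
  shows "total_lift w v \<alpha> i u = 0"
  using assms by (auto simp: total_lift_def lift_plus_def lift_zero_def lift_minus_def on_charts_def)

lemma total_lift_chart:
  assumes "i \<in> idx M" "fst u \<in> chart_range M i" "smooth_on (chart_range M i) (v i)"
  shows "total_lift w v \<alpha> i u = lift_field (\<Gamma> i) (w i) (v i) (\<alpha> i) u"
  unfolding total_lift_def by (rule lift_total_chart[where v = v, OF assms])

lemma fst_overlap_cotangent:
  assumes ij: "i \<in> idx M" "j \<in> idx M" and u: "u \<in> overlap TM i j"
  shows "fst u \<in> overlap M i j" "fst u \<in> chart_range M i" "fst (transition TM i j u) \<in> chart_range M j"
proof -
  show x: "fst u \<in> overlap M i j" using u by (simp add: overlap_cotangent[OF M ij(1)] mem_Times_iff)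
  then show "fst u \<in> chart_range M i" by (auto simp: overlap_def chart_range_def)
  show "fst (transition TM i j u) \<in> chart_range M j"
    using transition_in_overlap[OF M ij(1) x] transition_cotangent[OF M ij x, of "snd u"]
    by (auto simp: overlap_def chart_range_def)
qed

lemma vector_field_total_lift:
  assumes w: "bivector_field M w" and v: "vector_field M v" and \<alpha>: "one_form M \<alpha>"
  shows "vector_field TM (total_lift w v \<alpha>)"
  unfolding vector_field_def
proof (intro conjI ballI)
  have sv: "smooth_on (chart_range M i) (v i)" if "i \<in> idx M" for i
    using v that by (simp add: vector_field_def)
  show "supported TM (total_lift w v \<alpha>)"
    unfolding supported_def by (simp add: total_lift_off)
  show "smooth_on (chart_range TM i) (total_lift w v \<alpha> i)" if i: "i \<in> idx TM" for i
  proof -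
    have i': "i \<in> idx M" using i by simp
    interpret c: connection_chart "chart_range M i" \<Gamma> i by (rule chart[OF i'])
    have "smooth_on (chart_range M i \<times> UNIV) (lift_field (\<Gamma> i) (w i) (v i) (\<alpha> i))"
      by (rule c.smooth_on_lift_field) (use w \<alpha> sv i' in \<open>auto simp: bivector_field_def one_form_def\<close>)
    then show ?thesis
      unfolding chart_range_cotangent[OF M i']
      by (rule smooth_on_congI[OF c.open_Times_UNIV]) (auto simp: total_lift_chart i' sv)
  qed
  show "total_lift w v \<alpha> j (transition TM i j u) = jac TM i j u (total_lift w v \<alpha> i u)"
    if ij: "i \<in> idx TM" "j \<in> idx TM" and u: "u \<in> overlap TM i j" for i j u
  proof -
    have ij': "i \<in> idx M" "j \<in> idx M" using ij by simp_all
    show ?thesis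
      by (simp add: total_lift_chart ij' sv fst_overlap_cotangent[OF ij' u] lift_field_transform[OF ij' u w v \<alpha>])
  qed
qed

text \<open>Read from right to left this produces Killing fields, from left to right it completes
  the decomposition. There \<open>w\<close> is already known to be parallel, because that equation
  comes from the mixed Killing components.\<close>

lemma killing_total_lift_iff:
  assumes w: "parallel_bivector M \<Gamma> w" and v: "vector_field M v" and \<alpha>: "one_form M \<alpha>"
  shows "(\<forall>i\<in>idx TM. \<forall>u\<in>chart_range TM i. \<forall>Y Z. lie_metric (total_lift w v \<alpha> i) (pw_metric \<Gamma> i) u Y Z = 0)
    \<longleftrightarrow> integrability_condition M \<Gamma> w \<and> infinitesimal_symmetry M \<Gamma> v \<and> killing_form M \<Gamma> \<alpha>"
proof -
  let ?S = "chart_range M"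
  have key: "(\<forall>u\<in>chart_range TM i. \<forall>Y Z. lie_metric (total_lift w v \<alpha> i) (pw_metric \<Gamma> i) u Y Z = 0) \<longleftrightarrow>
    (\<forall>x\<in>?S i. \<forall>A B. (cov_form (\<Gamma> i) (\<alpha> i) x A B + cov_form (\<Gamma> i) (\<alpha> i) x B A) / 2 = 0) \<and>
    (\<forall>U X. open U \<and> U \<subseteq> ?S i \<and> smooth_on U X \<longrightarrow>
        (\<forall>x\<in>U. \<forall>A B. lie_endo (v i) (cov_vec (\<Gamma> i) X) x A B = cov_vec (\<Gamma> i) (lie_vec (v i) X) x A B)) \<and>
    (\<forall>x\<in>?S i. \<forall>A C D E.
        (w_curvature (\<Gamma> i) (w i) x A C D E + w_curvature (\<Gamma> i) (w i) x D C A E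
         + w_curvature (\<Gamma> i) (w i) x A E D C + w_curvature (\<Gamma> i) (w i) x D E A C) / 4 = 0)"
    if i: "i \<in> idx M" for i
  proof -
    interpret c: connection_chart "?S i" \<Gamma> i by (rule chart[OF i])
    have sw: "smooth_on (?S i) (w i)" and sv: "smooth_on (?S i) (v i)" and s\<alpha>: "smooth_on (?S i) (\<alpha> i)"
      using w v \<alpha> i by (simp_all add: parallel_bivector_def bivector_field_def vector_field_def one_form_def)
    have anti: "w i x $ A $ B = - (w i x $ B $ A)" and par: "cov_biv (\<Gamma> i) (w i) x C A B = 0"
      if "x \<in> ?S i" for x A B C
      using w i that unfolding parallel_bivector_def bivector_field_def by blast+
    have lie: "lie_metric (total_lift w v \<alpha> i) (pw_metric \<Gamma> i) u Y Z
       = lie_metric (lift_field (\<Gamma> i) (w i) (v i) (\<alpha> i)) (pw_metric \<Gamma> i) u Y Z"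
      if u: "u \<in> ?S i \<times> UNIV" for u Y Z
    proof -
      \<comment> \<open>The total lift is zero off the chart range but agrees with
        \<open>lift_field\<close> on an open set around \<open>u\<close>, so the derivatives at
        \<open>u\<close> agree.\<close>
      have e: "total_lift w v \<alpha> i y = lift_field (\<Gamma> i) (w i) (v i) (\<alpha> i) y" if "y \<in> ?S i \<times> UNIV" for y
        using that i sv by (auto simp: total_lift_chart)
      have "frechet_derivative (total_lift w v \<alpha> i) (at u) = frechet_derivative (lift_field (\<Gamma> i) (w i) (v i) (\<alpha> i)) (at u)"
        by (rule frechet_derivative_cong_open[OF c.open_Times_UNIV u e])
      then show ?thesis by (simp only: lie_metric_def e[OF u])
    qed
    show ?thesis
      unfolding chart_range_cotangent[OF M i]
      using c.lie_metric_lift_field_iff[OF sw sv s\<alpha> anti par] c.symmetry_iff[OF sv]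
        c.killing_form_iff[OF s\<alpha>] c.integrability_iff[where w = "w i", OF _ anti]
      by (simp add: lie)
  qed
  have conj: "(\<forall>i\<in>I. L i) \<longleftrightarrow> (\<forall>i\<in>I. C i) \<and> (P \<and> (\<forall>i\<in>I. B i)) \<and> Q \<and> (\<forall>i\<in>I. A i)"
    if "\<And>i. i \<in> I \<Longrightarrow> L i \<longleftrightarrow> A i \<and> B i \<and> C i" P Q
    for I :: "'i set" and A B C L P Q using that by blast
  show ?thesis
    unfolding integrability_condition_def infinitesimal_symmetry_def killing_form_def idx_cotangent
    by (rule conj[OF _ v \<alpha>]) (rule key)
qed

lemma killing_field_total_lift:
  assumes "parallel_bivector M \<Gamma> w" "integrability_condition M \<Gamma> w"
    "infinitesimal_symmetry M \<Gamma> v" "killing_form M \<Gamma> \<alpha>"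
  shows "killing_field TM (pw_metric \<Gamma>) (total_lift w v \<alpha>)"
proof -
  have "bivector_field M w" "vector_field M v" "one_form M \<alpha>"
    using assms by (simp_all add: parallel_bivector_def infinitesimal_symmetry_def killing_form_def)
  then show ?thesis
    unfolding killing_field_def
    using vector_field_total_lift killing_total_lift_iff[OF assms(1)] assms by blast
qed

section \<open>Killing fields on the cotangent bundle\<close>

lemma total_lift_inject:
  assumes w: "bivector_field M w" "bivector_field M w'"
    and v: "vector_field M v" "vector_field M v'" and \<alpha>: "one_form M \<alpha>" "one_form M \<alpha>'"
    and eq: "total_lift w v \<alpha> = total_lift w' v' \<alpha>'"
  shows "w = w'" "v = v'" "\<alpha> = \<alpha>'"
proof -
  have "w i x = w' i x \<and> v i x = v' i x \<and> \<alpha> i x = \<alpha>' i x" for i x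
  proof (cases "i \<in> idx M \<and> x \<in> chart_range M i")
    case True
    then have "lift_field (\<Gamma> i) (w i) (v i) (\<alpha> i) (x, p) = lift_field (\<Gamma> i) (w' i) (v' i) (\<alpha>' i) (x, p)" for p
      using total_lift_chart[of i "(x, p)" v w \<alpha>] total_lift_chart[of i "(x, p)" v' w' \<alpha>'] v eq
      by (simp add: vector_field_def)
    from lift_field_inject[OF this] show ?thesis by blast
  next
    case False
    then show ?thesis
      using w v \<alpha> by (auto simp: bivector_field_def vector_field_def one_form_def supported_def)
  qed
  then show "w = w'" "v = v'" "\<alpha> = \<alpha>'" by (simp_all add: fun_eq_iff)
qed

text \<open>In each chart \<open>killing_on_chart\<close> provides the data. Their transformation
  laws are separated from the single law of \<open>X\<close> by the freedom in \<open>p\<close>, and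
  the remaining affine equations follow from the equivalence for total lifts.\<close>

lemma killing_field_decomposition:
  assumes X: "killing_field TM (pw_metric \<Gamma>) X"
  obtains w v \<alpha> where "parallel_bivector M \<Gamma> w" "integrability_condition M \<Gamma> w"
    "infinitesimal_symmetry M \<Gamma> v" "killing_form M \<Gamma> \<alpha>" "X = total_lift w v \<alpha>"
proof -
  \<comment> \<open>\<open>on_charts\<close> sets the components to 0 off the chart ranges, as the
    notion of a field demands.\<close>
  define v where "v = on_charts M (\<lambda>i x. fst (X i (x, 0)))"
  define \<alpha> where "\<alpha> = on_charts M (\<lambda>i x. snd (X i (x, 0)))"
  define w where "w = on_charts M (\<lambda>i x. \<chi> A B. (fst (X i (x, axis A 1)) - fst (X i (x, 0))) $ B)"
  have vf: "vector_field TM X" using X by (simp add: killing_field_def)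
  have on_chart: "smooth_on (chart_range M i) (v i)" "smooth_on (chart_range M i) (\<alpha> i)"
      "smooth_on (chart_range M i) (w i)"
      "\<And>x A B. x \<in> chart_range M i \<Longrightarrow> w i x $ A $ B = - (w i x $ B $ A)"
      "\<And>x C A B. x \<in> chart_range M i \<Longrightarrow> cov_biv (\<Gamma> i) (w i) x C A B = 0"
      "\<And>u. fst u \<in> chart_range M i \<Longrightarrow> X i u = lift_field (\<Gamma> i) (w i) (v i) (\<alpha> i) u"
    if i: "i \<in> idx M" for i
  proof -
    interpret c: connection_chart "chart_range M i" \<Gamma> i by (rule chart[OF i])
    have 1: "smooth_on (chart_range M i \<times> UNIV) (X i)"
      using vf i by (simp add: vector_field_def chart_range_cotangent[OF M])
    have 2: "lie_metric (X i) (pw_metric \<Gamma> i) u Y Z = 0" if "fst u \<in> chart_range M i" for u Y Z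
      using X i that in_chart_range_cotangent[OF i] unfolding killing_field_def idx_cotangent by blast
    have 3: "v i x = fst (X i (x, 0))" "\<alpha> i x = snd (X i (x, 0))"
      "w i x = (\<chi> A B. (fst (X i (x, axis A 1)) - fst (X i (x, 0))) $ B)" if "x \<in> chart_range M i" for x
      using i that by (simp_all add: v_def \<alpha>_def w_def on_charts_def)
    note k = c.killing_on_chart[where v = "v i" and \<alpha> = "\<alpha> i" and w = "w i", OF 1 2 3]
    show "smooth_on (chart_range M i) (v i)" "smooth_on (chart_range M i) (\<alpha> i)"
      "smooth_on (chart_range M i) (w i)"
      by (rule k; assumption)+
    show "w i x $ A $ B = - (w i x $ B $ A)" if "x \<in> chart_range M i" for x A B
      using that by (rule k(4)[rotated -1])
    show "cov_biv (\<Gamma> i) (w i) x C A B = 0" if "x \<in> chart_range M i" for x C A B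
      using that by (rule k(5)[rotated -1])
    show "X i u = lift_field (\<Gamma> i) (w i) (v i) (\<alpha> i) u" if "fst u \<in> chart_range M i" for u
      using that by (rule k(6)[rotated -1])
  qed
  have law: "lift_field (\<Gamma> j) (w j) (v j) (\<alpha> j) (transition TM i j u)
      = jac TM i j u (lift_field (\<Gamma> i) (w i) (v i) (\<alpha> i) u)"
    if ij: "i \<in> idx M" "j \<in> idx M" and u: "u \<in> overlap TM i j" for i j u
  proof -
    have "X j (transition TM i j u) = jac TM i j u (X i u)"
      using vf ij u by (simp add: vector_field_def)
    then show ?thesis
      using on_chart(6)[OF ij(1)] on_chart(6)[OF ij(2)] fst_overlap_cotangent[OF ij u] by simp
  qed
  have field_laws: "v j (transition M i j x) = jac M i j x (v i x)"
    "\<alpha> i x \<bullet> h = \<alpha> j (transition M i j x) \<bullet> jac M i j x h"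
    "(\<forall>h. p \<bullet> h = p' \<bullet> jac M i j x h) \<Longrightarrow> p' v* w j (transition M i j x) = jac M i j x (p v* w i x)"
    if ij: "i \<in> idx M" "j \<in> idx M" and x: "x \<in> overlap M i j" for i j x h p p'
  proof -
    have ov: "(x, p) \<in> overlap TM i j" for p using x by (simp add: overlap_cotangent[OF M ij(1)])
    have T: "transition TM i j (x, p) = (transition M i j x, p')" if p: "\<And>h. p \<bullet> h = p' \<bullet> jac M i j x h" for p p'
    proof (rule prod_eqI)
      show "fst (transition TM i j (x, p)) = fst (transition M i j x, p')"
        by (simp add: transition_cotangent[OF M ij x])
      have "snd (transition TM i j (x, p)) = p'"
        by (rule inner_jac_eqI[OF ij x]) (simp add: transition_cotangent_inner[OF M ij x, symmetric] p)
      then show "snd (transition TM i j (x, p)) = snd (transition M i j x, p')" by simp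
    qed
    have lin: "linear (jac M i j x)" by (rule linear_jac[OF M ij x])
    \<comment> \<open>The base part of the law of \<open>X\<close>, for one covector with components
      \<open>p\<close> and \<open>p'\<close>. The zero covector isolates \<open>v\<close>, and
      subtracting its law leaves that of \<open>w\<close>.\<close>
    have base: "v j (transition M i j x) + p' v* w j (transition M i j x) = jac M i j x (v i x + p v* w i x)"
      if p: "\<And>h. p \<bullet> h = p' \<bullet> jac M i j x h" for p p'
    proof -
      obtain H where "\<And>Y. fst (jac TM i j (x, p) Y) = jac M i j (fst (x, p)) (fst Y)"
        using jac_cotangent_bundle[OF ij ov[of p]] by metis
      then show ?thesis
        using arg_cong[OF law[OF ij ov[of p]], of fst] by (simp add: T[OF p] lift_field_def)
    qed
    show vlaw: "v j (transition M i j x) = jac M i j x (v i x)"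
      using base[of 0 0] by (simp add: vector_matrix_mult_simps)
    show "p' v* w j (transition M i j x) = jac M i j x (p v* w i x)" if "\<forall>h. p \<bullet> h = p' \<bullet> jac M i j x h"
      using base[of p p'] that vlaw by (simp add: linear_add[OF lin])
    \<comment> \<open>On the zero section the second derivative of the coordinate change is paired
      with 0, so the fibre part \<alpha> transforms as a 1-form.\<close>
    have T0: "transition TM i j (x, 0) = (transition M i j x, 0)" by (rule T) simp
    obtain H where H: "\<And>Y h. snd Y \<bullet> h = snd (jac TM i j (x, 0) Y) \<bullet> jac M i j (fst (x, 0 :: real^'n)) h
        + snd (transition TM i j (x, 0)) \<bullet> H (fst Y) h"
      using jac_cotangent_bundle[OF ij ov[of 0]] by metis
    have s0: "snd (lift_field (\<Gamma> k) (w k) (v k) (\<alpha> k) (y, 0)) = \<alpha> k y" for k y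
      by (simp add: lift_field_def vec_eq_iff)
    show "\<alpha> i x \<bullet> h = \<alpha> j (transition M i j x) \<bullet> jac M i j x h"
      using H[of "lift_field (\<Gamma> i) (w i) (v i) (\<alpha> i) (x, 0)" h] law[OF ij ov[of 0]]
      by (simp add: T0 s0 flip: law[OF ij ov[of 0]])
  qed
  have sup: "supported M v" "supported M \<alpha>" "supported M w"
    by (auto simp: supported_def v_def \<alpha>_def w_def on_charts_def)
  have v: "vector_field M v"
    unfolding vector_field_def using sup on_chart field_laws(1) by blast
  have \<alpha>: "one_form M \<alpha>"
    unfolding one_form_def
  proof (intro conjI ballI)
    show "\<forall>A. \<alpha> i x $ A = (\<Sum>B\<in>UNIV. jac M i j x (axis A 1) $ B * \<alpha> j (transition M i j x) $ B)"
      if "i \<in> idx M" "j \<in> idx M" "x \<in> overlap M i j" for i j x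
      using one_form_law_iff[OF that] field_laws(2)[OF that] by blast
  qed (use sup on_chart in blast)+
  have "bivector_field M w"
    unfolding bivector_field_def
  proof (intro conjI ballI)
    show "\<forall>C D. w j (transition M i j x) $ C $ D =
        (\<Sum>A\<in>UNIV. \<Sum>B\<in>UNIV. jac M i j x (axis A 1) $ C * jac M i j x (axis B 1) $ D * w i x $ A $ B)"
      if "i \<in> idx M" "j \<in> idx M" "x \<in> overlap M i j" for i j x
      using bivector_law_iff[OF that] field_laws(3)[OF that] by blast
  qed (use sup on_chart in blast)+
  then have w: "parallel_bivector M \<Gamma> w"
    unfolding parallel_bivector_def using on_chart by blast
  have eq: "X = total_lift w v \<alpha>"
  proof (intro ext)
    fix i u
    show "X i u = total_lift w v \<alpha> i u"
    proof (cases "i \<in> idx M \<and> fst u \<in> chart_range M i")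
      case True
      then show ?thesis using on_chart(1,6)[of i] by (simp add: total_lift_chart)
    next
      case False
      then have off: "i \<notin> idx TM \<or> u \<notin> chart_range TM i" using in_chart_range_cotangent by auto
      then have "X i u = 0" using vf unfolding vector_field_def supported_def by blast
      then show ?thesis using off by (simp add: total_lift_off)
    qed
  qed
  have "\<forall>i\<in>idx TM. \<forall>u\<in>chart_range TM i. \<forall>Y Z. lie_metric (total_lift w v \<alpha> i) (pw_metric \<Gamma> i) u Y Z = 0"
    using X unfolding eq killing_field_def by blast
  then show ?thesis
    using killing_total_lift_iff[OF w v \<alpha>] by (intro that[OF w _ _ _ eq]) blast+
qed

text \<open>The zero solutions make each single lift a total lift, so that (a), (b) and (c) become
  special cases of one statement.\<close>

lemma parallel_bivector_zero: "parallel_bivector M \<Gamma> (\<lambda>_ _. 0)" "integrability_condition M \<Gamma> (\<lambda>_ _. 0)"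
  by (simp_all add: parallel_bivector_def bivector_field_def supported_def smooth_on_const cov_biv_def pd_def
      integrability_condition_def w_curvature_def)

lemma killing_form_zero: "killing_form M \<Gamma> (\<lambda>_ _. 0)"
  by (simp add: killing_form_def one_form_def supported_def smooth_on_const cov_form_def pd_def)

lemma infinitesimal_symmetry_zero: "infinitesimal_symmetry M \<Gamma> (\<lambda>_ _. 0)"
proof -
  have "vector_field M (\<lambda>_ _. 0)"
    unfolding vector_field_def
    by (simp add: supported_def smooth_on_const linear_0[OF linear_jac[OF M]])
  moreover have "lie_vec (\<lambda>_. 0) X = (\<lambda>_. 0)" for X :: "real^'n \<Rightarrow> real^'n"
    by (simp add: lie_vec_def fun_eq_iff vec_eq_iff pd_def)
  ultimately show ?thesis
    by (simp add: infinitesimal_symmetry_def lie_endo_def cov_vec_def pd_def)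
qed

lemma lifts_of_zero:
  "lift_plus M \<Gamma> (\<lambda>_ _. 0) i u = 0" "lift_minus M (\<lambda>_ _. 0) i u = 0" "lift_zero M \<Gamma> (\<lambda>_ _. 0) i u = 0"
  by (simp_all add: lift_plus_def lift_minus_def lift_zero_def on_charts_def phi_def psi_def cov_vec_def pd_def)

end

theorem theorem4:
  fixes M :: "('i, 'a, real^'n) atlas"
    and \<Gamma> :: "'i \<Rightarrow> 'n christoffel"
  assumes "CARD('n) \<ge> 2"
    and "smooth_manifold M"
    and "affine_connection M \<Gamma>"
    and "torsion_free M \<Gamma>"
    and "special M \<Gamma>"
  shows
    "(\<forall>v. infinitesimal_symmetry M \<Gamma> v \<longrightarrow>
        killing_field (cotangent_bundle M) (pw_metric \<Gamma>) (lift_zero M \<Gamma> v)) \<and>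
     (\<forall>w. parallel_bivector M \<Gamma> w \<and> integrability_condition M \<Gamma> w \<longrightarrow>
        killing_field (cotangent_bundle M) (pw_metric \<Gamma>) (lift_plus M \<Gamma> w)) \<and>
     (\<forall>\<alpha>. killing_form M \<Gamma> \<alpha> \<longrightarrow>
        killing_field (cotangent_bundle M) (pw_metric \<Gamma>) (lift_minus M \<alpha>)) \<and>
     (\<forall>X. killing_field (cotangent_bundle M) (pw_metric \<Gamma>) X \<longrightarrow>
        (\<exists>!s. case s of (w, v, \<alpha>) \<Rightarrow>
           (parallel_bivector M \<Gamma> w \<and> integrability_condition M \<Gamma> w) \<and>
           infinitesimal_symmetry M \<Gamma> v \<and>
           killing_form M \<Gamma> \<alpha> \<and>
           X = (\<lambda>i u. lift_plus M \<Gamma> w i u + lift_zero M \<Gamma> v i u + lift_minus M \<alpha> i u)))"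
proof -
  interpret affine_manifold M \<Gamma> by unfold_locales (rule assms)+
  have sum: "(\<lambda>i u. lift_plus M \<Gamma> w i u + lift_zero M \<Gamma> v i u + lift_minus M \<alpha> i u) = total_lift w v \<alpha>"
    for w v \<alpha> by (simp add: total_lift_def fun_eq_iff)
  have only: "total_lift (\<lambda>_ _. 0) v (\<lambda>_ _. 0) = lift_zero M \<Gamma> v"
    "total_lift w (\<lambda>_ _. 0) (\<lambda>_ _. 0) = lift_plus M \<Gamma> w"
    "total_lift (\<lambda>_ _. 0) (\<lambda>_ _. 0) \<alpha> = lift_minus M \<alpha>" for w v \<alpha>
    by (simp_all add: total_lift_def fun_eq_iff lifts_of_zero)
  show ?thesis
  proof (intro conjI allI impI)
    show "killing_field TM (pw_metric \<Gamma>) (lift_zero M \<Gamma> v)" if "infinitesimal_symmetry M \<Gamma> v" for v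
      using killing_field_total_lift[OF parallel_bivector_zero that killing_form_zero] by (simp only: only)
    show "killing_field TM (pw_metric \<Gamma>) (lift_plus M \<Gamma> w)"
      if "parallel_bivector M \<Gamma> w \<and> integrability_condition M \<Gamma> w" for w
      using killing_field_total_lift[OF _ _ infinitesimal_symmetry_zero killing_form_zero, of w] that
      by (simp only: only)
    show "killing_field TM (pw_metric \<Gamma>) (lift_minus M \<alpha>)" if "killing_form M \<Gamma> \<alpha>" for \<alpha>
      using killing_field_total_lift[OF parallel_bivector_zero infinitesimal_symmetry_zero that] by (simp only: only)
    fix X assume "killing_field TM (pw_metric \<Gamma>) X"
    then obtain w v \<alpha> where s: "parallel_bivector M \<Gamma> w" "integrability_condition M \<Gamma> w"
      "infinitesimal_symmetry M \<Gamma> v" "killing_form M \<Gamma> \<alpha>" and X: "X = total_lift w v \<alpha>"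
      by (rule killing_field_decomposition)
    show "\<exists>!s. case s of (w, v, \<alpha>) \<Rightarrow>
           (parallel_bivector M \<Gamma> w \<and> integrability_condition M \<Gamma> w) \<and>
           infinitesimal_symmetry M \<Gamma> v \<and>
           killing_form M \<Gamma> \<alpha> \<and>
           X = (\<lambda>i u. lift_plus M \<Gamma> w i u + lift_zero M \<Gamma> v i u + lift_minus M \<alpha> i u)"
      unfolding sum
    proof (rule ex1I[of _ "(w, v, \<alpha>)"])
      fix s assume *: "case s of (w, v, \<alpha>) \<Rightarrow>
           (parallel_bivector M \<Gamma> w \<and> integrability_condition M \<Gamma> w) \<and>
           infinitesimal_symmetry M \<Gamma> v \<and> killing_form M \<Gamma> \<alpha> \<and> X = total_lift w v \<alpha>"
      obtain w' v' \<alpha>' where s': "s = (w', v', \<alpha>')" by (cases s)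
      have f: "bivector_field M w'" "bivector_field M w" "vector_field M v'" "vector_field M v"
        "one_form M \<alpha>'" "one_form M \<alpha>" and e: "total_lift w' v' \<alpha>' = total_lift w v \<alpha>"
        using * s X by (simp_all add: s' parallel_bivector_def infinitesimal_symmetry_def killing_form_def)
      show "s = (w, v, \<alpha>)" using total_lift_inject[OF f e] by (simp add: s')
    qed (use s X in simp)
  qed
qed

end
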